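(* For any $\epsilon>0$ there is some $C_\epsilon\ge 0$ such that instances of \textsc{Capacitated Graph Pricing} on simple graphs satisfying $\mu_v\ge C_\epsilon$ for every vertex $v$ admit a randomized polynomial-time $(4+\epsilon)$-approximation algorithm.
   Context: A graph is simple if it has no parallel edges. An instance of \textsc{Capacitated Graph Pricing} consists of a finite graph $G=(V,E)$ (no loops), capacities $\mu_v\in\mathbb Z_{\ge0}\cup\{\infty\}$ for $v\in V$ and budgets $b_e\ge 0$ for $e\in E$ (edge $e=uv$ is a customer interested in bundle $\{u,v\}$). A feasible solution is a pair $(p,F)$ with $p:V\to\mathbb R_{\ge 0}$ and $F\subseteq E$ such that $p(u)+p(v)\le b_e$ for every $e=uv\in F$ and every vertex $w$ is incident to at most $\mu_w$ edges of $F$; its revenue is $\sum_{e=uv\in F}(p(u)+p(v))$, to be maximized. A randomized $\alpha$-approximation algorithm outputs a feasible solution whose expected revenue is at least $1/\alpha$ times the optimum revenue. *)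

theory Defs
  imports
    "HOL-Probability.Probability"
    "HOL-Computational_Algebra.Polynomial"
    "HOL-Library.Log_Nat"
    "HOL-Library.Extended_Nat"
begin

section \<open>Capacitated graph pricing\<close>

text \<open>Edges carry names, so parallel edges are possible; \<open>ends e\<close> is the set of the two
  endpoints of \<open>e\<close>, i.e. the bundle that customer \<open>e\<close> is interested in.\<close>

record ('v, 'e) cgp =
  verts :: "'v set"
  edges :: "'e set"
  ends :: "'e \<Rightarrow> 'v set"
  cap :: "'v \<Rightarrow> enat"
  budget :: "'e \<Rightarrow> real"

definition cgp_instance :: "('v, 'e) cgp \<Rightarrow> bool" where
  "cgp_instance I \<longleftrightarrow>
     finite (verts I) \<and> finite (edges I) \<and>
     (\<forall>e\<in>edges I. ends I e \<subseteq> verts I \<and> card (ends I e) = 2 \<and> 0 \<le> budget I e)"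

definition simple_graph :: "('v, 'e) cgp \<Rightarrow> bool" where
  "simple_graph I \<longleftrightarrow> inj_on (ends I) (edges I)"

text \<open>As \<open>ends I e\<close> has two elements \<open>u\<close> and \<open>v\<close>, this is \<open>p u + p v\<close>.\<close>

definition bundle_price :: "('v, 'e) cgp \<Rightarrow> ('v \<Rightarrow> real) \<Rightarrow> 'e \<Rightarrow> real" where
  "bundle_price I p e = (\<Sum>v\<in>ends I e. p v)"

definition feasible :: "('v, 'e) cgp \<Rightarrow> ('v \<Rightarrow> real) \<Rightarrow> 'e set \<Rightarrow> bool" where
  "feasible I p F \<longleftrightarrow>
     (\<forall>v\<in>verts I. 0 \<le> p v) \<and>
     F \<subseteq> edges I \<and>
     (\<forall>e\<in>F. bundle_price I p e \<le> budget I e) \<and>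
     (\<forall>w\<in>verts I. enat (card {e\<in>F. w \<in> ends I e}) \<le> cap I w)"

definition revenue :: "('v, 'e) cgp \<Rightarrow> ('v \<Rightarrow> real) \<Rightarrow> 'e set \<Rightarrow> real" where
  "revenue I p F = (\<Sum>e\<in>F. bundle_price I p e)"

definition opt :: "('v, 'e) cgp \<Rightarrow> real" where
  "opt I = Sup {revenue I p F | p F. feasible I p F}"

text \<open>The supremum is taken over a nonempty set of reals that is bounded above.\<close>

lemma feasible_empty: "feasible I (\<lambda>_. 0) {}"
  by (simp add: feasible_def flip: zero_enat_def)

lemma revenue_bounded:
  assumes "cgp_instance I" "feasible I p F"
  shows "revenue I p F \<le> (\<Sum>e\<in>edges I. budget I e)"
proof -
  have "revenue I p F \<le> (\<Sum>e\<in>F. budget I e)"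
    unfolding revenue_def using assms(2) by (intro sum_mono) (auto simp: feasible_def)
  also have "\<dots> \<le> (\<Sum>e\<in>edges I. budget I e)"
    using assms by (intro sum_mono2) (auto simp: feasible_def cgp_instance_def)
  finally show ?thesis .
qed


section \<open>Randomized random access machines with logarithmic cost\<close>

text \<open>A program works on finitely many registers and on an indirectly addressed memory, all
  holding natural numbers. \<open>Sub\<close> is truncated subtraction and \<open>Div\<close> is integer division.\<close>

record state =
  reg :: "nat \<Rightarrow> nat"
  mem :: "nat \<Rightarrow> nat"

datatype aexp =
    Const nat
  | Reg nat
  | Load aexp
  | Add aexp aexp
  | Sub aexp aexp
  | Mul aexp aexp
  | Div aexp aexp

datatype com =
    Skip
  | Assign nat aexp
  | Store aexp aexp
  | Flip nat
  | Seq com com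
  | IfNZ aexp com com
  | WhileNZ aexp com

fun aval :: "state \<Rightarrow> aexp \<Rightarrow> nat" where
  "aval s (Const n) = n"
| "aval s (Reg x) = reg s x"
| "aval s (Load a) = mem s (aval s a)"
| "aval s (Add a b) = aval s a + aval s b"
| "aval s (Sub a b) = aval s a - aval s b"
| "aval s (Mul a b) = aval s a * aval s b"
| "aval s (Div a b) = aval s a div aval s b"

definition bits :: "nat \<Rightarrow> nat" where
  "bits n = Suc (floorlog 2 n)"

text \<open>The cost of an expression is the total bit length of the values of its subexpressions,
  which include all operands and all memory addresses in use.\<close>

fun acost :: "state \<Rightarrow> aexp \<Rightarrow> nat" where
  "acost s (Const n) = bits n"
| "acost s (Reg x) = bits (reg s x)"
| "acost s (Load a) = acost s a + bits (aval s (Load a))"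
| "acost s (Add a b) = acost s a + acost s b + bits (aval s (Add a b))"
| "acost s (Sub a b) = acost s a + acost s b + bits (aval s (Sub a b))"
| "acost s (Mul a b) = acost s a + acost s b + bits (aval s (Mul a b))"
| "acost s (Div a b) = acost s a + acost s b + bits (aval s (Div a b))"

text \<open>\<open>exec c s r s' r' t\<close>: started in state \<open>s\<close> with the sequence \<open>r\<close> of coin tosses at its
  disposal, \<open>c\<close> terminates in state \<open>s'\<close> at cost \<open>t\<close>, with the coin tosses \<open>r'\<close> left over.
  A \<open>Flip\<close> without coin tosses left is stuck.\<close>

inductive exec :: "com \<Rightarrow> state \<Rightarrow> bool list \<Rightarrow> state \<Rightarrow> bool list \<Rightarrow> nat \<Rightarrow> bool" where
  Skip: "exec Skip s r s r 1"
| Assign: "exec (Assign x a) s r (s\<lparr>reg := (reg s)(x := aval s a)\<rparr>) r (Suc (acost s a))"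
| Store: "exec (Store a b) s r (s\<lparr>mem := (mem s)(aval s a := aval s b)\<rparr>) r
            (Suc (acost s a + acost s b))"
| Flip: "exec (Flip x) s (b # r) (s\<lparr>reg := (reg s)(x := of_bool b)\<rparr>) r 1"
| Seq: "\<lbrakk>exec c1 s r s1 r1 t1; exec c2 s1 r1 s2 r2 t2\<rbrakk> \<Longrightarrow>
          exec (Seq c1 c2) s r s2 r2 (t1 + t2)"
| IfT: "\<lbrakk>aval s a \<noteq> 0; exec c1 s r s' r' t\<rbrakk> \<Longrightarrow>
          exec (IfNZ a c1 c2) s r s' r' (Suc (acost s a + t))"
| IfF: "\<lbrakk>aval s a = 0; exec c2 s r s' r' t\<rbrakk> \<Longrightarrow>
          exec (IfNZ a c1 c2) s r s' r' (Suc (acost s a + t))"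
| WhileT: "\<lbrakk>aval s a \<noteq> 0; exec c s r s1 r1 t1; exec (WhileNZ a c) s1 r1 s2 r2 t2\<rbrakk> \<Longrightarrow>
          exec (WhileNZ a c) s r s2 r2 (Suc (acost s a + t1 + t2))"
| WhileF: "aval s a = 0 \<Longrightarrow> exec (WhileNZ a c) s r s r (Suc (acost s a))"

inductive_cases exec_elims:
  "exec Skip s r s' r' t"
  "exec (Assign x a) s r s' r' t"
  "exec (Store a b) s r s' r' t"
  "exec (Flip x) s r s' r' t"
  "exec (Seq c1 c2) s r s' r' t"
  "exec (IfNZ a c1 c2) s r s' r' t"
  "exec (WhileNZ a c) s r s' r' t"

lemma exec_deterministic:
  "exec c s r s1 r1 t1 \<Longrightarrow> exec c s r s2 r2 t2 \<Longrightarrow> s2 = s1 \<and> r2 = r1 \<and> t2 = t1"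
proof (induction arbitrary: s2 r2 t2 rule: exec.induct)
  case Skip
  then show ?case by (rule exec_elims) simp
next
  case Assign
  then show ?case by (rule exec_elims) simp
next
  case Store
  then show ?case by (rule exec_elims) simp
next
  case Flip
  then show ?case by (rule exec_elims) simp
next
  case Seq
  show ?case using Seq.prems by (rule exec_elims) (auto dest!: Seq.IH)
next
  case IfT
  show ?case using IfT.prems by (rule exec_elims) (use IfT.hyps in \<open>auto dest: IfT.IH\<close>)
next
  case IfF
  show ?case using IfF.prems by (rule exec_elims) (use IfF.hyps in \<open>auto dest: IfF.IH\<close>)
next
  case WhileT
  show ?case using WhileT.prems by (rule exec_elims) (use WhileT.hyps in \<open>auto dest!: WhileT.IH\<close>)
next
  case WhileF
  show ?case using WhileF.prems by (rule exec_elims) (use WhileF.hyps in auto)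
qed

text \<open>Inputs and outputs are lists of numbers stored in the memory cells \<open>0, 1, \<dots>\<close>, with the
  length of the list in register \<open>0\<close>.\<close>

definition init_state :: "nat list \<Rightarrow> state" where
  "init_state xs =
     \<lparr>reg = (\<lambda>_. 0)(0 := length xs), mem = (\<lambda>i. if i < length xs then xs ! i else 0)\<rparr>"

definition output_of :: "state \<Rightarrow> nat list" where
  "output_of s = map (mem s) [0..<reg s 0]"

definition computes_within :: "com \<Rightarrow> nat list \<Rightarrow> bool list \<Rightarrow> nat list \<Rightarrow> nat \<Rightarrow> bool" where
  "computes_within c xs r ys T \<longleftrightarrow>
     (\<exists>s r' t. exec c (init_state xs) r s r' t \<and> t \<le> T \<and> output_of s = ys)"

definition input_size :: "nat list \<Rightarrow> nat" where
  "input_size xs = (\<Sum>x\<leftarrow>xs. bits x)"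


section \<open>Approximation algorithms\<close>

text \<open>For the purpose of computation the vertices and the edges are numbered consecutively
  and the budgets are rational, given by numerator and denominator in binary.\<close>

fun cap_code :: "enat \<Rightarrow> nat" where
  "cap_code (enat k) = Suc k"
| "cap_code \<infinity> = 0"

definition encodes_instance :: "nat list \<Rightarrow> (nat, nat) cgp \<Rightarrow> bool" where
  "encodes_instance xs I \<longleftrightarrow>
     (\<exists>n m u v a d.
        verts I = {..<n} \<and> edges I = {..<m} \<and>
        (\<forall>e<m. ends I e = {u e, v e} \<and> d e > 0 \<and> budget I e = real (a e) / real (d e)) \<and>
        xs = [n, m] @ map (\<lambda>w. cap_code (cap I w)) [0..<n]
               @ concat (map (\<lambda>e. [u e, v e, a e, d e]) [0..<m]))"

definition encodes_solution ::
    "nat list \<Rightarrow> (nat, nat) cgp \<Rightarrow> (nat \<Rightarrow> real) \<Rightarrow> nat set \<Rightarrow> bool" where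
  "encodes_solution ys I p F \<longleftrightarrow>
     (\<exists>a d.
        (\<forall>v\<in>verts I. d v > 0 \<and> p v = real (a v) / real (d v)) \<and>
        ys = concat (map (\<lambda>v. [a v, d v]) [0..<card (verts I)])
               @ map (\<lambda>e. of_bool (e \<in> F)) [0..<card (edges I)])"

text \<open>The algorithm is only required to work on the instances in \<open>\<I>\<close>. As every coin toss costs at
  least one unit of time, a run of cost at most \<open>T\<close> cannot exhaust a sequence of \<open>T\<close> coin
  tosses. The solution \<open>(p r, F r)\<close> is the one output by the run with coin tosses \<open>r\<close>.\<close>

definition admits_randomized_polytime_approx :: "real \<Rightarrow> (nat, nat) cgp set \<Rightarrow> bool" where
  "admits_randomized_polytime_approx \<alpha> \<I> \<longleftrightarrow>
     (\<exists>(c :: com) (q :: nat poly). \<forall>I\<in>\<I>. \<forall>xs. encodes_instance xs I \<longrightarrow>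
        (let T = poly q (input_size xs) in
         \<exists>(p :: bool list \<Rightarrow> nat \<Rightarrow> real) (F :: bool list \<Rightarrow> nat set).
           (\<forall>r. length r = T \<longrightarrow>
              feasible I (p r) (F r) \<and>
              (\<exists>ys. computes_within c xs r ys T \<and> encodes_solution ys I (p r) (F r))) \<and>
           measure_pmf.expectation (pmf_of_set {r. length r = T}) (\<lambda>r. revenue I (p r) (F r))
             \<ge> 1 / \<alpha> * opt I))"

end

theory Submission
  imports Defs
begin

text \<open>Split the vertices at random into a free side and a priced side; in expectation a quarter of
  any revenue is paid for priced vertices by edges joining the sides. With Lagrange multipliers
  for the capacities of the free side, the problem decomposes: each priced vertex chooses a price and
  its cheapest admissible edges optimally by itself. Updating the multipliers by gradient
  steps over polynomially many rounds makes the average of the responses nearly optimal, with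
  average loads just above slightly reduced capacities. Finally every priced vertex picks one of the
  rounds at random, and a free vertex drops the edges in excess of its capacity. As the graph is
  simple, the edges at a free vertex are chosen independently, so an exponential moment bound shows
  that an edge is dropped with small probability once all capacities exceed a constant.\<close>

section \<open>Compiling expressions to the random access machine\<close>

text \<open>A single round may overload the free vertices badly; only the average over all rounds
  nearly respects the capacities. A vertex therefore takes its price and its edges from the same
  round, while different vertices draw rounds independently. The average is controlled because an
  edge is admissible only if its multiplier is strictly below its price: a huge multiplier stops all
  load, so multipliers stay bounded, and after \<open>N + m\<close> rounds the average load exceeds
  its target by at most one. The gradient steps cost an additive error, made at most a fraction
  \<open>1 / (2 * k)\<close> of the largest budget; one edge sold at its full budget shows that this
  is at most the same fraction of the optimum. Reduced capacities and dropped edges cost a factor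
  \<open>1 - 1 / k\<close> each, so \<open>k\<close> of order \<open>1 / \<epsilon>\<close>
  suffices. On the machine side, denominators are cleared, ties are broken by indices, and the
  number of rounds is a power of two so that coins select one exactly uniformly. The calculation
  consists of expressions with a fixed nesting of bounded loops, so that polynomial time follows
  from their shape alone.\<close>

definition runs :: "com \<Rightarrow> state \<Rightarrow> bool list \<Rightarrow> state \<Rightarrow> bool list \<Rightarrow> nat \<Rightarrow> bool" where
  "runs c s r s' r' T \<longleftrightarrow> (\<exists>t\<le>T. exec c s r s' r' t)"

lemma runs_mono: "runs c s r s' r' T \<Longrightarrow> T \<le> T' \<Longrightarrow> runs c s r s' r' T'"
  unfolding runs_def by (meson order.trans)

lemma runs_Assign:
  "Suc (acost s a) \<le> T \<Longrightarrow> runs (Assign x a) s r (s\<lparr>reg := (reg s)(x := aval s a)\<rparr>) r T"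
  using exec.Assign by (auto simp: runs_def)

lemma runs_Store:
  "Suc (acost s a + acost s b) \<le> T \<Longrightarrow>
    runs (Store a b) s r (s\<lparr>mem := (mem s)(aval s a := aval s b)\<rparr>) r T"
  using exec.Store by (auto simp: runs_def)

lemma runs_Flip:
  "1 \<le> T \<Longrightarrow> runs (Flip x) s (b # r) (s\<lparr>reg := (reg s)(x := of_bool b)\<rparr>) r T"
  unfolding runs_def by (intro exI[of _ 1] conjI exec.Flip)

lemma runs_Seq:
  assumes "runs c1 s r s1 r1 T1" "runs c2 s1 r1 s2 r2 T2" "T1 + T2 \<le> T"
  shows "runs (Seq c1 c2) s r s2 r2 T"
proof -
  obtain t1 t2 where "t1 \<le> T1" "exec c1 s r s1 r1 t1" "t2 \<le> T2" "exec c2 s1 r1 s2 r2 t2"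
    using assms unfolding runs_def by blast
  then show ?thesis
    using assms(3) exec.Seq[of c1 s r s1 r1 t1 c2 s2 r2 t2] unfolding runs_def
    by (intro exI[of _ "t1 + t2"]) auto
qed

lemma bits_le: "n < 2 ^ p \<Longrightarrow> bits n \<le> Suc p"
  by (simp add: bits_def floorlog_le_iff)

lemma bits_gt: "n < 2 ^ bits n"
  using floorlog_bounds[of n 2] by (cases "n = 0") (auto simp: bits_def)

text \<open>The loop test is the difference of the bound and the counter, which is zero exactly when
  the count is complete. Each of the \<open>N + 1\<close> tests handles three numbers of at most
  \<open>A + 1\<close> bits, hence \<open>3 * A + 4\<close> beside the cost \<open>T\<close> of the
  body. The invariant sees the remaining coins, as the body may toss some.\<close>

lemma runs_count_loop:
  assumes inv: "\<And>i s r. i \<le> N \<Longrightarrow> Inv i s r \<Longrightarrow> reg s x = i \<and> reg s y = N"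
    and step: "\<And>i s r. i < N \<Longrightarrow> Inv i s r \<Longrightarrow> \<exists>s' r'. runs c s r s' r' T \<and> Inv (Suc i) s' r'"
    and start: "Inv 0 s r"
    and big: "N < 2 ^ A"
  shows "\<exists>s' r'. runs (WhileNZ (Sub (Reg y) (Reg x)) c) s r s' r' (Suc N * (T + 3 * A + 4)) \<and> Inv N s' r'"
proof -
  have cost: "acost s (Sub (Reg y) (Reg x)) \<le> 3 * A + 3" if "Inv i s r" "i \<le> N" for i s r
  proof -
    have "bits v \<le> Suc A" if "v \<le> N" for v
      using that big by (intro bits_le) simp
    from this[of N] this[of i] this[of "N - i"] show ?thesis
      using inv[OF that(2,1)] that(2) by simp
  qed
  have "\<exists>s' r'. runs (WhileNZ (Sub (Reg y) (Reg x)) c) s r s' r' (Suc d * (T + 3 * A + 4)) \<and> Inv N s' r'"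
    if "Inv i s r" "i + d = N" for d i s r
    using that
  proof (induction d arbitrary: i s r)
    case 0
    then have "exec (WhileNZ (Sub (Reg y) (Reg x)) c) s r s r (Suc (acost s (Sub (Reg y) (Reg x))))"
      using inv[of i s r] by (intro exec.WhileF) auto
    then show ?case
      using 0 cost[of i s r] unfolding runs_def
      by (intro exI[of _ s] exI[of _ r] exI[of _ "Suc (acost s (Sub (Reg y) (Reg x)))"] conjI)
        (simp_all del: acost.simps)
  next
    case (Suc d)
    obtain s1 r1 where 1: "runs c s r s1 r1 T" "Inv (Suc i) s1 r1"
      using step[of i s r] Suc by auto
    obtain s2 r2 where 2: "runs (WhileNZ (Sub (Reg y) (Reg x)) c) s1 r1 s2 r2 (Suc d * (T + 3 * A + 4))"
      "Inv N s2 r2"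
      using Suc.IH[OF 1(2)] Suc.prems by auto
    obtain t1 t2 where t: "t1 \<le> T" "exec c s r s1 r1 t1" "t2 \<le> Suc d * (T + 3 * A + 4)"
      "exec (WhileNZ (Sub (Reg y) (Reg x)) c) s1 r1 s2 r2 t2"
      using 1 2 unfolding runs_def by blast
    have "exec (WhileNZ (Sub (Reg y) (Reg x)) c) s r s2 r2 (Suc (acost s (Sub (Reg y) (Reg x)) + t1 + t2))"
      using t inv[of i s r] Suc.prems by (intro exec.WhileT) auto
    moreover have "Suc (acost s (Sub (Reg y) (Reg x)) + t1 + t2) \<le> Suc (Suc d) * (T + 3 * A + 4)"
      using cost[of i s r] t Suc.prems by (simp del: acost.simps)
    ultimately show ?case
      using 2(2) unfolding runs_def by blast
  qed
  from this[OF start, of N] show ?thesis by simp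
qed

section \<open>Arithmetic expressions with bounded folds, their compilation and cost\<close>

datatype bop = Plus | Minus | Times | Quotient

text \<open>Loops are part of the expressions: \<open>Fold h c x y b\<close> combines, starting from
  \<open>c\<close>, the values of \<open>b\<close> with register \<open>x\<close> running below the
  content of register \<open>y\<close>. Every expression then has a total value \<open>den\<close>,
  so correctness of the program becomes equational reasoning, and its cost is bounded once for all
  expressions.\<close>

datatype sexp =
    Num nat
  | Var nat
  | Ld sexp
  | Bin bop sexp sexp
  | Fold bop nat nat nat sexp

fun bapp :: "bop \<Rightarrow> nat \<Rightarrow> nat \<Rightarrow> nat" where
  "bapp Plus a b = a + b"
| "bapp Minus a b = a - b"
| "bapp Times a b = a * b"
| "bapp Quotient a b = a div b"

fun baexp :: "bop \<Rightarrow> aexp \<Rightarrow> aexp \<Rightarrow> aexp" where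
  "baexp Plus a b = Add a b"
| "baexp Minus a b = Sub a b"
| "baexp Times a b = Mul a b"
| "baexp Quotient a b = Div a b"

fun iter :: "bop \<Rightarrow> nat \<Rightarrow> nat \<Rightarrow> (nat \<Rightarrow> nat) \<Rightarrow> nat" where
  "iter h c 0 f = c"
| "iter h c (Suc i) f = bapp h (iter h c i f) (f i)"

lemma iter_Plus [simp]: "iter Plus 0 N f = (\<Sum>i<N. f i)"
  by (induction N) auto

lemma iter_Times [simp]: "iter Times (Suc 0) N f = (\<Prod>i<N. f i)"
  by (induction N) auto

fun den :: "sexp \<Rightarrow> (nat \<Rightarrow> nat) \<Rightarrow> (nat \<Rightarrow> nat) \<Rightarrow> nat" where
  "den (Num c) \<rho> M = c"
| "den (Var x) \<rho> M = \<rho> x"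
| "den (Ld a) \<rho> M = M (den a \<rho> M)"
| "den (Bin h a b) \<rho> M = bapp h (den a \<rho> M) (den b \<rho> M)"
| "den (Fold h c x y b) \<rho> M = iter h c (\<rho> y) (\<lambda>i. den b (\<rho>(x := i)) M)"

text \<open>Registers below 40 hold numbers that are small enough to bound a loop; registers from 60 on
  are used for temporary values.\<close>

fun wf_sexp :: "sexp \<Rightarrow> bool" where
  "wf_sexp (Num c) = True"
| "wf_sexp (Var x) = (x < 60)"
| "wf_sexp (Ld a) = wf_sexp a"
| "wf_sexp (Bin h a b) = (wf_sexp a \<and> wf_sexp b)"
| "wf_sexp (Fold h c x y b) = (x < 40 \<and> y < 40 \<and> x \<noteq> y \<and> wf_sexp b)"

text \<open>The value ends up in register \<open>k\<close>, registers below \<open>k\<close> are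
  left as they were, and everything above is scratch space. A fold therefore saves its loop register
  in \<open>k + 1\<close> and restores it at the end.\<close>

fun comp :: "sexp \<Rightarrow> nat \<Rightarrow> com" where
  "comp (Num c) k = Assign k (Const c)"
| "comp (Var x) k = Assign k (Reg x)"
| "comp (Ld a) k = Seq (comp a k) (Assign k (Load (Reg k)))"
| "comp (Bin h a b) k =
     Seq (comp a k) (Seq (comp b (Suc k)) (Assign k (baexp h (Reg k) (Reg (Suc k)))))"
| "comp (Fold h c x y b) k =
     Seq (Assign k (Const c)) (Seq (Assign (k + 1) (Reg x)) (Seq (Assign x (Const 0)) (Seq
       (WhileNZ (Sub (Reg y) (Reg x))
         (Seq (comp b (k + 2)) (Seq (Assign k (baexp h (Reg k) (Reg (k + 2))))
           (Assign x (Add (Reg x) (Const 1))))))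
       (Assign x (Reg (k + 1))))))"

lemma den_cong:
  "wf_sexp e \<Longrightarrow> (\<And>i. i < 60 \<Longrightarrow> \<rho> i = \<rho>' i) \<Longrightarrow> den e \<rho> M = den e \<rho>' M"
proof (induction e arbitrary: \<rho> \<rho>')
  case (Fold h c x y b)
  have "den b (\<rho>(x := i)) M = den b (\<rho>'(x := i)) M" for i
    by (rule Fold.IH) (use Fold.prems in simp_all)
  moreover have "\<rho> y = \<rho>' y"
    using Fold.prems by simp
  ultimately show ?case by simp
next
  case (Ld e)
  from Ld.prems have "den e \<rho> M = den e \<rho>' M" by (intro Ld.IH) simp_all
  then show ?case by simp
next
  case (Bin h a b)
  have "den a \<rho> M = den a \<rho>' M"
    by (rule Bin.IH(1)) (use Bin.prems in simp_all)
  moreover have "den b \<rho> M = den b \<rho>' M"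
    by (rule Bin.IH(2)) (use Bin.prems in simp_all)
  ultimately show ?case by simp
qed auto

text \<open>One parameter for two scales: registers below 40, which may bound loops, have values of
  at most \<open>A\<close>, whereas all other data have at most \<open>A\<close> bits. With
  \<open>A\<close> polynomial in the input size, loops are short and numbers are short.\<close>

definition small :: "nat \<Rightarrow> (nat \<Rightarrow> nat) \<Rightarrow> (nat \<Rightarrow> nat) \<Rightarrow> bool" where
  "small A \<rho> M \<longleftrightarrow> (\<forall>i<40. \<rho> i \<le> A) \<and> (\<forall>i<60. \<rho> i < 2 ^ A) \<and> (\<forall>i. M i < 2 ^ A)"

lemma smallD:
  assumes "small A \<rho> M"
  shows "i < 40 \<Longrightarrow> \<rho> i \<le> A" "i < 60 \<Longrightarrow> \<rho> i < 2 ^ A" "M a < 2 ^ A"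
  using assms by (auto simp: small_def)

lemma small_upd: "small A \<rho> M \<Longrightarrow> i \<le> A \<Longrightarrow> small A (\<rho>(x := i)) M"
  using order.strict_trans1[OF _ less_exp, of i A] by (auto simp: small_def)

text \<open>Powers of \<open>A + 2\<close> replace polynomials: the base is at least 2, so
  constants, sums and products are absorbed by raising the exponent.\<close>

definition pbd :: "(nat \<Rightarrow> nat) \<Rightarrow> bool" where
  "pbd f \<longleftrightarrow> (\<exists>d. \<forall>A. f A \<le> (A + 2) ^ d)"

lemma pbd_const [intro, simp]: "pbd (\<lambda>A. c)"
proof -
  have "c \<le> (A + 2) ^ c" for A :: nat
    using order.trans[OF less_imp_le[OF less_exp] power_mono[of 2 "A + 2" c]] by simp
  then show ?thesis unfolding pbd_def by blast
qed

lemma pbd_id [intro, simp]: "pbd (\<lambda>A. A)"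
  unfolding pbd_def by (intro exI[of _ 1]) auto

lemma pbd_mult [intro, simp]: "pbd f \<Longrightarrow> pbd g \<Longrightarrow> pbd (\<lambda>A. f A * g A)"
  unfolding pbd_def by (metis mult_le_mono power_add)

lemma pbd_add [intro, simp]:
  assumes "pbd f" "pbd g" shows "pbd (\<lambda>A. f A + g A)"
proof -
  obtain d d' where d: "f A \<le> (A + 2) ^ d" "g A \<le> (A + 2) ^ d'" for A
    using assms unfolding pbd_def by blast
  have "f A + g A \<le> (A + 2) ^ Suc (d + d')" for A
  proof -
    have "f A + g A \<le> (A + 2) ^ (d + d') + (A + 2) ^ (d + d')"
      using d[of A] by (intro add_mono) (auto intro: order.trans[OF _ power_increasing])
    also have "\<dots> \<le> (A + 2) ^ Suc (d + d')" by simp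
    finally show ?thesis .
  qed
  then show ?thesis unfolding pbd_def by blast
qed

lemma pbd_Suc [intro, simp]: "pbd f \<Longrightarrow> pbd (\<lambda>A. Suc (f A))"
  using pbd_add[of f "\<lambda>_. 1"] by simp

lemma pbd_pow [intro, simp]: "pbd f \<Longrightarrow> pbd (\<lambda>A. f A ^ c)"
  by (induction c) auto

lemma pbd_comp:
  assumes "pbd f" "pbd g" shows "pbd (\<lambda>A. f (g A))"
proof -
  obtain d where d: "f A \<le> (A + 2) ^ d" for A
    using assms unfolding pbd_def by blast
  obtain d' where d': "(g A + 2) ^ d \<le> (A + 2) ^ d'" for A
    using pbd_pow[OF pbd_add[OF assms(2) pbd_const[of 2]], of d] unfolding pbd_def by blast
  show ?thesis
    unfolding pbd_def using order.trans[OF d d'] by blast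
qed

text \<open>Adding exponents works for all four operations at once. For sums this needs positive
  exponents, since \<open>2 ^ p + 2 ^ q \<le> 2 ^ p * 2 ^ q\<close> requires both factors to be at
  least 2.\<close>

lemma bapp_less:
  assumes "a < 2 ^ p" "b < 2 ^ q" "0 < p" "0 < q"
  shows "bapp h a b < 2 ^ (p + q)"
proof (cases h)
  case Plus
  have "(2::nat) ^ 1 \<le> 2 ^ p" "(2::nat) ^ 1 \<le> 2 ^ q"
    using assms(3,4) by (intro power_increasing; simp)+
  then obtain x y where "(2::nat) ^ p = 2 + x" "(2::nat) ^ q = 2 + y"
    by (metis le_Suc_ex power_one_right)
  then have "(2::nat) ^ p + 2 ^ q \<le> 2 ^ p * 2 ^ q"
    by (simp add: algebra_simps)
  then show ?thesis
    using assms Plus by (simp add: power_add)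
next
  case Minus
  then show ?thesis
    using less_le_trans[OF assms(1) power_increasing[of p "p + q" "2::nat"]] by simp
next
  case Quotient
  then show ?thesis
    using less_le_trans[OF assms(1) power_increasing[of p "p + q" "2::nat"]]
      le_less_trans[OF div_le_dividend] by simp
next
  case Times
  then show ?thesis
    using assms by (simp add: power_add mult_strict_mono')
qed

text \<open>Each step adds at most \<open>q\<close> bits, so even an iterated product stays
  polynomially long.\<close>

lemma iter_less:
  assumes "\<And>i. i < N \<Longrightarrow> f i < 2 ^ q" "0 < q" "i \<le> N"
  shows "iter h c i f < 2 ^ (Suc c + i * q)"
  using assms(3)
proof (induction i)
  case 0
  have "c < 2 ^ Suc c"
    using less_exp[of c] power_increasing[of c "Suc c" "2::nat"] by linarith
  then show ?case by simp
next
  case (Suc i)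
  then have "bapp h (iter h c i f) (f i) < 2 ^ ((Suc c + i * q) + q)"
    using assms by (intro bapp_less) auto
  then show ?case by (simp add: add_ac)
qed

lemma aval_baexp [simp]: "aval s (baexp h a b) = bapp h (aval s a) (aval s b)"
  by (cases h) auto

lemma acost_baexp:
  assumes "reg s i < 2 ^ p" "reg s j < 2 ^ q" "0 < p" "0 < q"
  shows "acost s (baexp h (Reg i) (Reg j)) \<le> 2 * (p + q) + 3"
  using bits_le[OF assms(1)] bits_le[OF assms(2)] bits_le[OF bapp_less[OF assms, of h]]
  by (cases h; simp)+

abbreviation sval :: "sexp \<Rightarrow> state \<Rightarrow> nat" where
  "sval e s \<equiv> den e (reg s) (mem s)"

definition computes :: "nat \<Rightarrow> com \<Rightarrow> sexp \<Rightarrow> state \<Rightarrow> bool list \<Rightarrow> nat \<Rightarrow> bool" where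
  "computes k c e s r T \<longleftrightarrow> (\<exists>s'. runs c s r s' r T \<and> reg s' k = sval e s \<and>
     (\<forall>i<k. reg s' i = reg s i) \<and> mem s' = mem s)"

text \<open>The same \<open>f\<close> bounds the bit length of the value and the running time, which
  lets the induction over expressions carry a single function.\<close>

definition evals :: "nat \<Rightarrow> com \<Rightarrow> sexp \<Rightarrow> (nat \<Rightarrow> nat) \<Rightarrow> bool" where
  "evals k c e f \<longleftrightarrow> (\<forall>A s r. small A (reg s) (mem s) \<longrightarrow>
     sval e s < 2 ^ f A \<and> computes k c e s r (f A))"

lemma evals_witness:
  "runs c s r t r T \<Longrightarrow> reg t k = sval e s \<Longrightarrow> \<forall>i<k. reg t i = reg s i \<Longrightarrow> mem t = mem s \<Longrightarrow>
    computes k c e s r T"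
  unfolding computes_def by blast

lemma evalsI: "evals k c e f \<Longrightarrow> pbd f \<Longrightarrow> \<exists>f. pbd f \<and> evals k c e f"
  by blast

lemma small_cong: "small A \<rho> M \<Longrightarrow> (\<And>i. i < 60 \<Longrightarrow> \<rho>' i = \<rho> i) \<Longrightarrow> small A \<rho>' M"
  by (auto simp: small_def)

lemma less_exp_mono: "(a::nat) < 2 ^ p \<Longrightarrow> p \<le> q \<Longrightarrow> a < 2 ^ q"
  by (meson less_le_trans one_le_numeral power_increasing)

text \<open>The function \<open>f\<close> depends on the expression but not on the state. A loop
  multiplies the cost of its body by about \<open>A\<close>, and the nesting depth is fixed by the
  expression, so the bound stays polynomial.\<close>

lemma comp_evals:
  assumes "wf_sexp e" "60 \<le> k"
  shows "\<exists>f. pbd f \<and> evals k (comp e k) e f"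
  using assms
proof (induction e arbitrary: k)
  case (Num c)
  have "evals k (comp (Num c) k) (Num c) (\<lambda>A. c + 3)"
    unfolding evals_def computes_def comp.simps
  proof (intro allI impI conjI exI)
    fix A r and s :: state
    show "runs (Assign k (Const c)) s r (s\<lparr>reg := (reg s)(k := aval s (Const c))\<rparr>) r (c + 3)"
      using bits_le[OF less_exp[of c]] by (intro runs_Assign) simp
    show "sval (Num c) s < 2 ^ (c + 3)"
      using less_exp_mono[OF less_exp[of c], of "c + 3"] by simp
  qed auto
  then show ?case by (rule evalsI) (intro pbd_add pbd_Suc pbd_mult pbd_const pbd_id)
next
  case (Var x)
  have "evals k (comp (Var x) k) (Var x) (\<lambda>A. A + 2)"
    using Var unfolding evals_def computes_def comp.simps
  proof (intro allI impI conjI exI)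
    fix A r and s :: state assume sm: "small A (reg s) (mem s)"
    show "runs (Assign k (Reg x)) s r (s\<lparr>reg := (reg s)(k := aval s (Reg x))\<rparr>) r (A + 2)"
      using Var sm bits_le[OF smallD(2)[OF sm, of x]] by (intro runs_Assign) simp
    show "sval (Var x) s < 2 ^ (A + 2)"
      using less_exp_mono[OF smallD(2)[OF sm, of x], of "A + 2"] Var by simp
  qed auto
  then show ?case by (rule evalsI) (intro pbd_add pbd_Suc pbd_mult pbd_const pbd_id)
next
  case (Ld a)
  then obtain f where f: "pbd f" "evals k (comp a k) a f" by auto
  have "evals k (comp (Ld a) k) (Ld a) (\<lambda>A. f A + (f A + A + 3))"
    unfolding evals_def
  proof (intro allI impI conjI)
    fix A r and s :: state assume sm: "small A (reg s) (mem s)"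
    show "sval (Ld a) s < 2 ^ (f A + (f A + A + 3))"
      using less_exp_mono[OF smallD(3)[OF sm]] by simp
    obtain s' where s': "runs (comp a k) s r s' r (f A)" "reg s' k = sval a s"
      "\<forall>i<k. reg s' i = reg s i" "mem s' = mem s" "sval a s < 2 ^ f A"
      using f(2) sm unfolding evals_def computes_def by blast
    have "runs (comp (Ld a) k) s r (s'\<lparr>reg := (reg s')(k := aval s' (Load (Reg k)))\<rparr>) r (f A + (f A + A + 3))"
      unfolding comp.simps
      by (rule runs_Seq[OF s'(1) runs_Assign order.refl])
        (use s' bits_le[OF smallD(3)[OF sm, of "sval a s"]] bits_le[OF s'(5)] in simp)
    then show "computes k (comp (Ld a) k) (Ld a) s r (f A + (f A + A + 3))"
      by (rule evals_witness) (use s' in auto)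
  qed
  then show ?case by (rule evalsI) (intro pbd_add pbd_Suc pbd_mult pbd_const pbd_id f(1))
next
  case (Bin h a b)
  obtain f where f: "pbd f" "evals k (comp a k) a f"
    using Bin.IH(1)[of k] Bin.prems by auto
  obtain g where g: "pbd g" "evals (Suc k) (comp b (Suc k)) b g"
    using Bin.IH(2)[of "Suc k"] Bin.prems by auto
  let ?F = "\<lambda>A. f A + (g A + (2 * (Suc (f A) + Suc (g A)) + 4))"
  have "evals k (comp (Bin h a b) k) (Bin h a b) ?F"
    unfolding evals_def
  proof (intro allI impI conjI)
    fix A r and s :: state assume sm: "small A (reg s) (mem s)"
    obtain s1 where s1: "runs (comp a k) s r s1 r (f A)" "reg s1 k = sval a s"
      "\<forall>i<k. reg s1 i = reg s i" "mem s1 = mem s" "sval a s < 2 ^ f A"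
      using f(2) sm unfolding evals_def computes_def by blast
    have sm1: "small A (reg s1) (mem s1)"
      using small_cong[OF sm] s1(3,4) Bin.prems by simp
    have eq: "den b (reg s1) (mem s1) = sval b s"
      using s1(3,4) Bin.prems by (auto intro!: den_cong)
    obtain s2 where s2: "runs (comp b (Suc k)) s1 r s2 r (g A)" "reg s2 (Suc k) = sval b s"
      "\<forall>i<Suc k. reg s2 i = reg s1 i" "mem s2 = mem s1" "sval b s < 2 ^ g A"
      using g(2) sm1 eq unfolding evals_def computes_def by metis
    have b1: "sval a s < 2 ^ Suc (f A)" and b2: "sval b s < 2 ^ Suc (g A)"
      using less_exp_mono s1(5) s2(5) by (meson lessI less_imp_le)+
    have r: "reg s2 k = sval a s" using s2(3) s1(2) by simp
    have ac: "acost s2 (baexp h (Reg k) (Reg (Suc k))) \<le> 2 * (Suc (f A) + Suc (g A)) + 3"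
      using b1 b2 r s2(2) by (intro acost_baexp) auto
    have av: "aval s2 (baexp h (Reg k) (Reg (Suc k))) = sval (Bin h a b) s"
      using r s2(2) by simp
    have bb: "sval (Bin h a b) s < 2 ^ (Suc (f A) + Suc (g A))"
      using bapp_less[OF b1 b2] by simp
    show "sval (Bin h a b) s < 2 ^ ?F A"
      by (rule less_exp_mono[OF bb]) simp
    have "runs (comp (Bin h a b) k) s r (s2\<lparr>reg := (reg s2)(k := aval s2 (baexp h (Reg k) (Reg (Suc k))))\<rparr>) r (?F A)"
      unfolding comp.simps
      by (rule runs_Seq[OF s1(1) runs_Seq[OF s2(1) runs_Assign order.refl] order.refl]) (use ac in simp)
    then show "computes k (comp (Bin h a b) k) (Bin h a b) s r (?F A)"
      by (rule evals_witness) (use s1 s2 av in auto)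
  qed
  then show ?case by (rule evalsI) (intro pbd_add pbd_Suc pbd_mult pbd_const pbd_id f(1) g(1))
next
  case (Fold h c x y b)
  then have wf: "x < 40" "y < 40" "x \<noteq> y" "wf_sexp b" by auto
  obtain g where g: "pbd g" "evals (k + 2) (comp b (k + 2)) b g"
    using Fold.IH[of "k + 2"] wf(4) Fold.prems(2) by auto
  \<comment> \<open>Bit length of the accumulator after at most \<open>A\<close> steps;
    \<open>Suc (g A)\<close> instead of \<open>g A\<close> provides the positive exponent that
    \<open>bapp_less\<close> needs.\<close>
  let ?P = "\<lambda>A. Suc c + A * Suc (g A)"
  let ?T = "\<lambda>A. g A + ((2 * (?P A + Suc (g A)) + 4) + (2 * A + 10))"
  let ?F = "\<lambda>A. (c + 2) + ((A + 2) + (3 + (Suc A * (?T A + 3 * A + 4) + (A + 2)))) + ?P A"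
  have "evals k (comp (Fold h c x y b) k) (Fold h c x y b) ?F"
    unfolding evals_def
  proof (intro allI impI conjI)
    fix A r and s :: state assume sm: "small A (reg s) (mem s)"
    define f where "f = (\<lambda>i. den b ((reg s)(x := i)) (mem s))"
    have yA: "reg s y \<le> A" using smallD(1)[OF sm] wf by simp
    have fb: "f i < 2 ^ g A" if "i < reg s y" for i
    proof -
      have "small A ((reg s)(x := i)) (mem s)" using small_upd[OF sm] that yA by simp
      then show ?thesis
        using g(2)[unfolded evals_def, rule_format, of A "s\<lparr>reg := (reg s)(x := i)\<rparr>" r] by (simp add: f_def)
    qed
    then have fb': "f i < 2 ^ Suc (g A)" if "i < reg s y" for i
      using that less_exp_mono[of "f i" "g A" "Suc (g A)"] by auto
    have itb: "iter h c i f < 2 ^ ?P A" if "i \<le> reg s y" for i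
    proof (rule less_exp_mono)
      show "iter h c i f < 2 ^ (Suc c + i * Suc (g A))"
        by (rule iter_less[of "reg s y"]) (use fb' that in auto)
      show "Suc c + i * Suc (g A) \<le> ?P A"
        using that yA by (intro add_mono mult_le_mono) auto
    qed
    have dn: "sval (Fold h c x y b) s = iter h c (reg s y) f"
      by (simp add: f_def)
    show "sval (Fold h c x y b) s < 2 ^ ?F A"
      unfolding dn by (rule less_exp_mono[OF itb[OF order.refl]]) (rule le_add2)
    define s1 where "s1 = s\<lparr>reg := (reg s)(k := c)\<rparr>"
    define s2 where "s2 = s1\<lparr>reg := (reg s1)(k + 1 := reg s x)\<rparr>"
    define s3 where "s3 = s2\<lparr>reg := (reg s2)(x := 0)\<rparr>"
    have k: "x < k" "y < k" using wf Fold.prems by auto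
    have 1: "runs (Assign k (Const c)) s r s1 r (c + 2)"
      using runs_Assign[of s "Const c" "c + 2" k r] bits_le[OF less_exp[of c]] by (simp add: s1_def)
    have bx: "bits (reg s x) \<le> Suc A" using bits_le smallD(2)[OF sm, of x] wf by simp
    have 2: "runs (Assign (k + 1) (Reg x)) s1 r s2 r (A + 2)"
      using runs_Assign[of s1 "Reg x" "A + 2" "k + 1" r] bx k by (simp add: s1_def s2_def)
    have 3: "runs (Assign x (Const 0)) s2 r s3 r 3"
      using runs_Assign[of s2 "Const 0" 3 x r] bits_le[of 0 0] by (simp add: s3_def)
    define Inv where "Inv i s' r' \<longleftrightarrow> reg s' x = i \<and> (\<forall>j<k. j \<noteq> x \<longrightarrow> reg s' j = reg s j) \<and>
       mem s' = mem s \<and> reg s' k = iter h c i f \<and> reg s' (k + 1) = reg s x \<and> r' = r" for i and s' :: state and r'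
    let ?W = "Seq (comp b (k + 2)) (Seq (Assign k (baexp h (Reg k) (Reg (k + 2))))
           (Assign x (Add (Reg x) (Const 1))))"
    have "\<exists>s' r'. runs (WhileNZ (Sub (Reg y) (Reg x)) ?W) s3 r s' r' (Suc (reg s y) * (?T A + 3 * A + 4)) \<and>
       Inv (reg s y) s' r'"
    proof (rule runs_count_loop)
      show "reg s' x = i \<and> reg s' y = reg s y" if "Inv i s' r'" for i s' r'
        using that wf k by (auto simp: Inv_def)
      show "Inv 0 s3 r"
        using k by (auto simp: Inv_def s3_def s2_def s1_def)
      show "reg s y < 2 ^ A" using smallD(2)[OF sm, of y] wf by simp
      show "\<exists>s'' r''. runs ?W s' r' s'' r'' (?T A) \<and> Inv (Suc i) s'' r''"
        if i: "i < reg s y" and I: "Inv i s' r'" for i s' r'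
      proof -
        have rr: "r' = r" using I by (simp add: Inv_def)
        have fe: "reg s' j = ((reg s)(x := i)) j" if "j < 60" for j
          using I that Fold.prems by (auto simp: Inv_def)
        have sm': "small A (reg s') (mem s')"
          using small_cong[OF small_upd[OF sm, of i x] fe] i yA I by (simp add: Inv_def)
        have d: "den b (reg s') (mem s') = f i"
        proof -
          have "mem s' = mem s" using I by (simp add: Inv_def)
          then show ?thesis
            unfolding f_def using den_cong[OF wf(4), of "reg s'", OF fe] by presburger
        qed
        obtain t1 where t1: "runs (comp b (k + 2)) s' r t1 r (g A)" "reg t1 (k + 2) = f i"
          "\<forall>j<k+2. reg t1 j = reg s' j" "mem t1 = mem s'"
          using g(2) sm' d unfolding evals_def computes_def by metis
        have kk: "reg t1 k = iter h c i f" using t1(3) I by (simp add: Inv_def)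
        note ab = acost_baexp[of t1 k "?P A" "k + 2" "Suc (g A)", unfolded kk t1(2), OF itb fb', OF less_imp_le[OF i] i _ _, of h, simplified]
        define t2 where "t2 = t1\<lparr>reg := (reg t1)(k := iter h c (Suc i) f)\<rparr>"
        define t3 where "t3 = t2\<lparr>reg := (reg t2)(x := Suc i)\<rparr>"
        have r2: "runs (Assign k (baexp h (Reg k) (Reg (k + 2)))) t1 r t2 r (2 * (?P A + Suc (g A)) + 4)"
          using runs_Assign[of t1 "baexp h (Reg k) (Reg (k + 2))" "2 * (?P A + Suc (g A)) + 4" k r] ab kk t1(2)
          by (simp add: t2_def)
        have xi: "reg t2 x = i" using t1(3) I k by (simp add: Inv_def t2_def)
        have "i < 2 ^ A" "Suc i < 2 ^ Suc A"
          using i yA less_exp[of A] by (simp_all, linarith+)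
        then have "runs (Assign x (Add (Reg x) (Const 1))) t2 r t3 r (2 * A + 10)"
          using runs_Assign[of t2 "Add (Reg x) (Const 1)" "2 * A + 10" x r] bits_le[of i A] bits_le[of "Suc i" "Suc A"]
            bits_le[of 1 1] xi by (simp add: t3_def)
        note runs_Seq[OF t1(1) runs_Seq[OF r2 this order.refl] order.refl]
        moreover have "Inv (Suc i) t3 r"
          using I t1 k unfolding Inv_def t3_def t2_def by auto
        ultimately show ?thesis unfolding rr by blast
      qed
    qed
    then obtain s4 r4 where s4: "runs (WhileNZ (Sub (Reg y) (Reg x)) ?W) s3 r s4 r4 (Suc (reg s y) * (?T A + 3 * A + 4))"
      "Inv (reg s y) s4 r4"
      by blast
    have r4: "r4 = r" using s4(2) by (simp add: Inv_def)
    note s4 = s4[unfolded r4]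
    have 4: "runs (WhileNZ (Sub (Reg y) (Reg x)) ?W) s3 r s4 r (Suc A * (?T A + 3 * A + 4))"
      by (rule runs_mono[OF s4(1)]) (use yA in \<open>intro mult_le_mono; simp\<close>)
    have 5: "runs (Assign x (Reg (k + 1))) s4 r (s4\<lparr>reg := (reg s4)(x := reg s x)\<rparr>) r (A + 2)"
      using runs_Assign[of s4 "Reg (k + 1)" "A + 2" x r] bx s4(2) by (simp add: Inv_def)
    have "runs (comp (Fold h c x y b) k) s r (s4\<lparr>reg := (reg s4)(x := reg s x)\<rparr>) r (?F A)"
      unfolding comp.simps
      by (rule runs_Seq[OF 1 runs_Seq[OF 2 runs_Seq[OF 3 runs_Seq[OF 4 5 order.refl] order.refl] order.refl]]) (rule le_add1)
    then show "computes k (comp (Fold h c x y b) k) (Fold h c x y b) s r (?F A)"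
      by (rule evals_witness) (use s4(2) k in \<open>auto simp: Inv_def f_def\<close>)
  qed
  then show ?case
    by (rule evalsI) (rule g(1) pbd_const pbd_id pbd_add pbd_mult pbd_Suc)+
qed

section \<open>Statements as transformations of registers and memory\<close>

definition represents :: "(nat \<Rightarrow> nat) \<Rightarrow> (nat \<Rightarrow> nat) \<Rightarrow> state \<Rightarrow> bool" where
  "represents \<rho> M s \<longleftrightarrow> (\<forall>i<60. reg s i = \<rho> i) \<and> mem s = M"

text \<open>Quantifies over every content of the scratch registers from 60 on, so the intermediate
  values of one statement never have to be described for the next.\<close>

definition realizes ::
    "com \<Rightarrow> (nat \<Rightarrow> nat) \<Rightarrow> (nat \<Rightarrow> nat) \<Rightarrow> bool list \<Rightarrow> (nat \<Rightarrow> nat) \<Rightarrow> (nat \<Rightarrow> nat) \<Rightarrow> bool list \<Rightarrow> nat \<Rightarrow> bool" where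
  "realizes c \<rho> M r \<rho>' M' r' T \<longleftrightarrow>
     (\<forall>s. represents \<rho> M s \<longrightarrow> (\<exists>s'. runs c s r s' r' T \<and> represents \<rho>' M' s'))"

lemma realizes_Seq:
  assumes "realizes c1 \<rho> M r \<rho>1 M1 r1 T1" "realizes c2 \<rho>1 M1 r1 \<rho>2 M2 r2 T2"
  shows "realizes (Seq c1 c2) \<rho> M r \<rho>2 M2 r2 (T1 + T2)"
  unfolding realizes_def
proof (intro allI impI)
  fix s :: state assume "represents \<rho> M s"
  then obtain s1 where s1: "runs c1 s r s1 r1 T1" "represents \<rho>1 M1 s1"
    using assms(1) unfolding realizes_def by blast
  then obtain s2 where s2: "runs c2 s1 r1 s2 r2 T2" "represents \<rho>2 M2 s2"
    using assms(2) unfolding realizes_def by blast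
  show "\<exists>s'. runs (Seq c1 c2) s r s' r2 (T1 + T2) \<and> represents \<rho>2 M2 s'"
    using runs_Seq[OF s1(1) s2(1) order.refl] s2(2) by blast
qed

lemma represents_comp:
  assumes "evals k (comp e k) e f" "60 \<le> k" "wf_sexp e" "small A \<rho> M" "represents \<rho> M s"
  obtains s' where "runs (comp e k) s r s' r (f A)" "reg s' k = den e \<rho> M"
    "\<forall>i<k. reg s' i = reg s i" "mem s' = M" "den e \<rho> M < 2 ^ f A"
proof -
  have m: "mem s = M" and d: "den e (reg s) M = den e \<rho> M"
    using assms(3,5) by (auto simp: represents_def intro: den_cong)
  have "small A (reg s) (mem s)"
    by (rule small_cong) (use assms(4,5) in \<open>auto simp: represents_def\<close>)
  then show thesis
    using assms(1) that m d unfolding evals_def computes_def by metis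
qed

definition set_reg :: "nat \<Rightarrow> sexp \<Rightarrow> com" where
  "set_reg x e = Seq (comp e 60) (Assign x (Reg 60))"

lemma set_reg_realizes:
  assumes "wf_sexp e" "x < 60"
  shows "\<exists>f. pbd f \<and> (\<forall>A \<rho> M r. small A \<rho> M \<longrightarrow>
    realizes (set_reg x e) \<rho> M r (\<rho>(x := den e \<rho> M)) M r (f A))"
proof -
  obtain f where f: "pbd f" "evals 60 (comp e 60) e f"
    using comp_evals[OF assms(1)] by blast
  have "realizes (set_reg x e) \<rho> M r (\<rho>(x := den e \<rho> M)) M r (f A + (f A + 2))"
    if sm: "small A \<rho> M" for A \<rho> M r
    unfolding realizes_def
  proof (intro allI impI)
    fix s assume rep: "represents \<rho> M s"
    obtain s' where s': "runs (comp e 60) s r s' r (f A)" "reg s' 60 = den e \<rho> M"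
      "\<forall>i<60. reg s' i = reg s i" "mem s' = M" "den e \<rho> M < 2 ^ f A"
      using represents_comp[OF f(2) _ assms(1) sm rep] by blast
    let ?t = "s'\<lparr>reg := (reg s')(x := aval s' (Reg 60))\<rparr>"
    have "runs (set_reg x e) s r ?t r (f A + (f A + 2))"
      unfolding set_reg_def
      by (rule runs_Seq[OF s'(1) runs_Assign order.refl]) (use s'(2) bits_le[OF s'(5)] in simp)
    moreover have "represents (\<rho>(x := den e \<rho> M)) M ?t"
      using s'(2-4) rep by (simp add: represents_def)
    ultimately show "\<exists>s'. runs (set_reg x e) s r s' r (f A + (f A + 2)) \<and>
        represents (\<rho>(x := den e \<rho> M)) M s'"
      by blast
  qed
  moreover have "pbd (\<lambda>A. f A + (f A + 2))"
    by (intro pbd_add f(1) pbd_const)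
  ultimately show ?thesis by blast
qed

definition upd :: "(nat \<Rightarrow> nat) \<Rightarrow> nat \<Rightarrow> (nat \<Rightarrow> nat) \<Rightarrow> nat \<Rightarrow> nat \<Rightarrow> nat" where
  "upd M b f N = (\<lambda>a. if b \<le> a \<and> a < b + N then f (a - b) else M a)"

lemma upd_0 [simp]: "upd M b f 0 = M"
  by (auto simp: upd_def)

lemma upd_Suc: "(upd M b f i)(b + i := f i) = upd M b f (Suc i)"
  by (auto simp: upd_def fun_eq_iff less_Suc_eq)

lemma upd_outside: "a < b \<or> b + N \<le> a \<Longrightarrow> upd M b f N a = M a"
  by (auto simp: upd_def)

lemma upd_inside: "i < N \<Longrightarrow> upd M b f N (b + i) = f i"
  by (auto simp: upd_def)

lemma small_upd_mem:
  "small A \<rho> M \<Longrightarrow> (\<And>i. i < N \<Longrightarrow> f i < 2 ^ A) \<Longrightarrow> small A \<rho> (upd M b f N)"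
  by (auto simp: small_def upd_def)

definition for_loop :: "nat \<Rightarrow> nat \<Rightarrow> com \<Rightarrow> com" where
  "for_loop x y c = Seq (Assign x (Const 0))
     (WhileNZ (Sub (Reg y) (Reg x)) (Seq c (Assign x (Add (Reg x) (Const 1)))))"

definition fill :: "nat \<Rightarrow> nat \<Rightarrow> nat \<Rightarrow> sexp \<Rightarrow> com" where
  "fill b x y e = for_loop x y (Seq (comp e 60) (Store (Add (Reg b) (Reg x)) (Reg 60)))"

definition flip_fill :: "nat \<Rightarrow> nat \<Rightarrow> nat \<Rightarrow> com" where
  "flip_fill b x y = for_loop x y (Seq (Flip 60) (Store (Add (Reg b) (Reg x)) (Reg 60)))"

text \<open>Memory and remaining coins are given as functions of the iteration number, so one rule
  covers loops that fill a table by computation and loops that fill it with coin tosses.\<close>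

lemma for_loop_realizes:
  assumes xy: "x \<noteq> y" "x < 60" "y < 60" and yA: "\<rho> y \<le> A"
    and body: "\<And>i s. i < \<rho> y \<Longrightarrow> represents (\<rho>(x := i)) (M i) s \<Longrightarrow>
      \<exists>s'. runs c s (R i) s' (R (Suc i)) T \<and> represents (\<rho>(x := i)) (M (Suc i)) s'"
  shows "realizes (for_loop x y c) \<rho> (M 0) (R 0) (\<rho>(x := \<rho> y)) (M (\<rho> y)) (R (\<rho> y))
    (3 + Suc A * (T + (2 * A + 8) + 3 * A + 4))"
  unfolding realizes_def
proof (intro allI impI)
  fix s assume rep: "represents \<rho> (M 0) s"
  define Inv where "Inv i s r \<longleftrightarrow> represents (\<rho>(x := i)) (M i) s \<and> r = R i" for i s r
  let ?s = "s\<lparr>reg := (reg s)(x := aval s (Const 0))\<rparr>"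
  let ?W = "Seq c (Assign x (Add (Reg x) (Const 1)))"
  have 1: "runs (Assign x (Const 0)) s (R 0) ?s (R 0) 3"
    by (rule runs_Assign) (use bits_le[of 0 0] in simp)
  have "\<exists>s' r'. runs (WhileNZ (Sub (Reg y) (Reg x)) ?W) ?s (R 0) s' r'
      (Suc (\<rho> y) * (T + (2 * A + 8) + 3 * A + 4)) \<and> Inv (\<rho> y) s' r'"
  proof (rule runs_count_loop)
    show "reg s' x = i \<and> reg s' y = \<rho> y" if "Inv i s' r'" for i s' r'
      using that xy by (auto simp: Inv_def represents_def)
    show "Inv 0 ?s (R 0)"
      using rep by (auto simp: Inv_def represents_def)
    show "\<rho> y < 2 ^ A" using yA less_exp[of A] by linarith
    show "\<exists>s'' r''. runs ?W s' r' s'' r'' (T + (2 * A + 8)) \<and> Inv (Suc i) s'' r''"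
      if i: "i < \<rho> y" and I: "Inv i s' r'" for i s' r'
    proof -
      obtain t where t: "runs c s' (R i) t (R (Suc i)) T" "represents (\<rho>(x := i)) (M (Suc i)) t"
        using body[OF i] I by (auto simp: Inv_def)
      have x: "reg t x = i" using t(2) xy by (simp add: represents_def)
      have "i < 2 ^ A" "Suc i < 2 ^ Suc A"
        using i yA less_exp[of A] by (simp_all, linarith+)
      then have "runs (Assign x (Add (Reg x) (Const 1))) t (R (Suc i))
          (t\<lparr>reg := (reg t)(x := aval t (Add (Reg x) (Const 1)))\<rparr>) (R (Suc i)) (2 * A + 8)"
        using bits_le[of i A] bits_le[of "Suc i" "Suc A"] bits_le[of 1 1] x
        by (intro runs_Assign) simp
      note runs_Seq[OF t(1) this order.refl]
      moreover have "Inv (Suc i) (t\<lparr>reg := (reg t)(x := aval t (Add (Reg x) (Const 1)))\<rparr>) (R (Suc i))"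
        using t(2) x by (auto simp: Inv_def represents_def)
      moreover have "r' = R i" using I by (simp add: Inv_def)
      ultimately show ?thesis by blast
    qed
  qed
  then obtain s' r' where s': "runs (WhileNZ (Sub (Reg y) (Reg x)) ?W) ?s (R 0) s' r'
      (Suc (\<rho> y) * (T + (2 * A + 8) + 3 * A + 4))" "Inv (\<rho> y) s' r'"
    by blast
  have r': "r' = R (\<rho> y)" using s'(2) by (simp add: Inv_def)
  have "runs (for_loop x y c) s (R 0) s' (R (\<rho> y)) (3 + Suc A * (T + (2 * A + 8) + 3 * A + 4))"
    unfolding for_loop_def
  proof (rule runs_Seq[OF 1 s'(1)[unfolded r']])
    show "3 + Suc (\<rho> y) * (T + (2 * A + 8) + 3 * A + 4) \<le> 3 + Suc A * (T + (2 * A + 8) + 3 * A + 4)"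
      using yA by (intro add_left_mono mult_le_mono1) simp
  qed
  then show "\<exists>s'. runs (for_loop x y c) s (R 0) s' (R (\<rho> y)) (3 + Suc A * (T + (2 * A + 8) + 3 * A + 4)) \<and>
      represents (\<rho>(x := \<rho> y)) (M (\<rho> y)) s'"
    using s'(2) unfolding Inv_def by blast
qed

lemma runs_table_store:
  assumes rep: "represents (\<rho>(x := i)) M s" and regs: "b \<noteq> x" "b < 60" "x < 60"
    and bnd: "\<rho> b \<le> A" "i \<le> A" "v < 2 ^ q" and t: "\<forall>j<60. reg t j = reg s j" "mem t = mem s" "reg t 60 = v"
  shows "\<exists>t'. runs (Store (Add (Reg b) (Reg x)) (Reg 60)) t r t' r (4 * A + q + 8) \<and>
    represents (\<rho>(x := i)) (M(\<rho> b + i := v)) t'"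
proof -
  have x: "reg t x = i" "reg t b = \<rho> b"
    using rep t regs by (auto simp: represents_def)
  have e: "i < 2 ^ A" "\<rho> b < 2 ^ A" "\<rho> b + i < 2 ^ Suc A"
    using bnd less_exp[of A] by (simp_all, linarith+)
  have "runs (Store (Add (Reg b) (Reg x)) (Reg 60)) t r
     (t\<lparr>mem := (mem t)(aval t (Add (Reg b) (Reg x)) := aval t (Reg 60))\<rparr>) r (4 * A + q + 8)"
    by (rule runs_Store) (use bits_le[OF e(1)] bits_le[OF e(2)] bits_le[OF e(3)] bits_le[OF bnd(3)] x t(3) in simp)
  moreover have "represents (\<rho>(x := i)) (M(\<rho> b + i := v))
      (t\<lparr>mem := (mem t)(aval t (Add (Reg b) (Reg x)) := aval t (Reg 60))\<rparr>)"
    using rep t x by (auto simp: represents_def)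
  ultimately show ?thesis by blast
qed

text \<open>Entry \<open>i\<close> is evaluated in the memory in which the first \<open>i\<close>
  entries are already written. A table may therefore refer to its own earlier entries, which is how
  the recursion for the multipliers is carried out.\<close>

definition fills :: "com \<Rightarrow> nat \<Rightarrow> nat \<Rightarrow> nat \<Rightarrow> sexp \<Rightarrow> (nat \<Rightarrow> nat) \<Rightarrow> bool" where
  "fills c b x y e f \<longleftrightarrow> (\<forall>A \<rho> M r val. small A \<rho> M \<longrightarrow>
    (\<forall>i<\<rho> y. den e (\<rho>(x := i)) (upd M (\<rho> b) val i) = val i \<and> val i < 2 ^ A) \<longrightarrow>
    realizes c \<rho> M r (\<rho>(x := \<rho> y)) (upd M (\<rho> b) val (\<rho> y)) r (f A))"

lemma fill_realizes:
  assumes "wf_sexp e" "b \<noteq> x" "x \<noteq> y" "b < 40" "x < 40" "y < 40"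
  shows "\<exists>f. pbd f \<and> fills (fill b x y e) b x y e f"
proof -
  obtain f where f: "pbd f" "evals 60 (comp e 60) e f"
    using comp_evals[OF assms(1)] by blast
  let ?T = "\<lambda>A. f A + (4 * A + A + 8)"
  have "realizes (fill b x y e) \<rho> M r (\<rho>(x := \<rho> y)) (upd M (\<rho> b) val (\<rho> y)) r
      (3 + Suc A * (?T A + (2 * A + 8) + 3 * A + 4))"
    if sm: "small A \<rho> M"
      and val: "\<forall>i<\<rho> y. den e (\<rho>(x := i)) (upd M (\<rho> b) val i) = val i \<and> val i < 2 ^ A"
    for A \<rho> M r val
  proof -
    have A: "\<rho> y \<le> A" "\<rho> b \<le> A" using smallD(1)[OF sm] assms by auto
    have "\<exists>s'. runs (Seq (comp e 60) (Store (Add (Reg b) (Reg x)) (Reg 60))) s r s' r (?T A) \<and>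
        represents (\<rho>(x := i)) (upd M (\<rho> b) val (Suc i)) s'"
      if i: "i < \<rho> y" and rep: "represents (\<rho>(x := i)) (upd M (\<rho> b) val i) s" for i s
    proof -
      have "small A (\<rho>(x := i)) (upd M (\<rho> b) val i)"
        by (intro small_upd small_upd_mem sm) (use i A val in auto)
      then obtain t where t: "runs (comp e 60) s r t r (f A)" "reg t 60 = val i"
        "\<forall>i<60. reg t i = reg s i" "mem t = upd M (\<rho> b) val i"
        using represents_comp[OF f(2) _ assms(1) _ rep] val i by (metis order.refl)
      have v: "val i < 2 ^ A" using val i by blast
      obtain t' where t': "runs (Store (Add (Reg b) (Reg x)) (Reg 60)) t r t' r (4 * A + A + 8)"
        "represents (\<rho>(x := i)) ((upd M (\<rho> b) val i)(\<rho> b + i := val i)) t'"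
        using runs_table_store[OF rep assms(2) _ _ A(2) _ v t(3) _ t(2), of r] t(4) rep i A assms
        by (auto simp: represents_def)
      show ?thesis
        using runs_Seq[OF t(1) t'(1) order.refl] t'(2) unfolding upd_Suc by blast
    qed
    from for_loop_realizes[where R = "\<lambda>_. r" and M = "upd M (\<rho> b) val", OF assms(3) _ _ A(1) this]
    show ?thesis
      using assms unfolding fill_def by simp
  qed
  moreover have "pbd (\<lambda>A. 3 + Suc A * (?T A + (2 * A + 8) + 3 * A + 4))"
    by (intro pbd_add pbd_mult pbd_Suc pbd_id pbd_const f(1))
  ultimately show ?thesis unfolding fills_def by blast
qed

lemma flip_fill_realizes:
  assumes "b \<noteq> x" "x \<noteq> y" "b < 40" "x < 40" "y < 40"
  shows "\<exists>f. pbd f \<and> (\<forall>A \<rho> M r. small A \<rho> M \<longrightarrow> \<rho> y \<le> length r \<longrightarrow>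
    realizes (flip_fill b x y) \<rho> M r (\<rho>(x := \<rho> y)) (upd M (\<rho> b) (\<lambda>i. of_bool (r ! i)) (\<rho> y)) (drop (\<rho> y) r) (f A))"
proof -
  let ?T = "\<lambda>A. 1 + (4 * A + 1 + 8)"
  have "realizes (flip_fill b x y) \<rho> M r (\<rho>(x := \<rho> y)) (upd M (\<rho> b) (\<lambda>i. of_bool (r ! i)) (\<rho> y)) (drop (\<rho> y) r)
      (3 + Suc A * (?T A + (2 * A + 8) + 3 * A + 4))"
    if sm: "small A \<rho> M" and len: "\<rho> y \<le> length r" for A \<rho> M r
  proof -
    let ?val = "\<lambda>i. of_bool (r ! i) :: nat"
    have A: "\<rho> y \<le> A" "\<rho> b \<le> A" using smallD(1)[OF sm] assms by auto
    have "\<exists>s'. runs (Seq (Flip 60) (Store (Add (Reg b) (Reg x)) (Reg 60))) s (drop i r) s' (drop (Suc i) r) (?T A) \<and>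
        represents (\<rho>(x := i)) (upd M (\<rho> b) ?val (Suc i)) s'"
      if i: "i < \<rho> y" and rep: "represents (\<rho>(x := i)) (upd M (\<rho> b) ?val i) s" for i s
    proof -
      let ?t = "s\<lparr>reg := (reg s)(60 := of_bool (r ! i))\<rparr>"
      have 1: "runs (Flip 60) s (drop i r) ?t (drop (Suc i) r) 1"
        using runs_Flip[of 1 60 s "r ! i" "drop (Suc i) r"] i len by (simp add: Cons_nth_drop_Suc)
      have v: "?val i < 2 ^ 1" by simp
      obtain t' where t': "runs (Store (Add (Reg b) (Reg x)) (Reg 60)) ?t (drop (Suc i) r) t' (drop (Suc i) r) (4 * A + 1 + 8)"
        "represents (\<rho>(x := i)) ((upd M (\<rho> b) ?val i)(\<rho> b + i := ?val i)) t'"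
        using runs_table_store[OF rep assms(1) _ _ A(2) _ v, of ?t "drop (Suc i) r"] i A assms
        by auto
      show ?thesis
        using runs_Seq[OF 1 t'(1) order.refl] t'(2) unfolding upd_Suc[of M "\<rho> b" ?val i] by blast
    qed
    from for_loop_realizes[where R = "\<lambda>i. drop i r" and M = "upd M (\<rho> b) ?val", OF assms(2) _ _ A(1) this]
    show ?thesis
      using assms unfolding flip_fill_def by simp
  qed
  moreover have "pbd (\<lambda>A. 3 + Suc A * (?T A + (2 * A + 8) + 3 * A + 4))"
    by (intro pbd_add pbd_mult pbd_Suc pbd_id pbd_const)
  ultimately show ?thesis by blast
qed

section \<open>Best responses and multipliers\<close>

declare sum_of_bool_eq [simp del] sum_mult_of_bool_eq [simp del] sum_of_bool_mult_eq [simp del]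

text \<open>An exchange argument. The rank \<open>h\<close> numbers \<open>E\<close> from 0, so
  \<open>S\<close> has \<open>min K (card E)\<close> elements. If something is left out, let
  \<open>\<theta>\<close> be the largest value of \<open>f\<close> outside \<open>S\<close>:
  elements of \<open>G - S\<close> are worth at most \<open>\<theta>\<close>, those of
  \<open>S - G\<close> at least \<open>\<theta>\<close>, and there are at least as many of the
  latter.\<close>

lemma top_k:
  fixes f :: "nat \<Rightarrow> real" and g :: "nat \<Rightarrow> nat" and K :: nat
  assumes fin: "finite E" and inj: "inj_on g E"
    and anti: "\<And>a b. a \<in> E \<Longrightarrow> b \<in> E \<Longrightarrow> g a < g b \<Longrightarrow> f b \<le> f a"
    and nonneg: "\<And>a. a \<in> E \<Longrightarrow> 0 \<le> f a"
  defines "S \<equiv> {e \<in> E. card {e' \<in> E. g e' < g e} < K}"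
  shows "card S \<le> K" and "G \<subseteq> E \<Longrightarrow> card G \<le> K \<Longrightarrow> sum f G \<le> sum f S"
proof -
  define h where "h e = card {e' \<in> E. g e' < g e}" for e
  have mono: "h a < h b" if "a \<in> E" "b \<in> E" "g a < g b" for a b
    unfolding h_def using fin that by (intro psubset_card_mono) auto
  have inj_h: "inj_on h E"
  proof (rule inj_onI)
    fix a b assume ab: "a \<in> E" "b \<in> E" "h a = h b"
    then have "g a = g b"
      using mono[of a b] mono[of b a] by (metis less_irrefl linorder_less_linear)
    then show "a = b" using inj ab by (auto dest: inj_onD)
  qed
  have h_less: "h a < card E" if "a \<in> E" for a
    unfolding h_def using fin that by (intro psubset_card_mono) auto
  have "h ` E = {..<card E}"
    by (rule card_subset_eq) (use h_less card_image[OF inj_h] in auto)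
  moreover have S: "S = {e \<in> E. h e < K}"
    by (simp add: S_def h_def)
  ultimately have hS: "h ` S = {..<min K (card E)}"
    by (auto simp: image_iff) (metis (no_types, lifting) imageE lessThan_iff)
  have SE: "S \<subseteq> E" and finS: "finite S" using fin by (auto simp: S)
  have cS: "card S = min K (card E)"
    using card_image[OF inj_on_subset[OF inj_h SE]] hS by simp
  then show "card S \<le> K" by simp
  show "sum f G \<le> sum f S" if G: "G \<subseteq> E" "card G \<le> K"
  proof (cases "E \<subseteq> S")
    case True
    then show ?thesis using G fin finS SE nonneg by (intro sum_mono2) auto
  next
    case False
    then have ne: "E - S \<noteq> {}" by auto
    define \<theta> where "\<theta> = Max (f ` (E - S))"
    have \<theta>: "f a \<le> \<theta>" if "a \<in> E - S" for a
      unfolding \<theta>_def using fin that by (intro Max_ge) auto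
    have "\<theta> \<in> f ` (E - S)"
      unfolding \<theta>_def using fin ne by (intro Max_in) auto
    then obtain x where x: "x \<in> E - S" "\<theta> = f x" by auto
    have \<theta>0: "0 \<le> \<theta>" using x nonneg by auto
    have ge: "\<theta> \<le> f a" if "a \<in> S" for a
    proof -
      have "h a < h x" using x that by (auto simp: S)
      then have "g a < g x"
        using mono[of x a] x that SE inj by (metis DiffD1 inj_on_eq_iff less_asym linorder_neqE_nat order_less_irrefl subsetD)
      then show ?thesis using anti[of a x] x that SE by auto
    qed
    \<comment> \<open>The omitted \<open>x\<close> has rank at least \<open>K\<close>, so
      \<open>S\<close> has exactly \<open>K\<close> elements.\<close>
    have "K \<le> card E" using x h_less[of x] by (auto simp: S)
    then have "card G \<le> card S" using G cS by simp
    moreover have finG: "finite G" using G fin finite_subset by auto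
    ultimately have c: "card (G - S) \<le> card (S - G)"
      using card_le_sym_Diff[OF finG finS] by simp
    have "sum f (G - S) \<le> real (card (G - S)) * \<theta>"
      by (rule sum_bounded_above) (use \<theta> G in auto)
    also have "\<dots> \<le> real (card (S - G)) * \<theta>"
      using c \<theta>0 by (intro mult_right_mono) auto
    also have "\<dots> \<le> sum f (S - G)"
      by (rule sum_bounded_below) (use ge in auto)
    finally have "sum f (G - S) \<le> sum f (S - G)" .
    moreover have "sum f G = sum f (G - S) + sum f (G \<inter> S)"
      using finG by (metis add.commute sum.Int_Diff)
    moreover have "sum f S = sum f (S - G) + sum f (S \<inter> G)"
      using finS by (metis add.commute sum.Int_Diff)
    ultimately show ?thesis by (simp add: Int_commute)
  qed
qed

text \<open>The vertices on the side \<open>\<sigma> = 0\<close> are free of charge; those on the side \<open>\<sigma> = 1\<close> repeatedly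
  respond optimally to multipliers \<open>z\<close> for the capacities of the other side. All numbers are
  scaled to be integers: \<open>\<beta>\<close> is a common multiple of the budgets, and the unit of the
  multipliers is \<open>N\<close> times smaller than that of \<open>\<beta>\<close>.\<close>

locale response =
  fixes n m N k :: nat and U V \<beta> \<kappa> \<sigma> :: "nat \<Rightarrow> nat"
begin

definition inc :: "nat \<Rightarrow> nat \<Rightarrow> bool" where
  "inc e v \<longleftrightarrow> U e = v \<or> V e = v"

definition oth :: "nat \<Rightarrow> nat \<Rightarrow> nat" where
  "oth e v = (if U e = v then V e else U e)"

definition arc :: "nat \<Rightarrow> nat \<Rightarrow> bool" where
  "arc v e \<longleftrightarrow> inc e v \<and> \<sigma> v = 1 \<and> \<sigma> (oth e v) = 0"

text \<open>A price for \<open>v\<close> is always the budget \<open>\<beta> j\<close> of some edge.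
  The strict inequality demands a positive net profit in the Lagrangian; it is what keeps the
  multipliers bounded, since a vertex whose multiplier reaches \<open>N * total\<close> attracts no
  edge.\<close>

definition elig :: "(nat \<Rightarrow> nat) \<Rightarrow> nat \<Rightarrow> nat \<Rightarrow> nat \<Rightarrow> bool" where
  "elig z v j e \<longleftrightarrow> arc v e \<and> \<beta> j \<le> \<beta> e \<and> z (oth e v) < N * \<beta> j"

text \<open>For edges below \<open>m\<close> this is the lexicographic order of multiplier and
  index, so keys are distinct and the cheapest edges are well defined.\<close>

definition key :: "(nat \<Rightarrow> nat) \<Rightarrow> nat \<Rightarrow> nat \<Rightarrow> nat" where
  "key z v e = z (oth e v) * m + e"

definition rank :: "(nat \<Rightarrow> nat) \<Rightarrow> nat \<Rightarrow> nat \<Rightarrow> nat \<Rightarrow> nat" where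
  "rank z v j e = (\<Sum>e'<m. of_bool (elig z v j e' \<and> key z v e' < key z v e))"

definition sel :: "(nat \<Rightarrow> nat) \<Rightarrow> nat \<Rightarrow> nat \<Rightarrow> nat \<Rightarrow> bool" where
  "sel z v j e \<longleftrightarrow> elig z v j e \<and> rank z v j e < \<kappa> v"

definition gain :: "(nat \<Rightarrow> nat) \<Rightarrow> nat \<Rightarrow> nat \<Rightarrow> nat" where
  "gain z v j = (\<Sum>e<m. of_bool (sel z v j e) * (N * \<beta> j - z (oth e v)))"

text \<open>The index breaks ties, so that there is exactly one best price.\<close>

definition best :: "(nat \<Rightarrow> nat) \<Rightarrow> nat \<Rightarrow> nat \<Rightarrow> bool" where
  "best z v j \<longleftrightarrow> (\<forall>i<m. gain z v i * m + i \<le> gain z v j * m + j)"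

definition pick :: "(nat \<Rightarrow> nat) \<Rightarrow> nat \<Rightarrow> nat \<Rightarrow> bool" where
  "pick z v e \<longleftrightarrow> (\<exists>j<m. best z v j \<and> sel z v j e)"

definition price :: "(nat \<Rightarrow> nat) \<Rightarrow> nat \<Rightarrow> nat" where
  "price z v = (\<Sum>j<m. of_bool (best z v j) * \<beta> j)"

definition load :: "(nat \<Rightarrow> nat) \<Rightarrow> nat \<Rightarrow> nat" where
  "load z u = (\<Sum>v<n. \<Sum>e<m. of_bool (pick z v e \<and> oth e v = u))"

text \<open>Bounds every price, and doubles as the step length of the gradient steps in
  \<open>update\<close>.\<close>

definition total :: nat where
  "total = (\<Sum>e<m. \<beta> e)"

text \<open>The reduction of the capacity leaves room for the fluctuation of the rounding.\<close>

definition target :: "nat \<Rightarrow> nat" where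
  "target u = \<kappa> u - \<kappa> u div k"

text \<open>A gradient step projected to the nonnegative numbers: adding before subtracting lets
  truncated subtraction perform the projection.\<close>

definition update :: "(nat \<Rightarrow> nat) \<Rightarrow> nat \<Rightarrow> nat" where
  "update z u = (z u + total * load z u) - total * target u"

primrec lam :: "nat \<Rightarrow> nat \<Rightarrow> nat" where
  "lam 0 = (\<lambda>u. 0)"
| "lam (Suc t) = update (lam t)"

text \<open>Here \<open>\<tau> v\<close> is the round whose response vertex \<open>v\<close>
  adopts.\<close>

definition chosen :: "(nat \<Rightarrow> nat) \<Rightarrow> nat \<Rightarrow> bool" where
  "chosen \<tau> e \<longleftrightarrow> (\<exists>v<n. pick (lam (\<tau> v)) v e)"

text \<open>Among the chosen edges at a free vertex those with the \<open>\<kappa> u\<close>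
  smallest indices pass the test. Priced vertices need no test, since each response already respects
  the capacity of its own vertex.\<close>

definition kept :: "(nat \<Rightarrow> nat) \<Rightarrow> nat \<Rightarrow> bool" where
  "kept \<tau> e \<longleftrightarrow> chosen \<tau> e \<and>
     (\<forall>u<n. inc e u \<and> \<sigma> u = 0 \<longrightarrow> (\<Sum>e'<m. of_bool (e' < e \<and> inc e' u \<and> chosen \<tau> e')) < \<kappa> u)"

definition prc :: "(nat \<Rightarrow> nat) \<Rightarrow> nat \<Rightarrow> nat" where
  "prc \<tau> v = of_bool (\<sigma> v = 1) * price (lam (\<tau> v)) v"

text \<open>The only part of a competing revenue that responses are compared with, because the free
  side charges nothing.\<close>

definition crossing_value :: "nat set \<Rightarrow> (nat \<Rightarrow> real) \<Rightarrow> real" where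
  "crossing_value F p = (\<Sum>v<n. \<Sum>e\<in>F. of_bool (arc v e) * p v)"

definition rev :: "(nat \<Rightarrow> nat) \<Rightarrow> real" where
  "rev z = (\<Sum>v<n. \<Sum>e<m. of_bool (pick z v e) * real (price z v))"

end

locale response_graph = response +
  assumes ends_less: "e < m \<Longrightarrow> U e < n" "e < m \<Longrightarrow> V e < n"
    and no_loop: "e < m \<Longrightarrow> U e \<noteq> V e"
    and simple: "e < m \<Longrightarrow> e' < m \<Longrightarrow> {U e, V e} = {U e', V e'} \<Longrightarrow> e = e'"
begin

lemma sum_of_bool_card: "finite A \<Longrightarrow> (\<Sum>e\<in>A. of_bool (P e)) = (of_nat (card {e \<in> A. P e}) :: 'b :: semiring_1)"
  by (simp add: sum_of_bool_eq Int_def)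

lemma oth_less: "e < m \<Longrightarrow> oth e v < n"
  using ends_less by (simp add: oth_def)

lemma inc_oth: "inc e (oth e v)"
  by (auto simp: inc_def oth_def)

lemma inc_cases: "e < m \<Longrightarrow> inc e v \<Longrightarrow> inc e w \<Longrightarrow> w = v \<or> w = oth e v"
  by (auto simp: inc_def oth_def)

lemma ends_eq: "e < m \<Longrightarrow> inc e v \<Longrightarrow> {U e, V e} = {v, oth e v}"
  by (auto simp: inc_def oth_def)

lemma arc_unique: "e < m \<Longrightarrow> arc v e \<Longrightarrow> arc w e \<Longrightarrow> w = v"
  using inc_cases[of e v w] by (auto simp: arc_def)

lemma arc_inc: "e < m \<Longrightarrow> arc v e \<Longrightarrow> inc e w \<Longrightarrow> \<sigma> w = 0 \<Longrightarrow> w = oth e v"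
  using inc_cases[of e v w] by (auto simp: arc_def)

lemma arc_eq: "e < m \<Longrightarrow> e' < m \<Longrightarrow> arc v e \<Longrightarrow> arc v e' \<Longrightarrow> oth e v = oth e' v \<Longrightarrow> e = e'"
  using simple[of e e'] ends_eq[of e v] ends_eq[of e' v] by (auto simp: arc_def)

section \<open>Optimality of the responses\<close>

lemma inj_key: "inj_on (key z v) {..<m}"
proof (rule inj_onI)
  fix a b assume ab: "a \<in> {..<m}" "b \<in> {..<m}" "key z v a = key z v b"
  then have "key z v a mod m = key z v b mod m" by simp
  then show "a = b" using ab by (simp add: key_def)
qed

lemma key_mono: "a < m \<Longrightarrow> key z v a < key z v b \<Longrightarrow> b < m \<Longrightarrow> z (oth a v) \<le> z (oth b v)"
proof (rule ccontr)
  assume a: "a < m" "key z v a < key z v b" "b < m" "\<not> z (oth a v) \<le> z (oth b v)"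
  then have "Suc (z (oth b v)) * m \<le> z (oth a v) * m" by (intro mult_le_mono1) simp
  then show False using a by (simp add: key_def)
qed

lemma gain_eq: "real (gain z v j) = (\<Sum>e\<in>{e\<in>{..<m}. sel z v j e}. real (N * \<beta> j) - real (z (oth e v)))"
proof -
  have "real (gain z v j) = (\<Sum>e<m. if sel z v j e then real (N * \<beta> j - z (oth e v)) else 0)"
    unfolding gain_def of_nat_sum by (intro sum.cong) auto
  also have "\<dots> = (\<Sum>e\<in>{e\<in>{..<m}. sel z v j e}. real (N * \<beta> j - z (oth e v)))"
    by (rule sum.inter_filter[symmetric]) simp
  also have "\<dots> = (\<Sum>e\<in>{e\<in>{..<m}. sel z v j e}. real (N * \<beta> j) - real (z (oth e v)))"
    by (intro sum.cong) (auto simp: sel_def elig_def of_nat_diff)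
  finally show ?thesis .
qed

lemma sel_top_k:
  fixes z v j
  defines "E \<equiv> {e\<in>{..<m}. elig z v j e}"
  shows "{e\<in>{..<m}. sel z v j e} = {e \<in> E. card {e' \<in> E. key z v e' < key z v e} < \<kappa> v}"
proof -
  have "rank z v j e = card {e' \<in> E. key z v e' < key z v e}" for e
    unfolding rank_def E_def by (subst sum_of_bool_card) (auto intro!: arg_cong[of _ _ card])
  then show ?thesis by (auto simp: sel_def E_def)
qed

lemma card_sel: "card {e\<in>{..<m}. sel z v j e} \<le> \<kappa> v"
  unfolding sel_top_k
  by (rule top_k(1)[where f = "\<lambda>_. 0"]) (auto intro: inj_on_subset[OF inj_key])

text \<open>Edges with nonpositive net profit can be discarded from \<open>G\<close>. The rest
  consists of at most \<open>\<kappa> v\<close> eligible edges, and against such sets selecting the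
  smallest keys is optimal by \<open>top_k\<close>.\<close>

lemma gain_ge:
  assumes G: "G \<subseteq> {..<m}" "\<And>e. e \<in> G \<Longrightarrow> arc v e \<and> \<beta> j \<le> \<beta> e" "card G \<le> \<kappa> v"
  shows "(\<Sum>e\<in>G. real (N * \<beta> j) - real (z (oth e v))) \<le> real (gain z v j)"
proof -
  let ?f = "\<lambda>e. real (N * \<beta> j) - real (z (oth e v))"
  let ?H = "{e\<in>G. z (oth e v) < N * \<beta> j}"
  have fin: "finite G" using G(1) finite_subset by auto
  have "sum ?f G = sum ?f ?H + sum ?f (G - ?H)"
    using fin by (subst sum.subset_diff[of ?H G]) auto
  also have "sum ?f (G - ?H) \<le> 0"
    by (rule sum_nonpos) (auto simp flip: of_nat_mult)
  also have "sum ?f ?H + 0 \<le> real (gain z v j)"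
    unfolding gain_eq sel_top_k add_0_right
  proof (rule top_k(2))
    show "inj_on (key z v) {e \<in> {..<m}. elig z v j e}"
      by (rule inj_on_subset[OF inj_key]) auto
    show "card ?H \<le> \<kappa> v"
      using card_mono[OF fin, of ?H] G(3) by auto
  qed (use G key_mono in \<open>auto simp: elig_def simp flip: of_nat_mult\<close>)
  finally show ?thesis by simp
qed

lemma best_ex:
  assumes "0 < m"
  obtains j where "j < m" "\<And>i. i < m \<Longrightarrow> best z v i \<longleftrightarrow> i = j" "\<And>i. i < m \<Longrightarrow> gain z v i \<le> gain z v j"
proof -
  let ?h = "\<lambda>i. gain z v i * m + i"
  have "Max (?h ` {..<m}) \<in> ?h ` {..<m}"
    using assms by (intro Max_in) auto
  then obtain j where j: "j < m" "Max (?h ` {..<m}) = ?h j" by auto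
  have max: "?h i \<le> ?h j" if "i < m" for i
    using that unfolding j(2)[symmetric] by (intro Max_ge) auto
  have "best z v i \<longleftrightarrow> i = j" if "i < m" for i
  proof
    assume "best z v i"
    then have "?h i = ?h j" using max[OF that] j(1) by (auto simp: best_def intro: antisym)
    then have "?h i mod m = ?h j mod m" by simp
    then show "i = j" using that j(1) by simp
  qed (use max in \<open>auto simp: best_def\<close>)
  moreover have "gain z v i \<le> gain z v j" if "i < m" for i
  proof (rule ccontr)
    assume "\<not> ?thesis"
    then have "Suc (gain z v j) * m \<le> gain z v i * m" by (intro mult_le_mono1) simp
    then show False using max[OF that] j(1) by simp
  qed
  ultimately show thesis using that j(1) by blast
qed

lemma pick_price:
  assumes "0 < m"
  obtains j where "j < m" "\<And>e. pick z v e \<longleftrightarrow> sel z v j e" "price z v = \<beta> j"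
    "\<And>i. i < m \<Longrightarrow> gain z v i \<le> gain z v j"
proof -
  obtain j where j: "j < m" "\<And>i. i < m \<Longrightarrow> best z v i \<longleftrightarrow> i = j"
    "\<And>i. i < m \<Longrightarrow> gain z v i \<le> gain z v j"
    using best_ex[OF assms] by blast
  have "pick z v e \<longleftrightarrow> sel z v j e" for e
    using j by (auto simp: pick_def)
  moreover have "price z v = (\<Sum>i<m. if i = j then \<beta> i else 0)"
    unfolding price_def using j(2) by (intro sum.cong) auto
  ultimately show thesis using that j by simp
qed

lemma pickD:
  assumes "pick z v e"
  shows "arc v e" "price z v \<le> \<beta> e" "z (oth e v) < N * price z v"
proof -
  have "0 < m" using assms by (auto simp: pick_def)
  then obtain j where "sel z v j e" "price z v = \<beta> j"
    using assms by (metis pick_price)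
  then show "arc v e" "price z v \<le> \<beta> e" "z (oth e v) < N * price z v"
    by (auto simp: sel_def elig_def)
qed

lemma price_le_total: "price z v \<le> total"
proof (cases "m = 0")
  case False
  then obtain j where "j < m" "price z v = \<beta> j" by (metis pick_price neq0_conv)
  then show ?thesis unfolding total_def by (auto intro: member_le_sum)
next
  case True
  then have "price z v = 0" unfolding price_def by simp
  then show ?thesis by simp
qed

lemma card_pick: "card {e\<in>{..<m}. pick z v e} \<le> \<kappa> v"
proof (cases "m = 0")
  case False
  then obtain j where "\<And>e. pick z v e \<longleftrightarrow> sel z v j e" by (metis pick_price neq0_conv)
  then show ?thesis using card_sel by simp
qed simp

definition surplus :: "(nat \<Rightarrow> nat) \<Rightarrow> nat \<Rightarrow> real" where
  "surplus z v = (\<Sum>e<m. of_bool (pick z v e) * (real (N * price z v) - real (z (oth e v))))"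

lemma surplus_nonneg: "0 \<le> surplus z v"
  unfolding surplus_def
  by (intro sum_nonneg) (auto dest: pickD(3) simp flip: of_nat_mult)

text \<open>Optimality against every real price \<open>q\<close>, although only budgets are tried:
  raising \<open>q\<close> to the smallest budget in \<open>G\<close> loses no edge and never
  decreases the profit.\<close>

lemma surplus_ge:
  assumes G: "G \<subseteq> {..<m}" "\<And>e. e \<in> G \<Longrightarrow> arc v e \<and> q \<le> real (\<beta> e)" "card G \<le> \<kappa> v"
  shows "(\<Sum>e\<in>G. real N * q - real (z (oth e v))) \<le> surplus z v"
proof (cases "G = {}")
  case True
  then show ?thesis using surplus_nonneg by simp
next
  case False
  have fin: "finite G" using G(1) finite_subset by auto
  obtain i where i: "i \<in> G" "\<And>e. e \<in> G \<Longrightarrow> \<beta> i \<le> \<beta> e"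
    using fin False by (metis arg_min_if_finite(1) arg_min_least)
  have im: "i < m" using i G(1) by auto
  obtain j where j: "j < m" "\<And>e. pick z v e \<longleftrightarrow> sel z v j e" "price z v = \<beta> j"
    "\<And>i. i < m \<Longrightarrow> gain z v i \<le> gain z v j"
    using pick_price[of z v] im by (metis gr_implies_not0 neq0_conv)
  have "(\<Sum>e\<in>G. real N * q - real (z (oth e v))) \<le> (\<Sum>e\<in>G. real (N * \<beta> i) - real (z (oth e v)))"
    using G(2)[OF i(1)] by (intro sum_mono) (auto intro: mult_left_mono)
  also have "\<dots> \<le> real (gain z v i)"
    by (rule gain_ge) (use G i in auto)
  also have "\<dots> \<le> real (gain z v j)" using j(4)[OF im] by simp
  also have "\<dots> = surplus z v"
    unfolding gain_eq surplus_def j(2,3) sum.inter_filter[OF finite_lessThan] by (intro sum.cong) auto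
  finally show ?thesis .
qed

lemma sum_by_oth:
  fixes f :: "nat \<Rightarrow> real"
  assumes "F \<subseteq> {..<m}"
  shows "(\<Sum>v<n. \<Sum>e\<in>F. of_bool (P v e) * f (oth e v)) =
    (\<Sum>u<n. f u * (\<Sum>v<n. \<Sum>e\<in>F. of_bool (P v e \<and> oth e v = u)))"
proof -
  have "(\<Sum>u<n. f u * (\<Sum>v<n. \<Sum>e\<in>F. of_bool (P v e \<and> oth e v = u))) =
      (\<Sum>u<n. \<Sum>v<n. \<Sum>e\<in>F. f u * of_bool (P v e \<and> oth e v = u))"
    by (simp add: sum_distrib_left)
  also have "\<dots> = (\<Sum>v<n. \<Sum>e\<in>F. \<Sum>u<n. f u * of_bool (P v e \<and> oth e v = u))"
    by (rule trans[OF sum.swap]) (intro sum.cong refl sum.swap)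
  also have "\<dots> = (\<Sum>v<n. \<Sum>e\<in>F. of_bool (P v e) * f (oth e v))"
  proof (intro sum.cong refl)
    fix v e assume "e \<in> F"
    then have "oth e v < n" using assms oth_less by auto
    have "(\<Sum>u<n. f u * of_bool (P v e \<and> oth e v = u)) = 
        (\<Sum>u<n. if u = oth e v then of_bool (P v e) * f (oth e v) else 0)"
      by (intro sum.cong) auto
    then show "(\<Sum>u<n. f u * of_bool (P v e \<and> oth e v = u)) = of_bool (P v e) * f (oth e v)"
      using \<open>oth e v < n\<close> by simp
  qed
  finally show ?thesis by simp
qed

section \<open>Multipliers: boundedness, average loads and regret\<close>

lemma real_load: "real (load z u) = (\<Sum>v<n. \<Sum>e<m. of_bool (pick z v e \<and> oth e v = u))"
  by (simp add: load_def)

lemma sum_surplus: "(\<Sum>v<n. surplus z v) = real N * rev z - (\<Sum>u<n. real (z u) * real (load z u))"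
proof -
  have "(\<Sum>v<n. surplus z v) = (\<Sum>v<n. \<Sum>e<m. real N * (of_bool (pick z v e) * real (price z v))) -
      (\<Sum>v<n. \<Sum>e<m. of_bool (pick z v e) * real (z (oth e v)))"
    by (simp add: surplus_def right_diff_distrib sum_subtractf mult_ac)
  then show ?thesis
    by (simp add: rev_def sum_by_oth[where f = "\<lambda>u. real (z u)"] real_load sum_distrib_left)
qed

lemma sum_arc_le_1: "e < m \<Longrightarrow> (\<Sum>v<n. of_bool (arc v e \<and> P v)) \<le> (1::nat)"
proof -
  assume e: "e < m"
  have "card {v \<in> {..<n}. arc v e \<and> P v} \<le> 1"
    using arc_unique[OF e] card_le_Suc0_iff_eq[of "{v \<in> {..<n}. arc v e \<and> P v}"] by auto
  then show ?thesis by (subst sum_of_bool_card) auto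
qed

lemma load_le: "load z u \<le> m"
proof -
  have "load z u = (\<Sum>e<m. \<Sum>v<n. of_bool (pick z v e \<and> oth e v = u))"
    unfolding load_def by (rule sum.swap)
  also have "\<dots> \<le> (\<Sum>e<m. \<Sum>v<n. of_bool (arc v e \<and> True))"
    by (intro sum_mono) (auto dest: pickD(1))
  also have "\<dots> \<le> (\<Sum>e<m. 1)"
    by (intro sum_mono sum_arc_le_1) auto
  finally show ?thesis by simp
qed

text \<open>Without load a multiplier does not grow. With load, some picked edge certifies that it
  is below \<open>N * total\<close>, and one step adds at most \<open>total * m\<close>.\<close>

lemma lam_le: "lam t u \<le> total * (N + m)"
proof (induction t)
  case (Suc t)
  show ?case
  proof (cases "load (lam t) u = 0")
    case True
    then show ?thesis using Suc by (simp add: update_def)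
  next
    case False
    then obtain v e where "pick (lam t) v e" "oth e v = u"
      unfolding load_def by (auto simp: sum_eq_0_iff split: if_splits)
    then have "lam t u < N * price (lam t) v" using pickD(3) by blast
    also have "\<dots> \<le> N * total" using price_le_total by simp
    finally have "lam t u \<le> N * total" by simp
    moreover have "total * load (lam t) u \<le> total * m" using load_le by simp
    ultimately have "lam t u + total * load (lam t) u \<le> total * (N + m)"
      by (simp only: distrib_left mult.commute[of N]) 
    then show ?thesis by (simp add: update_def)
  qed
qed simp

text \<open>In each round the multiplier grows by at least \<open>total\<close> times the excess of
  the load over the target. Summed up, the excess is at most the final multiplier divided by
  \<open>total\<close>.\<close>

lemma sum_load_le: "(\<Sum>t<T. load (lam t) u) \<le> T * target u + (N + m)"
proof (cases "total = 0")
  case True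
  have "\<not> pick (lam t) v e" for t v e
    using pickD(3)[of "lam t" v e] price_le_total[of "lam t" v] True by auto
  then show ?thesis by (simp add: load_def)
next
  case False
  have "total * (\<Sum>t<T. load (lam t) u) \<le> total * (T * target u) + lam T u"
    by (induction T) (auto simp: update_def algebra_simps)
  also have "\<dots> \<le> total * (T * target u + (N + m))"
    using lam_le[of T u] by (simp add: algebra_simps)
  finally show ?thesis using False by simp
qed

text \<open>Projection does not increase the absolute value, so the square of the unprojected step
  may be expanded; load and target both lie between 0 and \<open>W\<close>, which bounds the
  quadratic term.\<close>

lemma update_square:
  assumes "\<And>u. u < n \<Longrightarrow> \<kappa> u \<le> W" "m \<le> W"
  shows "(\<Sum>u<n. (real (update z u))\<^sup>2) \<le> (\<Sum>u<n. (real (z u))\<^sup>2) +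
    2 * real total * (\<Sum>u<n. real (z u) * (real (load z u) - real (target u))) + (real total)\<^sup>2 * (real n * (real W)\<^sup>2)"
proof -
  let ?f = "\<lambda>u. (real (z u))\<^sup>2 +
    2 * real total * (real (z u) * (real (load z u) - real (target u))) + (real total)\<^sup>2 * (real W)\<^sup>2"
  have "(real (update z u))\<^sup>2 \<le> ?f u"
    if u: "u < n" for u
  proof -
    let ?x = "real (load z u) - real (target u)"
    have "target u \<le> W" using assms(1)[OF u] by (simp add: target_def)
    then have "\<bar>?x\<bar> \<le> real W" using load_le[of z u] assms(2) by (simp add: abs_le_iff)
    then have "?x\<^sup>2 \<le> (real W)\<^sup>2" by (metis abs_ge_zero power2_abs power_mono)
    then have "(real total)\<^sup>2 * ?x\<^sup>2 \<le> (real total)\<^sup>2 * (real W)\<^sup>2" by (intro mult_left_mono) auto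
    moreover have "real (update z u) \<le> \<bar>real (z u) + real total * ?x\<bar>"
    proof (cases "total * target u \<le> z u + total * load z u")
      case True
      then have "real (update z u) = real (z u) + real total * ?x"
        by (simp add: update_def of_nat_diff algebra_simps)
      then show ?thesis by simp
    qed (simp add: update_def)
    then have "(real (update z u))\<^sup>2 \<le> (real (z u) + real total * ?x)\<^sup>2"
      by (metis of_nat_0_le_iff power2_abs power_mono)
    ultimately show ?thesis by (simp add: power2_eq_square algebra_simps)
  qed
  then have "(\<Sum>u<n. (real (update z u))\<^sup>2) \<le> (\<Sum>u<n. ?f u)"
    by (intro sum_mono) auto
  then show ?thesis
    by (simp add: sum.distrib sum_distrib_left mult.left_commute)
qed

text \<open>The usual regret bound of gradient steps, against the zero multiplier: the sum of the
  squared multipliers starts at zero and is never negative, so its linear increments cannot be too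
  negative in total.\<close>

lemma multiplier_regret:
  assumes W: "\<And>u. u < n \<Longrightarrow> \<kappa> u \<le> W" "m \<le> W"
  shows "- (real T * real total * real n * (real W)\<^sup>2 / 2) \<le>
    (\<Sum>t<T. \<Sum>u<n. real (lam t u) * (real (load (lam t) u) - real (target u)))"
proof (cases "total = 0")
  case True
  have "lam t u = 0" for t u using lam_le[of t u] True by simp
  then show ?thesis using True by simp
next
  case False
  let ?B = "real total"
  let ?D = "\<lambda>t. \<Sum>u<n. real (lam t u) * (real (load (lam t) u) - real (target u))"
  have "(\<Sum>u<n. (real (lam T u))\<^sup>2) \<le> 2 * ?B * (\<Sum>t<T. ?D t) + real T * (?B\<^sup>2 * (real n * (real W)\<^sup>2))"
  proof (induction T)
    case (Suc T)
    then show ?case using update_square[OF W, of "lam T"] by (simp add: algebra_simps)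
  qed simp
  moreover have "0 \<le> (\<Sum>u<n. (real (lam T u))\<^sup>2)" by (intro sum_nonneg) auto
  ultimately have "0 \<le> ?B * (2 * (\<Sum>t<T. ?D t) + real T * ?B * (real n * (real W)\<^sup>2))"
    by (simp add: power2_eq_square algebra_simps)
  then have "0 \<le> 2 * (\<Sum>t<T. ?D t) + real T * ?B * (real n * (real W)\<^sup>2)"
    using False by (simp add: zero_le_mult_iff)
  then show ?thesis by (simp add: algebra_simps)
qed

end

section \<open>Sums over independent choices: factorization and random sides\<close>

lemma sum_PiE_split:
  fixes g :: "'b \<Rightarrow> real"
  assumes "finite I" "v \<in> I" "finite S"
  shows "(\<Sum>\<tau>\<in>PiE I (\<lambda>_. S). g (\<tau> v) * (\<Prod>w\<in>I - {v}. h w (\<tau> w))) =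
    (\<Sum>t\<in>S. g t) * (\<Prod>w\<in>I - {v}. \<Sum>t\<in>S. h w t)"
proof -
  let ?f = "\<lambda>w t. if w = v then g t else h w t"
  have "(\<Prod>w\<in>I. \<Sum>t\<in>S. ?f w t) = (\<Sum>\<tau>\<in>PiE I (\<lambda>_. S). \<Prod>w\<in>I. ?f w (\<tau> w))"
    using assms by (intro prod_sum_PiE) auto
  moreover have "(\<Prod>w\<in>I. \<Sum>t\<in>S. ?f w t) = (\<Sum>t\<in>S. g t) * (\<Prod>w\<in>I - {v}. \<Sum>t\<in>S. h w t)"
    using assms by (subst prod.remove[of _ v]) (auto intro!: prod.cong)
  moreover have "(\<Prod>w\<in>I. ?f w (\<tau> w)) = g (\<tau> v) * (\<Prod>w\<in>I - {v}. h w (\<tau> w))" for \<tau>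
    using assms by (subst prod.remove[of _ v]) (auto intro!: prod.cong)
  ultimately show ?thesis by simp
qed

lemma sum_PiE_component:
  fixes g :: "'b \<Rightarrow> real"
  assumes "finite I" "v \<in> I" "finite S"
  shows "(\<Sum>\<tau>\<in>PiE I (\<lambda>_. S). g (\<tau> v)) = (\<Sum>t\<in>S. g t) * real (card S) ^ (card I - 1)"
  using sum_PiE_split[OF assms, of g "\<lambda>_ _. 1"] assms by simp

lemma sum_crossing_value:
  assumes "\<And>e. e < m \<Longrightarrow> U e < n \<and> V e < n \<and> U e \<noteq> V e" and F: "F \<subseteq> {..<m}"
  shows "(\<Sum>\<sigma>\<in>PiE {..<n} (\<lambda>_. {..<2::nat}). response.crossing_value n U V \<sigma> F p) =
    2 ^ n / 4 * (\<Sum>e\<in>F. p (U e) + p (V e))"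
proof -
  let ?P = "PiE {..<n} (\<lambda>_. {..<2::nat})"
  let ?arc = "response.arc U V"
  have count: "(\<Sum>\<sigma>\<in>?P. of_bool (\<sigma> v = 1 \<and> \<sigma> u = 0)) = (2 ^ n / 4 :: real)"
    if vu: "v < n" "u < n" "u \<noteq> v" for u v
  proof -
    \<comment> \<open>The condition on \<open>u\<close> becomes one factor of a product, so that
      \<open>sum_PiE_split\<close> applies.\<close>
    let ?h = "\<lambda>w b. if w = u then of_bool (b = (0::nat)) else (1::real)"
    have "(\<Sum>\<sigma>\<in>?P. of_bool (\<sigma> v = 1 \<and> \<sigma> u = 0)) =
        (\<Sum>\<sigma>\<in>?P. of_bool (\<sigma> v = 1) * (\<Prod>w\<in>{..<n} - {v}. ?h w (\<sigma> w)) :: real)"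
      using vu by (intro sum.cong refl) (simp add: prod.remove[of _ u] of_bool_conj)
    also have "\<dots> = (\<Sum>b<2. of_bool (b = (1::nat))) * (\<Prod>w\<in>{..<n} - {v}. \<Sum>b<2. ?h w b)"
      using vu by (intro sum_PiE_split) auto
    also have "(\<Prod>w\<in>{..<n} - {v}. \<Sum>b<2. ?h w b) = (\<Prod>w\<in>{..<n} - {v} - {u}. 2)"
      using vu by (subst prod.remove[of _ u]) (auto simp: numeral_2_eq_2 intro!: prod.cong)
    also have "\<dots> = 2 ^ (n - 2)"
      using vu by (simp add: card_Diff_singleton numeral_2_eq_2)
    also have "(\<Sum>b<2. of_bool (b = (1::nat))) * 2 ^ (n - 2) = (2 ^ n / 4 :: real)"
    proof -
      have "n = Suc (Suc (n - 2))" using vu by simp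
      then have "(2::real) ^ n = 2 * (2 * 2 ^ (n - 2))" by (metis power_Suc)
      then show ?thesis by (simp add: numeral_2_eq_2)
    qed
    finally show ?thesis .
  qed
  have edge: "(\<Sum>v<n. \<Sum>\<sigma>\<in>?P. of_bool (?arc \<sigma> v e) * p v) = 2 ^ n / 4 * (p (U e) + p (V e))"
    if e: "e < m" for e
  proof -
    note a = assms(1)[OF e]
    have "(\<Sum>v<n. \<Sum>\<sigma>\<in>?P. of_bool (?arc \<sigma> v e) * p v) =
        (\<Sum>v<n. if v = U e \<or> v = V e then 2 ^ n / 4 * p v else 0)"
    proof (intro sum.cong refl)
      fix v assume v: "v \<in> {..<n}"
      have "(\<Sum>\<sigma>\<in>?P. of_bool (?arc \<sigma> v e) * p v) = (\<Sum>\<sigma>\<in>?P. of_bool (?arc \<sigma> v e)) * p v"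
        by (simp add: sum_distrib_right)
      also have "(\<Sum>\<sigma>\<in>?P. of_bool (?arc \<sigma> v e)) = (if v = U e \<or> v = V e then 2 ^ n / 4 else 0 :: real)"
        using count[of v "if U e = v then V e else U e"] a v
        by (auto simp: response.arc_def response.inc_def response.oth_def)
      finally show "(\<Sum>\<sigma>\<in>?P. of_bool (?arc \<sigma> v e) * p v) = (if v = U e \<or> v = V e then 2 ^ n / 4 * p v else 0)"
        by simp
    qed
    also have "\<dots> = (\<Sum>v\<in>{U e, V e}. 2 ^ n / 4 * p v)"
      using a by (intro sum.mono_neutral_cong_right) auto
    finally show ?thesis using a by (simp add: distrib_left)
  qed
  have "(\<Sum>\<sigma>\<in>?P. response.crossing_value n U V \<sigma> F p) =
      (\<Sum>v<n. \<Sum>\<sigma>\<in>?P. \<Sum>e\<in>F. of_bool (?arc \<sigma> v e) * p v)"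
    unfolding response.crossing_value_def by (rule sum.swap)
  also have "\<dots> = (\<Sum>v<n. \<Sum>e\<in>F. \<Sum>\<sigma>\<in>?P. of_bool (?arc \<sigma> v e) * p v)"
    by (intro sum.cong refl sum.swap)
  also have "\<dots> = (\<Sum>e\<in>F. \<Sum>v<n. \<Sum>\<sigma>\<in>?P. of_bool (?arc \<sigma> v e) * p v)"
    by (rule sum.swap)
  also have "\<dots> = (\<Sum>e\<in>F. 2 ^ n / 4 * (p (U e) + p (V e)))"
    using edge F by (intro sum.cong) auto
  finally show ?thesis by (simp add: sum_distrib_left)
qed

section \<open>Duality: the rounds compared with an arbitrary solution\<close>

context response_graph
begin

lemma target_ge:
  assumes "0 < k"
  shows "(1 - 1 / real k) * real (\<kappa> u) \<le> real (target u)"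
proof -
  have "real (\<kappa> u div k) \<le> real (\<kappa> u) / real k" by (simp add: of_nat_div_le_of_nat)
  moreover have "\<kappa> u div k \<le> \<kappa> u" by simp
  ultimately show ?thesis by (simp add: target_def of_nat_diff left_diff_distrib)
qed

text \<open>Feasibility for the integer budgets \<open>\<beta>\<close> and the finite capacities
  \<open>\<kappa>\<close>; the prices of the competitor remain arbitrary reals.\<close>

definition solution :: "nat set \<Rightarrow> (nat \<Rightarrow> real) \<Rightarrow> bool" where
  "solution F p \<longleftrightarrow> F \<subseteq> {..<m} \<and> (\<forall>v<n. 0 \<le> p v) \<and> (\<forall>e\<in>F. p (U e) + p (V e) \<le> real (\<beta> e)) \<and>
     (\<forall>w<n. card {e \<in> F. inc e w} \<le> \<kappa> w)"

text \<open>Weak duality with reduced capacities. At every priced vertex the response earns at least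
  the Lagrangian profit of the crossing edges of \<open>F\<close>. These load a vertex
  \<open>u\<close> by \<open>L u \<le> \<kappa> u\<close>, so scaling the comparison by
  \<open>1 - 1 / k\<close> brings their load below \<open>target u\<close>, and the multipliers
  charge the competitor for at most the target.\<close>

lemma round_ge:
  assumes sol: "solution F p" and k: "0 < k"
  shows "(1 - 1 / real k) * (real N * crossing_value F p) +
    (\<Sum>u<n. real (z u) * (real (load z u) - real (target u))) \<le> real N * rev z"
proof -
  note sol = sol[unfolded solution_def]
  have F: "F \<subseteq> {..<m}" using sol by blast
  let ?\<theta> = "1 - 1 / real k"
  let ?g = "\<lambda>v. \<Sum>e\<in>F. of_bool (arc v e) * (real N * p v - real (z (oth e v)))"
  define L where "L u = (\<Sum>v<n. \<Sum>e\<in>F. of_bool (arc v e \<and> oth e v = u) :: real)" for u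
  have finF: "finite F" using F finite_subset by auto
  have \<theta>: "0 \<le> ?\<theta>" "?\<theta> \<le> 1" using k by auto
  have "?g v \<le> surplus z v" if v: "v < n" for v
  proof -
    have "(\<Sum>e\<in>{e\<in>F. arc v e}. real N * p v - real (z (oth e v))) \<le> surplus z v"
    proof (rule surplus_ge)
      show "{e\<in>F. arc v e} \<subseteq> {..<m}" using F by auto
      \<comment> \<open>Omitting the competitor's nonnegative price at the free endpoint keeps the
        edge within its budget.\<close>
      show "arc v e \<and> p v \<le> real (\<beta> e)" if "e \<in> {e\<in>F. arc v e}" for e
      proof -
        have e: "e < m" "e \<in> F" "arc v e" using that F by auto
        then have "p (U e) + p (V e) = p v + p (oth e v)"
          by (auto simp: arc_def inc_def oth_def)
        moreover have "p (U e) + p (V e) \<le> real (\<beta> e)" "0 \<le> p (oth e v)"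
          using sol e oth_less[OF e(1), of v] by auto
        ultimately show ?thesis using e by simp
      qed
      have "card {e\<in>F. arc v e} \<le> card {e\<in>F. inc e v}"
        using finF by (intro card_mono) (auto simp: arc_def)
      then show "card {e\<in>F. arc v e} \<le> \<kappa> v" using sol v by (meson order.trans)
    qed
    also have "(\<Sum>e\<in>{e\<in>F. arc v e}. real N * p v - real (z (oth e v))) =
        ?g v"
      unfolding sum.inter_filter[OF finF] by (intro sum.cong) auto
    finally show ?thesis .
  qed
  then have "(\<Sum>v<n. ?g v) \<le> (\<Sum>v<n. surplus z v)"
    by (intro sum_mono) auto
  moreover have "(\<Sum>v<n. ?g v) =
      real N * crossing_value F p - (\<Sum>u<n. real (z u) * L u)"
  proof -
    have "(\<Sum>v<n. ?g v) =
      (\<Sum>v<n. \<Sum>e\<in>F. real N * (of_bool (arc v e) * p v)) - (\<Sum>v<n. \<Sum>e\<in>F. of_bool (arc v e) * real (z (oth e v)))"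
      by (simp add: right_diff_distrib sum_subtractf mult_ac)
    then show ?thesis
      by (simp add: crossing_value_def L_def sum_by_oth[OF F, where f = "\<lambda>u. real (z u)"] sum_distrib_left)
  qed
  ultimately have "?\<theta> * (real N * crossing_value F p - (\<Sum>u<n. real (z u) * L u)) \<le> ?\<theta> * (\<Sum>v<n. surplus z v)"
    using \<theta> by (intro mult_left_mono) auto
  also have "\<dots> \<le> (\<Sum>v<n. surplus z v)"
    using \<theta> surplus_nonneg by (intro mult_left_le_one_le sum_nonneg) auto
  also have "\<dots> = real N * rev z - (\<Sum>u<n. real (z u) * real (load z u))"
    by (rule sum_surplus)
  finally have "?\<theta> * (real N * crossing_value F p) - (\<Sum>u<n. real (z u) * (?\<theta> * L u)) \<le>
     real N * rev z - (\<Sum>u<n. real (z u) * real (load z u))"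
    by (simp add: right_diff_distrib sum_distrib_left mult.left_commute)
  moreover have "(\<Sum>u<n. real (z u) * (?\<theta> * L u)) \<le> (\<Sum>u<n. real (z u) * real (target u))"
  proof (intro sum_mono mult_left_mono)
    fix u assume u: "u \<in> {..<n}"
    have "L u = (\<Sum>e\<in>F. \<Sum>v<n. of_bool (arc v e \<and> oth e v = u))"
      unfolding L_def by (rule sum.swap)
    also have "\<dots> \<le> (\<Sum>e\<in>F. of_bool (inc e u))"
    proof (rule sum_mono)
      fix e assume "e \<in> F"
      then have e: "e < m" using F by auto
      have "(\<Sum>v<n. of_bool (arc v e \<and> oth e v = u)) \<le> (of_bool (inc e u) :: nat)"
        using sum_arc_le_1[OF e, of "\<lambda>v. oth e v = u"] inc_oth[of e] by (cases "inc e u") auto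
      then show "(\<Sum>v<n. of_bool (arc v e \<and> oth e v = u)) \<le> (of_bool (inc e u) :: real)"
        by (metis (mono_tags, lifting) of_nat_le_iff of_nat_of_bool of_nat_sum sum.cong)
    qed
    also have "\<dots> = real (card {e \<in> F. inc e u})"
      by (rule sum_of_bool_card[OF finF])
    also have "\<dots> \<le> real (\<kappa> u)" using sol u by simp
    finally have "?\<theta> * L u \<le> ?\<theta> * real (\<kappa> u)" using \<theta> by (intro mult_left_mono) auto
    then show "?\<theta> * L u \<le> real (target u)" using target_ge[OF k, of u] by linarith
  qed simp
  ultimately show ?thesis by (simp add: right_diff_distrib sum_subtractf)
qed

text \<open>The multiplier terms of all rounds together are bounded below by the regret bound. In
  the units of \<open>\<beta>\<close> the loss shrinks like \<open>1 / N\<close>, which is why the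
  multipliers get a finer unit.\<close>

lemma sum_rev_ge:
  assumes sol: "solution F p" and k: "0 < k"
    and W: "\<And>u. u < n \<Longrightarrow> \<kappa> u \<le> W" "m \<le> W" and N: "0 < N"
  shows "real T * ((1 - 1 / real k) * crossing_value F p - real total * real n * (real W)\<^sup>2 / (2 * real N)) \<le>
    (\<Sum>t<T. rev (lam t))"
proof -
  let ?R = "\<lambda>t. (\<Sum>u<n. real (lam t u) * (real (load (lam t) u) - real (target u)))"
  let ?c = "(1 - 1 / real k) * (real N * crossing_value F p)"
  have "(\<Sum>t<T. ?c + ?R t) \<le> (\<Sum>t<T. real N * rev (lam t))"
    using round_ge[OF sol k] by (intro sum_mono) auto
  then have "real T * ?c - real T * real total * real n * (real W)\<^sup>2 / 2 \<le> real N * (\<Sum>t<T. rev (lam t))"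
    using multiplier_regret[OF W, of T] by (simp add: sum.distrib sum_distrib_left)
  moreover have "real T * ?c - real T * real total * real n * (real W)\<^sup>2 / 2 =
      real N * (real T * ((1 - 1 / real k) * crossing_value F p - real total * real n * (real W)\<^sup>2 / (2 * real N)))"
    using N by (simp add: field_simps)
  ultimately show ?thesis using N by (simp add: mult_le_cancel_left_pos)
qed

section \<open>Rounding to one random round per priced vertex\<close>

definition earned :: "(nat \<Rightarrow> nat) \<Rightarrow> nat \<Rightarrow> nat \<Rightarrow> real" where
  "earned \<tau> v e = of_bool (pick (lam (\<tau> v)) v e \<and> kept \<tau> e) * real (price (lam (\<tau> v)) v)"

definition offered :: "nat \<Rightarrow> nat \<Rightarrow> nat \<Rightarrow> real" where
  "offered v e t = of_bool (pick (lam t) v e) * real (price (lam t) v)"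

definition contrib :: "nat \<Rightarrow> nat \<Rightarrow> nat \<Rightarrow> nat" where
  "contrib u w t = (\<Sum>e<m. of_bool (pick (lam t) w e \<and> oth e w = u))"

text \<open>Simplicity of the graph enters here: \<open>w\<close> has at most one edge to
  \<open>u\<close>. The load at \<open>u\<close> is thus a sum of zero-one terms that depend on
  different, independently drawn rounds.\<close>

lemma contrib_le_1: "contrib u w t \<le> 1"
proof -
  have "card {e \<in> {..<m}. pick (lam t) w e \<and> oth e w = u} \<le> 1"
    using card_le_Suc0_iff_eq[of "{e \<in> {..<m}. pick (lam t) w e \<and> oth e w = u}"] arc_eq[of _ _ w]
    by (auto dest!: pickD(1))
  then show ?thesis unfolding contrib_def by (subst sum_of_bool_card) auto
qed

lemma load_contrib: "load (lam t) u = (\<Sum>w<n. contrib u w t)"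
  by (simp add: load_def contrib_def)

text \<open>Leaving \<open>v\<close> out of the sum makes the bad event independent of the round of
  \<open>v\<close>, and hence of the price offered for \<open>e\<close>. This is possible since the
  edges that crowd out \<open>e\<close> at its free endpoint belong to other priced vertices, by
  simplicity.\<close>

lemma overfull_if_dropped:
  assumes e: "e < m" "v < n" and pick: "pick (lam (\<tau> v)) v e" and "\<not> kept \<tau> e"
  shows "\<kappa> (oth e v) \<le> (\<Sum>w\<in>{..<n} - {v}. contrib (oth e v) w (\<tau> w))"
proof -
  have "chosen \<tau> e" using e pick by (auto simp: chosen_def)
  then obtain u where u: "u < n" "inc e u" "\<sigma> u = 0"
    "\<kappa> u \<le> (\<Sum>e'<m. of_bool (e' < e \<and> inc e' u \<and> chosen \<tau> e'))"
    using assms(4) by (auto simp: kept_def not_less)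
  have arc: "arc v e" using pickD(1)[OF pick] .
  have uo: "u = oth e v" using arc_inc[OF e(1) arc u(2,3)] .
  have "(\<Sum>e'<m. of_bool (e' < e \<and> inc e' u \<and> chosen \<tau> e')) \<le>
      (\<Sum>e'<m. \<Sum>w\<in>{..<n} - {v}. of_bool (pick (lam (\<tau> w)) w e' \<and> oth e' w = u) :: nat)"
  proof (rule sum_mono)
    fix e' assume e': "e' \<in> {..<m}"
    show "of_bool (e' < e \<and> inc e' u \<and> chosen \<tau> e') \<le>
        (\<Sum>w\<in>{..<n} - {v}. of_bool (pick (lam (\<tau> w)) w e' \<and> oth e' w = u) :: nat)"
    proof (cases "e' < e \<and> inc e' u \<and> chosen \<tau> e'")
      case True
      then obtain w where w: "w < n" "pick (lam (\<tau> w)) w e'" by (auto simp: chosen_def)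
      have o: "oth e' w = u"
        using arc_inc[of e' w u] e' pickD(1)[OF w(2)] True u(3) by auto
      have "w \<noteq> v"
        using arc_eq[of e e' v] e' e pickD(1)[OF w(2)] arc o uo True by auto
      then have "(\<Sum>w\<in>{w}. of_bool (pick (lam (\<tau> w)) w e' \<and> oth e' w = u) :: nat) \<le>
          (\<Sum>w\<in>{..<n} - {v}. of_bool (pick (lam (\<tau> w)) w e' \<and> oth e' w = u))"
        using w by (intro sum_mono2) auto
      then show ?thesis using w o by simp
    next
      case False
      then have "of_bool (e' < e \<and> inc e' u \<and> chosen \<tau> e') = (0::nat)"
        by (simp only: of_bool_eq_0_iff not_False_eq_True)
      then show ?thesis by linarith
    qed
  qed
  also have "\<dots> = (\<Sum>w\<in>{..<n} - {v}. contrib u w (\<tau> w))"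
    unfolding contrib_def by (rule sum.swap)
  finally show ?thesis using u(4) uo by simp
qed

text \<open>An exponential moment bound. A dropped edge forces the product of the factors
  \<open>h\<close> to be at least \<open>(1 + \<delta>) ^ \<kappa> u\<close>, so the quotient of the
  two bounds the indicator of a drop pointwise. The rounds are independent, so the product may be
  averaged factor by factor, and \<open>1 + x \<le> exp x\<close> turns the result into the average
  load of \<open>u\<close>. The hypothesis on \<open>s\<close> says that the drop probability
  estimated in this way is at most \<open>s\<close>.\<close>

lemma rounding_edge:
  fixes \<delta> s :: real
  assumes e: "e < m" "v < n" and T: "N + m \<le> T" "0 < T" and \<delta>: "0 \<le> \<delta>"
    and s: "exp (\<delta> * (real (target (oth e v)) + 1)) \<le> s * (1 + \<delta>) ^ \<kappa> (oth e v)"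
  shows "(1 - s) * (real T ^ (n - 1) * (\<Sum>t<T. offered v e t)) \<le>
    (\<Sum>\<tau>\<in>PiE {..<n} (\<lambda>_. {..<T}). earned \<tau> v e)"
proof -
  let ?P = "PiE {..<n} (\<lambda>_. {..<T})"
  define u where "u = oth e v"
  define K where "K = (1 + \<delta>) ^ \<kappa> u"
  let ?g = "offered v e"
  define h where "h w t = 1 + \<delta> * real (contrib u w t)" for w t
  have K: "0 < K" using \<delta> by (simp add: K_def add_pos_nonneg)
  have g0: "0 \<le> ?g t" for t by (simp add: offered_def)
  have h0: "0 \<le> h w t" for w t using \<delta> by (simp add: h_def)
  have h: "h w t = (1 + \<delta>) ^ contrib u w t" for w t
    using contrib_le_1[of u w t] by (cases "contrib u w t = 0") (auto simp: h_def le_Suc_eq)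
  have pt: "?g (\<tau> v) - ?g (\<tau> v) * (\<Prod>w\<in>{..<n} - {v}. h w (\<tau> w)) / K \<le>
      earned \<tau> v e" for \<tau>
  proof (cases "pick (lam (\<tau> v)) v e \<and> \<not> kept \<tau> e")
    case True
    then have "\<kappa> u \<le> (\<Sum>w\<in>{..<n} - {v}. contrib u w (\<tau> w))"
      unfolding u_def using overfull_if_dropped[OF e] by blast
    then have "K \<le> (\<Prod>w\<in>{..<n} - {v}. h w (\<tau> w))"
      unfolding K_def h power_sum[symmetric] using \<delta> by (intro power_increasing) auto
    then have "?g (\<tau> v) * 1 \<le> ?g (\<tau> v) * ((\<Prod>w\<in>{..<n} - {v}. h w (\<tau> w)) / K)"
      using K g0 by (intro mult_left_mono) (auto simp: le_divide_eq)
    then show ?thesis using True by (simp add: earned_def)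
  next
    case False
    have "0 \<le> ?g (\<tau> v) * (\<Prod>w\<in>{..<n} - {v}. h w (\<tau> w)) / K"
      using K g0 h0 by (intro divide_nonneg_pos mult_nonneg_nonneg prod_nonneg) auto
    moreover have "?g (\<tau> v) = earned \<tau> v e"
      using False by (auto simp: offered_def earned_def)
    ultimately show ?thesis by simp
  qed
  have avg: "(\<Prod>w\<in>{..<n} - {v}. \<Sum>t<T. h w t) \<le> real T ^ (n - 1) * (s * K)"
  proof -
    let ?x = "\<lambda>w. real (\<Sum>t<T. contrib u w t) / real T"
    have "(\<Prod>w\<in>{..<n} - {v}. \<Sum>t<T. h w t) \<le> (\<Prod>w\<in>{..<n} - {v}. real T * exp (\<delta> * ?x w))"
    proof (intro prod_mono conjI sum_nonneg h0)
      fix w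
      have "(\<Sum>t<T. h w t) = real T * (1 + \<delta> * ?x w)"
        using T by (simp add: h_def sum.distrib sum_distrib_left field_simps)
      also have "\<dots> \<le> real T * exp (\<delta> * ?x w)"
        by (intro mult_left_mono exp_ge_add_one_self) auto
      finally show "(\<Sum>t<T. h w t) \<le> real T * exp (\<delta> * ?x w)" .
    qed
    also have "\<dots> = real T ^ (n - 1) * exp (\<delta> * (\<Sum>w\<in>{..<n} - {v}. ?x w))"
      using e by (simp add: prod.distrib exp_sum sum_distrib_left)
    also have "\<dots> \<le> real T ^ (n - 1) * exp (\<delta> * (real (target u) + 1))"
    proof -
      have "(\<Sum>w\<in>{..<n} - {v}. ?x w) \<le> (\<Sum>w<n. ?x w)"
        by (intro sum_mono2 divide_nonneg_nonneg) (auto intro: sum_nonneg)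
      also have "\<dots> = real (\<Sum>t<T. load (lam t) u) / real T"
        unfolding sum_divide_distrib[symmetric] of_nat_sum[symmetric] load_contrib
        by (subst sum.swap) simp
      also have "\<dots> \<le> real (T * target u + (N + m)) / real T"
        by (intro divide_right_mono of_nat_mono sum_load_le) simp
      \<comment> \<open>The excess \<open>N + m\<close> over all rounds is at most one per round;
        this is the origin of the \<open>+ 1\<close> in the hypothesis on \<open>s\<close>.\<close>
      also have "\<dots> \<le> real (T * (target u + 1)) / real T"
        using T(1) by (intro divide_right_mono of_nat_mono) auto
      also have "\<dots> = real (target u) + 1" using T(2) by (simp add: field_simps)
      finally show ?thesis using \<delta> by (intro mult_left_mono) (auto intro: mult_left_mono)
    qed
    also have "\<dots> \<le> real T ^ (n - 1) * (s * K)"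
      using s by (intro mult_left_mono) (auto simp: K_def u_def)
    finally show ?thesis .
  qed
  have "(1 - s) * (real T ^ (n - 1) * (\<Sum>t<T. ?g t)) =
      (\<Sum>t<T. ?g t) * real T ^ (n - 1) - (\<Sum>t<T. ?g t) * (real T ^ (n - 1) * (s * K)) / K"
    using K by (simp add: field_simps)
  also have "\<dots> \<le> (\<Sum>t<T. ?g t) * real T ^ (n - 1) - (\<Sum>t<T. ?g t) * (\<Prod>w\<in>{..<n} - {v}. \<Sum>t<T. h w t) / K"
    using K avg g0 by (intro diff_left_mono divide_right_mono mult_left_mono sum_nonneg) auto
  also have "\<dots> = (\<Sum>\<tau>\<in>?P. ?g (\<tau> v)) - (\<Sum>\<tau>\<in>?P. ?g (\<tau> v) * (\<Prod>w\<in>{..<n} - {v}. h w (\<tau> w))) / K"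
    using e sum_PiE_split[of "{..<n}" v "{..<T}" ?g h] sum_PiE_component[of "{..<n}" v "{..<T}" ?g] by simp
  also have "\<dots> = (\<Sum>\<tau>\<in>?P. ?g (\<tau> v) - ?g (\<tau> v) * (\<Prod>w\<in>{..<n} - {v}. h w (\<tau> w)) / K)"
    by (simp add: sum_subtractf sum_divide_distrib)
  also have "\<dots> \<le> (\<Sum>\<tau>\<in>?P. earned \<tau> v e)"
    by (intro sum_mono pt)
  finally show ?thesis .
qed

section \<open>Feasibility and revenue of the rounded solution\<close>

definition sol_edges :: "(nat \<Rightarrow> nat) \<Rightarrow> nat set" where
  "sol_edges \<tau> = {e \<in> {..<m}. kept \<tau> e}"

definition sol_revenue :: "(nat \<Rightarrow> nat) \<Rightarrow> real" where
  "sol_revenue \<tau> = (\<Sum>e\<in>sol_edges \<tau>. real (prc \<tau> (U e)) + real (prc \<tau> (V e)))"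

text \<open>The free endpoint costs nothing, so an edge pays exactly the price at its priced
  endpoint.\<close>

lemma kept_obtain:
  assumes "e < m" "kept \<tau> e"
  obtains v where "v < n" "arc v e" "pick (lam (\<tau> v)) v e"
    "prc \<tau> (U e) + prc \<tau> (V e) = price (lam (\<tau> v)) v"
proof -
  obtain v where v: "v < n" "pick (lam (\<tau> v)) v e"
    using assms by (auto simp: kept_def chosen_def)
  have arc: "arc v e" using pickD(1)[OF v(2)] .
  have "prc \<tau> (U e) + prc \<tau> (V e) = prc \<tau> v + prc \<tau> (oth e v)"
    using arc by (auto simp: arc_def inc_def oth_def)
  then have "prc \<tau> (U e) + prc \<tau> (V e) = price (lam (\<tau> v)) v"
    using arc by (auto simp: arc_def prc_def)
  then show thesis using that v arc by blast
qed

lemma sol_within_budget: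
  assumes "e \<in> sol_edges \<tau>"
  shows "prc \<tau> (U e) + prc \<tau> (V e) \<le> \<beta> e"
proof -
  have "e < m" "kept \<tau> e" using assms by (auto simp: sol_edges_def)
  then obtain v where "pick (lam (\<tau> v)) v e" "prc \<tau> (U e) + prc \<tau> (V e) = price (lam (\<tau> v)) v"
    using kept_obtain by metis
  then show ?thesis using pickD(2) by metis
qed

lemma sol_revenue_eq:
  "sol_revenue \<tau> = (\<Sum>v<n. \<Sum>e<m. earned \<tau> v e)"
proof -
  have "sol_revenue \<tau> = (\<Sum>e<m. if kept \<tau> e then real (prc \<tau> (U e)) + real (prc \<tau> (V e)) else 0)"
    unfolding sol_revenue_def sol_edges_def by (rule sum.inter_filter) simp
  also have "\<dots> = (\<Sum>e<m. \<Sum>v<n. earned \<tau> v e)"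
  proof (rule sum.cong[OF refl])
    fix e assume "e \<in> {..<m}"
    then have e: "e < m" by simp
    show "(if kept \<tau> e then real (prc \<tau> (U e)) + real (prc \<tau> (V e)) else 0) =
      (\<Sum>v<n. earned \<tau> v e)"
    proof (cases "kept \<tau> e")
      case True
      obtain v where v: "v < n" "arc v e" "pick (lam (\<tau> v)) v e"
        "prc \<tau> (U e) + prc \<tau> (V e) = price (lam (\<tau> v)) v"
        using kept_obtain[OF e True] by blast
      have "(\<Sum>w<n. earned \<tau> w e) =
          (\<Sum>w<n. if w = v then real (price (lam (\<tau> v)) v) else 0)"
        using arc_unique[OF e v(2)] pickD(1) v(3) True by (intro sum.cong) (auto simp: earned_def)
      then show ?thesis using True v by (simp flip: of_nat_add)
    qed (simp add: earned_def)
  qed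
  also have "\<dots> = (\<Sum>v<n. \<Sum>e<m. earned \<tau> v e)"
    by (rule sum.swap)
  finally show ?thesis .
qed

text \<open>On the free side all kept edges at \<open>w\<close> except the one with the largest
  index count against that one, so fewer than \<open>\<kappa> w\<close> others exist. On the priced
  side every kept edge at \<open>w\<close> stems from the response of \<open>w\<close>, which
  respects the capacity.\<close>

lemma sol_within_cap: 
  assumes "w < n"
  shows "card {e \<in> sol_edges \<tau>. inc e w} \<le> \<kappa> w"
proof (cases "{e \<in> sol_edges \<tau>. inc e w} = {}")
  case False
  define S where "S = {e \<in> sol_edges \<tau>. inc e w}"
  have fin: "finite S" by (simp add: S_def sol_edges_def)
  have S: "x < m" "kept \<tau> x" "inc x w" if "x \<in> S" for x
    using that by (auto simp: S_def sol_edges_def)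
  show ?thesis
  proof (cases "\<sigma> w = 0")
    case True
    let ?e = "Max S"
    have "?e \<in> S" using fin False by (intro Max_in) (auto simp: S_def)
    then have "kept \<tau> ?e" "inc ?e w" using S by auto
    then have "(\<Sum>e'<m. of_bool (e' < ?e \<and> inc e' w \<and> chosen \<tau> e')) < \<kappa> w"
      using True assms unfolding kept_def by blast
    then have "card {e' \<in> {..<m}. e' < ?e \<and> inc e' w \<and> chosen \<tau> e'} < \<kappa> w"
      unfolding sum_of_bool_card[OF finite_lessThan] of_nat_id .
    moreover have "card (S - {?e}) \<le> card {e' \<in> {..<m}. e' < ?e \<and> inc e' w \<and> chosen \<tau> e'}"
    proof (rule card_mono)
      show "S - {?e} \<subseteq> {e' \<in> {..<m}. e' < ?e \<and> inc e' w \<and> chosen \<tau> e'}"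
      proof
        fix x assume "x \<in> S - {?e}"
        then show "x \<in> {e' \<in> {..<m}. e' < ?e \<and> inc e' w \<and> chosen \<tau> e'}"
          using Max_ge[OF fin, of x] S[of x] le_neq_implies_less[of x ?e] by (auto simp: kept_def)
      qed
    qed simp
    ultimately show ?thesis
      using \<open>?e \<in> S\<close> fin unfolding S_def[symmetric] by simp
  next
    case False
    have "S \<subseteq> {e\<in>{..<m}. pick (lam (\<tau> w)) w e}"
    proof
      fix e assume "e \<in> S"
      then have e: "e < m" "kept \<tau> e" "inc e w" using S by auto
      obtain v where v: "arc v e" "pick (lam (\<tau> v)) v e" using kept_obtain[OF e(1,2)] by blast
      have "w = v"
        using inc_cases[OF e(1) _ e(3), of v] v(1) False by (auto simp: arc_def)
      then show "e \<in> {e\<in>{..<m}. pick (lam (\<tau> w)) w e}" using v e by simp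
    qed
    then have "card S \<le> card {e\<in>{..<m}. pick (lam (\<tau> w)) w e}" by (intro card_mono) auto
    then show ?thesis using card_pick[of "lam (\<tau> w)" w] by (simp add: S_def)
  qed
next
  case True
  show ?thesis unfolding True by simp
qed

lemma sum_sol_revenue_ge:
  fixes \<delta> s :: real
  assumes sol: "solution F p" and k: "0 < k"
    and W: "\<And>u. u < n \<Longrightarrow> \<kappa> u \<le> W" "m \<le> W" and N: "0 < N"
    and T: "N + m \<le> T" and \<delta>: "0 \<le> \<delta>" and s1: "s \<le> 1"
    and s: "\<And>u. u < n \<Longrightarrow> exp (\<delta> * (real (target u) + 1)) \<le> s * (1 + \<delta>) ^ \<kappa> u"
  shows "(1 - s) * real T ^ n *
      ((1 - 1 / real k) * crossing_value F p - real total * real n * (real W)\<^sup>2 / (2 * real N)) \<le>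
    (\<Sum>\<tau>\<in>PiE {..<n} (\<lambda>_. {..<T}). sol_revenue \<tau>)"
    (is "_ * ?c \<le> _")
\<comment> \<open>The rounding bound has exponent \<open>n - 1\<close>, so the empty graph is
  treated separately.\<close>
proof (cases "n = 0")
  case True
  then have "crossing_value F p = 0" unfolding crossing_value_def by simp
  moreover have "0 \<le> (\<Sum>\<tau>\<in>PiE {..<n} (\<lambda>_. {..<T}). sol_revenue \<tau>)"
    by (intro sum_nonneg) (simp add: sol_revenue_def sum_nonneg)
  ultimately show ?thesis using True by simp
next
  case False
  have T0: "0 < T" using T N by simp
  have "real T ^ n = real T ^ (n - 1) * real T" using False by (metis mult.commute power_eq_if)
  then have "(1 - s) * real T ^ n *
      ?c =
      (1 - s) * real T ^ (n - 1) *
      (real T * ?c)"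
    by simp
  also have "\<dots> \<le> (1 - s) * real T ^ (n - 1) * (\<Sum>t<T. rev (lam t))"
    by (intro mult_left_mono sum_rev_ge[OF sol k W N]) (use s1 in auto)
  also have "\<dots> = (\<Sum>v<n. \<Sum>e<m. (1 - s) * (real T ^ (n - 1) *
      (\<Sum>t<T. offered v e t)))"
  proof -
    have "(\<Sum>t<T. rev (lam t)) = (\<Sum>v<n. \<Sum>t<T. \<Sum>e<m. offered v e t)"
      unfolding rev_def offered_def by (rule sum.swap)
    also have "\<dots> = (\<Sum>v<n. \<Sum>e<m. \<Sum>t<T. offered v e t)"
      by (intro sum.cong refl sum.swap)
    finally show ?thesis by (simp add: sum_distrib_left mult.assoc)
  qed
  also have "\<dots> \<le> (\<Sum>v<n. \<Sum>e<m. \<Sum>\<tau>\<in>PiE {..<n} (\<lambda>_. {..<T}).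
      earned \<tau> v e)"
  proof (rule sum_mono, rule sum_mono)
    fix v e assume "v \<in> {..<n}" "e \<in> {..<m}"
    then have ev: "e < m" "v < n" by auto
    show "(1 - s) * (real T ^ (n - 1) * (\<Sum>t<T. offered v e t)) \<le>
        (\<Sum>\<tau>\<in>PiE {..<n} (\<lambda>_. {..<T}). earned \<tau> v e)"
      by (rule rounding_edge[OF ev T T0 \<delta> s[OF oth_less[OF ev(1)]]])
  qed
  also have "\<dots> = (\<Sum>v<n. \<Sum>\<tau>\<in>PiE {..<n} (\<lambda>_. {..<T}). \<Sum>e<m.
      earned \<tau> v e)"
    by (intro sum.cong refl sum.swap)
  also have "\<dots> = (\<Sum>\<tau>\<in>PiE {..<n} (\<lambda>_. {..<T}). sol_revenue \<tau>)"
    unfolding sol_revenue_eq by (rule sum.swap)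
  finally show ?thesis .
qed

end

section \<open>The program\<close>

text \<open>Truth values are the numbers 0 and 1. Truncated subtraction makes
  \<open>1 - (a - b)\<close> the indicator of \<open>a \<le> b\<close>, and conjunction is
  multiplication.\<close>

definition xle :: "sexp \<Rightarrow> sexp \<Rightarrow> sexp" where
  "xle a b = Bin Minus (Num 1) (Bin Minus a b)"

definition xlt :: "sexp \<Rightarrow> sexp \<Rightarrow> sexp" where
  "xlt a b = Bin Minus (Num 1) (xle b a)"

definition xeq :: "sexp \<Rightarrow> sexp \<Rightarrow> sexp" where
  "xeq a b = Bin Times (xle a b) (xle b a)"

definition xif :: "sexp \<Rightarrow> sexp \<Rightarrow> sexp \<Rightarrow> sexp" where
  "xif c a b = Bin Plus (Bin Times c a) (Bin Times (Bin Minus (Num 1) c) b)"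

definition xsum :: "nat \<Rightarrow> nat \<Rightarrow> sexp \<Rightarrow> sexp" where
  "xsum = Fold Plus 0"

definition xprod :: "nat \<Rightarrow> nat \<Rightarrow> sexp \<Rightarrow> sexp" where
  "xprod = Fold Times (Suc 0)"

lemma den_xle [simp]: "den (xle a b) \<rho> M = of_bool (den a \<rho> M \<le> den b \<rho> M)"
  by (auto simp: xle_def)

lemma den_xlt [simp]: "den (xlt a b) \<rho> M = of_bool (den a \<rho> M < den b \<rho> M)"
  by (auto simp: xlt_def)

lemma den_xeq [simp]: "den (xeq a b) \<rho> M = of_bool (den a \<rho> M = den b \<rho> M)"
  by (auto simp: xeq_def)

lemma den_xif: "den c \<rho> M = of_bool P \<Longrightarrow> den (xif c a b) \<rho> M = (if P then den a \<rho> M else den b \<rho> M)"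
  by (auto simp: xif_def)

lemma den_xsum [simp]: "den (xsum x y b) \<rho> M = (\<Sum>i<\<rho> y. den b (\<rho>(x := i)) M)"
  by (simp add: xsum_def)

lemma den_xprod [simp]: "den (xprod x y b) \<rho> M = (\<Prod>i<\<rho> y. den b (\<rho>(x := i)) M)"
  by (simp add: xprod_def)

lemma wf_x [simp]:
  "wf_sexp (xle a b) \<longleftrightarrow> wf_sexp a \<and> wf_sexp b"
  "wf_sexp (xlt a b) \<longleftrightarrow> wf_sexp a \<and> wf_sexp b"
  "wf_sexp (xeq a b) \<longleftrightarrow> wf_sexp a \<and> wf_sexp b"
  "wf_sexp (xif c a b) \<longleftrightarrow> wf_sexp c \<and> wf_sexp a \<and> wf_sexp b"
  "wf_sexp (xsum x y b) \<longleftrightarrow> x < 40 \<and> y < 40 \<and> x \<noteq> y \<and> wf_sexp b"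
  "wf_sexp (xprod x y b) \<longleftrightarrow> x < 40 \<and> y < 40 \<and> x \<noteq> y \<and> wf_sexp b"
  by (auto simp: xle_def xlt_def xeq_def xif_def xsum_def xprod_def)

text \<open>Registers: 1 and 2 hold the numbers of vertices and edges, 3 the number of coins per vertex
  that select a round, 4 the number of rounds, 5, 6 and 7 the starts of the tables for the coins,
  the multipliers and the output, 13 the scaling factor of the multipliers, 14 the bound on the
  capacities, 40 the sum and 41 the common denominator of the budgets. The loop variables are 20 for
  the index of a table entry, 21 for rounds, 22 and 23 for vertices on the free and on the
  priced side, and 24 to 32 for edges (30 and 31 for coins).\<close>

definition xfield :: "nat \<Rightarrow> nat \<Rightarrow> sexp" where
  "xfield c e = Ld (Bin Plus (Bin Plus (Num c) (Var 1)) (Bin Times (Num 4) (Var e)))"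

abbreviation "xU \<equiv> xfield 2"
abbreviation "xV \<equiv> xfield 3"
abbreviation "xA \<equiv> xfield 4"
abbreviation "xD \<equiv> xfield 5"

definition xbeta :: "nat \<Rightarrow> sexp" where
  "xbeta e = Bin Times (xA e) (xprod 29 2 (xif (xeq (Var 29) (Var e)) (Num 1) (xD 29)))"

definition xcode :: "nat \<Rightarrow> sexp" where
  "xcode w = Ld (Bin Plus (Num 2) (Var w))"

definition xkap :: "nat \<Rightarrow> sexp" where
  "xkap w = xif (xeq (xcode w) (Num 0)) (Var 14)
     (xif (xle (Bin Minus (xcode w) (Num 1)) (Var 14)) (Bin Minus (xcode w) (Num 1)) (Var 14))"

definition xsig :: "sexp \<Rightarrow> sexp" where
  "xsig a = Ld (Bin Plus (Var 5) a)"

definition xrow :: "sexp \<Rightarrow> sexp" where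
  "xrow a = Ld (Bin Plus (Var 6) (Bin Plus (Bin Times (Var 21) (Var 1)) a))"

definition xinc :: "nat \<Rightarrow> nat \<Rightarrow> sexp" where
  "xinc e v = xlt (Num 0) (Bin Plus (xeq (xU e) (Var v)) (xeq (xV e) (Var v)))"

definition xoth :: "nat \<Rightarrow> sexp" where
  "xoth e = xif (xeq (xU e) (Var 23)) (xV e) (xU e)"

definition xelig :: "nat \<Rightarrow> nat \<Rightarrow> sexp" where
  "xelig e j = Bin Times (Bin Times (xinc e 23) (Bin Times (xeq (xsig (Var 23)) (Num 1)) (xeq (xsig (xoth e)) (Num 0))))
     (Bin Times (xle (xbeta j) (xbeta e)) (xlt (xrow (xoth e)) (Bin Times (Var 13) (xbeta j))))"

definition xkey :: "nat \<Rightarrow> sexp" where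
  "xkey e = Bin Plus (Bin Times (xrow (xoth e)) (Var 2)) (Var e)"

definition xrank :: "nat \<Rightarrow> nat \<Rightarrow> sexp" where
  "xrank e j = xsum 28 2 (Bin Times (xelig 28 j) (xlt (xkey 28) (xkey e)))"

definition xsel :: "nat \<Rightarrow> nat \<Rightarrow> sexp" where
  "xsel e j = Bin Times (xelig e j) (xlt (xrank e j) (xkap 23))"

definition xgain :: "nat \<Rightarrow> sexp" where
  "xgain j = xsum 27 2 (Bin Times (xsel 27 j) (Bin Minus (Bin Times (Var 13) (xbeta j)) (xrow (xoth 27))))"

definition xbest :: "nat \<Rightarrow> sexp" where
  "xbest j = xeq (xsum 26 2 (xlt (Bin Plus (Bin Times (xgain j) (Var 2)) (Var j))
     (Bin Plus (Bin Times (xgain 26) (Var 2)) (Var 26)))) (Num 0)"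

definition xpick :: "nat \<Rightarrow> sexp" where
  "xpick e = xlt (Num 0) (xsum 25 2 (Bin Times (xbest 25) (xsel e 25)))"

definition xprice :: sexp where
  "xprice = xsum 25 2 (Bin Times (xbest 25) (xbeta 25))"

definition xload :: sexp where
  "xload = xsum 23 1 (xsum 24 2 (Bin Times (xpick 24) (xeq (xoth 24) (Var 22))))"

definition xupdate :: "nat \<Rightarrow> sexp" where
  "xupdate k = Bin Minus (Bin Plus (xrow (Var 22)) (Bin Times (Var 40) xload))
     (Bin Times (Var 40) (Bin Minus (xkap 22) (Bin Quotient (xkap 22) (Num k))))"

text \<open>A register can change inside an expression only as the variable of a fold. Quotient and
  remainder of the table index by \<open>n\<close> are therefore not computed but searched for: at
  most one term of the double sum matches. The first \<open>n\<close> entries match nothing and get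
  the initial value zero.\<close>

definition xlam :: "nat \<Rightarrow> sexp" where
  "xlam k = xsum 21 4 (xsum 22 1 (Bin Times
     (xeq (Var 20) (Bin Plus (Bin Times (Bin Plus (Var 21) (Num 1)) (Var 1)) (Var 22))) (xupdate k)))"

definition xtau :: sexp where
  "xtau = xsum 30 3 (Bin Times (xprod 31 30 (Num 2))
     (Ld (Bin Plus (Var 5) (Bin Plus (Var 1) (Bin Plus (Bin Times (Var 23) (Var 3)) (Var 30))))))"

text \<open>The sum over all rounds serves to load the number of the adopted round into register 21:
  exactly one summand matches.\<close>

definition xchosen :: "nat \<Rightarrow> sexp" where
  "xchosen e = xlt (Num 0) (xsum 23 1 (xsum 21 4 (Bin Times (xeq (Var 21) xtau) (xpick e))))"

definition xkept :: sexp where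
  "xkept = Bin Times (xchosen 24) (xeq (xsum 22 1 (Bin Times (Bin Times (xinc 24 22) (xeq (xsig (Var 22)) (Num 0)))
     (xle (xkap 22) (xsum 32 2 (Bin Times (xlt (Var 32) (Var 24)) (Bin Times (xinc 32 22) (xchosen 32))))))) (Num 0))"

definition xprc :: sexp where
  "xprc = Bin Times (xeq (xsig (Var 23)) (Num 1)) (xsum 21 4 (Bin Times (xeq (Var 21) xtau) xprice))"

definition xout :: sexp where
  "xout = Bin Plus
     (xsum 23 1 (Bin Plus (Bin Times (xeq (Var 20) (Bin Times (Num 2) (Var 23))) xprc)
        (Bin Times (xeq (Var 20) (Bin Plus (Bin Times (Num 2) (Var 23)) (Num 1))) (Var 41))))
     (xsum 24 2 (Bin Times (xeq (Var 20) (Bin Plus (Bin Times (Num 2) (Var 1)) (Var 24))) xkept))"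

lemma wf_access [simp]:
  "wf_sexp (xfield c e) \<longleftrightarrow> e < 60" "wf_sexp (xbeta e) \<longleftrightarrow> e < 60" "wf_sexp (xcode e) \<longleftrightarrow> e < 60"
  "wf_sexp (xkap e) \<longleftrightarrow> e < 60" "wf_sexp (xsig a) \<longleftrightarrow> wf_sexp a" "wf_sexp (xrow a) \<longleftrightarrow> wf_sexp a"
  "wf_sexp (xinc e v) \<longleftrightarrow> e < 60 \<and> v < 60" "wf_sexp (xoth e) \<longleftrightarrow> e < 60"
  by (auto simp: xfield_def xbeta_def xcode_def xkap_def xsig_def xrow_def xinc_def xoth_def)

lemma wf_pick [simp]:
  "wf_sexp (xelig e j) \<longleftrightarrow> e < 60 \<and> j < 60" "wf_sexp (xkey e) \<longleftrightarrow> e < 60"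
  "wf_sexp (xrank e j) \<longleftrightarrow> e < 60 \<and> j < 60" "wf_sexp (xsel e j) \<longleftrightarrow> e < 60 \<and> j < 60"
  "wf_sexp (xgain j) \<longleftrightarrow> j < 60" "wf_sexp (xbest j) \<longleftrightarrow> j < 60" "wf_sexp (xpick e) \<longleftrightarrow> e < 60"
  "wf_sexp xprice" "wf_sexp xload" "wf_sexp (xupdate k)" "wf_sexp (xlam k)" "wf_sexp xtau"
  "wf_sexp (xchosen e) \<longleftrightarrow> e < 60" "wf_sexp xkept" "wf_sexp xprc" "wf_sexp xout"
  by (auto simp: xelig_def xkey_def xrank_def xsel_def xgain_def xbest_def xpick_def xprice_def xload_def
    xupdate_def xlam_def xtau_def xchosen_def xkept_def xprc_def xout_def)

section \<open>Meaning of the expressions in the memory layout of the program\<close>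

locale program =
  fixes n m k J :: nat and U V a d code :: "nat \<Rightarrow> nat"
begin

text \<open>The budget of \<open>e\<close> times the product of all denominators.\<close>

definition \<beta> :: "nat \<Rightarrow> nat" where
  "\<beta> e = a e * (\<Prod>x<m. if x = e then 1 else d x)"

text \<open>Code 0 stands for infinite capacity. Truncation at \<open>m + J\<close> loses nothing,
  since no solution has more than \<open>m\<close> edges; it keeps capacities polynomially small and
  pushes none that is at least \<open>J\<close> below \<open>J\<close>.\<close>

definition \<kappa> :: "nat \<Rightarrow> nat" where
  "\<kappa> w = (if code w = 0 then m + J else min (code w - 1) (m + J))"

text \<open>Chosen to make the regret loss small: if budgets are at most \<open>b\<close>, then
  \<open>total \<le> m * b\<close>, and with \<open>W = m + J\<close> the loss
  \<open>total * n * W^2 / (2 * N)\<close> is at most \<open>b / (2 * k)\<close>.\<close>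

definition N :: nat where
  "N = k * (n + 1) * (m + J + 1) ^ 3"

sublocale response n m N k U V \<beta> \<kappa> \<sigma> for \<sigma> .

text \<open>The facts about registers and memory on which the expressions rely are split by origin:
  the input, the coins for the sides, one row of multipliers. Each evaluation lemma assumes only
  what it reads, so it applies while later tables are still incomplete.\<close>

definition input_env :: "(nat \<Rightarrow> nat) \<Rightarrow> (nat \<Rightarrow> nat) \<Rightarrow> bool" where
  "input_env \<rho> M \<longleftrightarrow> \<rho> 1 = n \<and> \<rho> 2 = m \<and> \<rho> 13 = N \<and> \<rho> 14 = m + J \<and>
     (\<forall>w<n. M (2 + w) = code w) \<and>
     (\<forall>e<m. M (2 + n + 4 * e) = U e \<and> M (3 + n + 4 * e) = V e \<and>
        M (4 + n + 4 * e) = a e \<and> M (5 + n + 4 * e) = d e)"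

definition coin_env :: "(nat \<Rightarrow> nat) \<Rightarrow> (nat \<Rightarrow> nat) \<Rightarrow> (nat \<Rightarrow> nat) \<Rightarrow> bool" where
  "coin_env \<sigma> \<rho> M \<longleftrightarrow> input_env \<rho> M \<and> \<rho> 40 = total \<and> (\<forall>w<n. M (\<rho> 5 + w) = \<sigma> w)"

definition row_env :: "(nat \<Rightarrow> nat) \<Rightarrow> (nat \<Rightarrow> nat) \<Rightarrow> (nat \<Rightarrow> nat) \<Rightarrow> bool" where
  "row_env z \<rho> M \<longleftrightarrow> (\<forall>w<n. M (\<rho> 6 + (\<rho> 21 * n + w)) = z w)"

lemma env_upd [simp]:
  "20 \<le> x \<Longrightarrow> x < 40 \<Longrightarrow> input_env (\<rho>(x := i)) M \<longleftrightarrow> input_env \<rho> M"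
  "20 \<le> x \<Longrightarrow> x < 40 \<Longrightarrow> coin_env \<sigma> (\<rho>(x := i)) M \<longleftrightarrow> coin_env \<sigma> \<rho> M"
  "21 < x \<Longrightarrow> x < 40 \<Longrightarrow> row_env z (\<rho>(x := i)) M \<longleftrightarrow> row_env z \<rho> M"
  by (auto simp: input_env_def coin_env_def row_env_def)

lemma input_envD:
  assumes "input_env \<rho> M"
  shows "\<rho> 1 = n" "\<rho> 2 = m" "\<rho> (Suc 0) = n" "\<rho> 13 = N" "\<rho> 14 = m + J" "w < n \<Longrightarrow> M (2 + w) = code w"
    "e < m \<Longrightarrow> M (2 + n + 4 * e) = U e" "e < m \<Longrightarrow> M (3 + n + 4 * e) = V e"
    "e < m \<Longrightarrow> M (4 + n + 4 * e) = a e" "e < m \<Longrightarrow> M (5 + n + 4 * e) = d e"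
  using assms by (auto simp: input_env_def)

lemma coin_envD:
  assumes "coin_env \<sigma> \<rho> M"
  shows "input_env \<rho> M" "\<rho> 40 = total" "w < n \<Longrightarrow> M (\<rho> 5 + w) = \<sigma> w"
  using assms by (auto simp: coin_env_def)

lemma den_access:
  assumes "input_env \<rho> M"
  shows "\<rho> e < m \<Longrightarrow> den (xU e) \<rho> M = U (\<rho> e)" "\<rho> e < m \<Longrightarrow> den (xV e) \<rho> M = V (\<rho> e)"
    "\<rho> e < m \<Longrightarrow> den (xA e) \<rho> M = a (\<rho> e)" "\<rho> e < m \<Longrightarrow> den (xD e) \<rho> M = d (\<rho> e)"
    "\<rho> w < n \<Longrightarrow> den (xcode w) \<rho> M = code (\<rho> w)"
  using input_envD[OF assms] by (simp_all add: xfield_def xcode_def)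

text \<open>Here and below the excluded registers are loop variables used inside the expression: an
  argument held in one of them would be captured.\<close>

lemma den_xbeta: "input_env \<rho> M \<Longrightarrow> \<rho> e < m \<Longrightarrow> e \<noteq> 29 \<Longrightarrow> den (xbeta e) \<rho> M = \<beta> (\<rho> e)"
  by (simp add: xbeta_def \<beta>_def den_access input_envD den_xif cong: prod.cong_simp if_cong)

lemma den_xkap: "input_env \<rho> M \<Longrightarrow> \<rho> w < n \<Longrightarrow> den (xkap w) \<rho> M = \<kappa> (\<rho> w)"
  by (simp add: xkap_def \<kappa>_def den_access input_envD den_xif min_def)

lemma den_xinc: "input_env \<rho> M \<Longrightarrow> \<rho> e < m \<Longrightarrow> den (xinc e v) \<rho> M = of_bool (inc (\<rho> e) (\<rho> v))"
  by (simp add: xinc_def inc_def den_access)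

lemma den_xoth: "input_env \<rho> M \<Longrightarrow> \<rho> e < m \<Longrightarrow> den (xoth e) \<rho> M = oth (\<rho> e) (\<rho> 23)"
  by (simp add: xoth_def oth_def den_access den_xif)

lemma den_xsig: "coin_env \<sigma> \<rho> M \<Longrightarrow> den x \<rho> M < n \<Longrightarrow> den (xsig x) \<rho> M = \<sigma> (den x \<rho> M)"
  by (simp add: xsig_def coin_envD)

lemma den_xrow: "input_env \<rho> M \<Longrightarrow> row_env z \<rho> M \<Longrightarrow> den x \<rho> M < n \<Longrightarrow> den (xrow x) \<rho> M = z (den x \<rho> M)"
  by (simp add: xrow_def row_env_def input_envD)

end

locale graph_program = program +
  assumes ends_less: "e < m \<Longrightarrow> U e < n" "e < m \<Longrightarrow> V e < n"
    and no_loop: "e < m \<Longrightarrow> U e \<noteq> V e"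
    and simple: "e < m \<Longrightarrow> e' < m \<Longrightarrow> {U e, V e} = {U e', V e'} \<Longrightarrow> e = e'"
begin

sublocale response_graph n m N k U V \<beta> \<kappa> \<sigma> for \<sigma>
  by unfold_locales (use ends_less no_loop simple in auto)

lemma den_xelig:
  assumes "coin_env \<sigma> \<rho> M" "row_env z \<rho> M" "\<rho> e < m" "\<rho> j < m" "\<rho> 23 < n" "e \<noteq> 29" "j \<noteq> 29"
  shows "den (xelig e j) \<rho> M = of_bool (elig \<sigma> z (\<rho> 23) (\<rho> j) (\<rho> e))"
  using assms coin_envD(1)[OF assms(1)]
  by (simp add: xelig_def elig_def arc_def den_xbeta den_xinc den_xoth den_xsig den_xrow oth_less input_envD of_bool_conj)

lemma den_xkey:
  assumes "coin_env \<sigma> \<rho> M" "row_env z \<rho> M" "\<rho> e < m"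
  shows "den (xkey e) \<rho> M = key z (\<rho> 23) (\<rho> e)"
  using assms coin_envD(1)[OF assms(1)]
  by (simp add: xkey_def key_def den_xoth den_xrow oth_less input_envD)

lemma den_xsel:
  assumes "coin_env \<sigma> \<rho> M" "row_env z \<rho> M" "\<rho> e < m" "\<rho> j < m" "\<rho> 23 < n" "e \<notin> {28, 29}" "j \<notin> {28, 29}"
  shows "den (xsel e j) \<rho> M = of_bool (sel \<sigma> z (\<rho> 23) (\<rho> j) (\<rho> e))"
proof -
  note i = coin_envD(1)[OF assms(1)]
  have "den (xrank e j) \<rho> M = rank \<sigma> z (\<rho> 23) (\<rho> j) (\<rho> e)"
    unfolding xrank_def rank_def den_xsum input_envD(2)[OF i]
    by (intro sum.cong refl) (use assms in \<open>simp add: den_xelig[where z = z and \<sigma> = \<sigma>] den_xkey[where z = z and \<sigma> = \<sigma>] of_bool_conj\<close>)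
  then show ?thesis
    using assms i by (simp add: xsel_def sel_def den_xelig den_xkap of_bool_conj)
qed

lemma den_xgain:
  assumes "coin_env \<sigma> \<rho> M" "row_env z \<rho> M" "\<rho> j < m" "\<rho> 23 < n" "j \<notin> {27, 28, 29}"
  shows "den (xgain j) \<rho> M = gain \<sigma> z (\<rho> 23) (\<rho> j)"
  unfolding xgain_def gain_def den_xsum input_envD(2)[OF coin_envD(1)[OF assms(1)]]
  by (intro sum.cong refl) (use assms coin_envD(1)[OF assms(1)] in
    \<open>simp add: den_xsel[where z = z and \<sigma> = \<sigma>] den_xrow[where z = z] den_xoth den_xbeta oth_less input_envD(4)\<close>)

lemma den_xbest:
  assumes "coin_env \<sigma> \<rho> M" "row_env z \<rho> M" "\<rho> j < m" "\<rho> 23 < n" "j \<notin> {26, 27, 28, 29}"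
  shows "den (xbest j) \<rho> M = of_bool (best \<sigma> z (\<rho> 23) (\<rho> j))"
proof -
  note i = coin_envD(1)[OF assms(1)]
  have "den (xbest j) \<rho> M = of_bool ((\<Sum>i<m. of_bool (gain \<sigma> z (\<rho> 23) (\<rho> j) * m + \<rho> j < gain \<sigma> z (\<rho> 23) i * m + i)) = (0 :: nat))"
    unfolding xbest_def den_xeq den_xsum input_envD(2)[OF i] den.simps
    by (intro arg_cong[of _ _ of_bool] arg_cong2[of _ _ _ _ "(=)"] sum.cong refl)
      (use assms i in \<open>simp add: den_xgain[where z = z and \<sigma> = \<sigma>] input_envD(2)\<close>)
  then show ?thesis
    by (auto simp: best_def not_less)
qed

lemma den_xpick:
  assumes "coin_env \<sigma> \<rho> M" "row_env z \<rho> M" "\<rho> e < m" "\<rho> 23 < n" "e \<notin> {25, 26, 27, 28, 29}"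
  shows "den (xpick e) \<rho> M = of_bool (pick \<sigma> z (\<rho> 23) (\<rho> e))"
proof -
  note i = coin_envD(1)[OF assms(1)]
  have "den (xpick e) \<rho> M = of_bool (0 < (\<Sum>j<m. of_bool (best \<sigma> z (\<rho> 23) j \<and> sel \<sigma> z (\<rho> 23) j (\<rho> e)) :: nat))"
    unfolding xpick_def den_xlt den_xsum input_envD(2)[OF i] den.simps
    by (intro arg_cong[of _ _ of_bool] arg_cong2[of _ _ _ _ "(<)"] sum.cong refl)
      (use assms in \<open>simp add: den_xbest[where z = z and \<sigma> = \<sigma>] den_xsel[where z = z and \<sigma> = \<sigma>] of_bool_conj\<close>)
  then show ?thesis
    by (auto simp: pick_def zero_less_iff_neq_zero)
qed

lemma den_xprice:
  assumes "coin_env \<sigma> \<rho> M" "row_env z \<rho> M" "\<rho> 23 < n"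
  shows "den xprice \<rho> M = price \<sigma> z (\<rho> 23)"
  unfolding xprice_def price_def den_xsum input_envD(2)[OF coin_envD(1)[OF assms(1)]]
  by (intro sum.cong refl) (use assms coin_envD(1)[OF assms(1)] in
    \<open>simp add: den_xbest[where z = z and \<sigma> = \<sigma>] den_xbeta\<close>)

lemma den_xload:
  assumes "coin_env \<sigma> \<rho> M" "row_env z \<rho> M"
  shows "den xload \<rho> M = load \<sigma> z (\<rho> 22)"
  unfolding xload_def load_def den_xsum input_envD(1,2)[OF coin_envD(1)[OF assms(1)]]
proof (rule sum.cong[OF refl])
  fix v assume v: "v \<in> {..<n}"
  note i = coin_envD(1)[OF assms(1)]
  show "(\<Sum>i<(\<rho>(23 := v)) 2. den (Bin Times (xpick 24) (xeq (xoth 24) (Var 22))) (\<rho>(23 := v, 24 := i)) M) =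
      (\<Sum>e<m. of_bool (pick \<sigma> z v e \<and> oth e v = \<rho> 22))"
    by (intro sum.cong) (use assms i v in \<open>simp_all add: input_envD(2) den_xpick[where z = z and \<sigma> = \<sigma>] den_xoth of_bool_conj\<close>)
qed

lemma den_xupdate:
  assumes "coin_env \<sigma> \<rho> M" "row_env z \<rho> M" "\<rho> 22 < n"
  shows "den (xupdate k) \<rho> M = update \<sigma> z (\<rho> 22)"
  using assms coin_envD[OF assms(1)]
  by (simp add: xupdate_def update_def target_def den_xload den_xrow den_xkap)

definition round_env :: "(nat \<Rightarrow> nat) \<Rightarrow> (nat \<Rightarrow> nat) \<Rightarrow> (nat \<Rightarrow> nat) \<Rightarrow> (nat \<Rightarrow> nat) \<Rightarrow> bool" where
  "round_env \<sigma> \<tau> \<rho> M \<longleftrightarrow>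
     (\<forall>w<n. (\<Sum>i<\<rho> 3. 2 ^ i * M (\<rho> 5 + (n + (w * \<rho> 3 + i)))) = \<tau> w \<and> \<tau> w < \<rho> 4) \<and>
     (\<forall>t<\<rho> 4. \<forall>w<n. M (\<rho> 6 + (t * n + w)) = lam \<sigma> t w)"

lemma round_env_upd [simp]: "20 \<le> x \<Longrightarrow> round_env \<sigma> \<tau> (\<rho>(x := i)) M \<longleftrightarrow> round_env \<sigma> \<tau> \<rho> M"
  by (simp add: round_env_def)

lemma sum_select: "x < (M :: nat) \<Longrightarrow> (\<Sum>i<M. of_bool (i = x) * f i) = (f x :: nat)"
  by (subst sum.remove[of _ x]) (auto intro!: sum.neutral)

lemma den_xtau:
  assumes "input_env \<rho> M" "round_env \<sigma> \<tau> \<rho> M" "\<rho> 23 < n"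
  shows "den xtau \<rho> M = \<tau> (\<rho> 23)"
  using assms by (simp add: xtau_def round_env_def input_envD)

lemma round_row: "round_env \<sigma> \<tau> \<rho> M \<Longrightarrow> \<rho> 21 < \<rho> 4 \<Longrightarrow> row_env (lam \<sigma> (\<rho> 21)) \<rho> M"
  by (simp add: round_env_def row_env_def)

lemma den_select_round:
  assumes "input_env \<rho> M" "round_env \<sigma> \<tau> \<rho> M" "\<rho> 23 < n"
    and "\<And>t. t < \<rho> 4 \<Longrightarrow> den x (\<rho>(21 := t)) M = f t"
  shows "den (xsum 21 4 (Bin Times (xeq (Var 21) xtau) x)) \<rho> M = f (\<tau> (\<rho> 23))"
proof -
  have "den (xsum 21 4 (Bin Times (xeq (Var 21) xtau) x)) \<rho> M = (\<Sum>t<\<rho> 4. of_bool (t = \<tau> (\<rho> 23)) * f t)"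
    unfolding den_xsum
    by (intro sum.cong refl) (use assms in \<open>simp add: den_xtau[where \<sigma> = \<sigma> and \<tau> = \<tau>]\<close>)
  also have "\<dots> = f (\<tau> (\<rho> 23))"
    by (rule sum_select) (use assms(2,3) in \<open>simp add: round_env_def\<close>)
  finally show ?thesis .
qed

lemma den_xchosen:
  assumes "coin_env \<sigma> \<rho> M" "round_env \<sigma> \<tau> \<rho> M" "\<rho> e < m" "e \<notin> {21, 23, 25, 26, 27, 28, 29}"
  shows "den (xchosen e) \<rho> M = of_bool (chosen \<sigma> \<tau> (\<rho> e))"
proof -
  note i = coin_envD(1)[OF assms(1)]
  have "den (xchosen e) \<rho> M = of_bool (0 < (\<Sum>v<n. of_bool (pick \<sigma> (lam \<sigma> (\<tau> v)) v (\<rho> e)) :: nat))"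
    unfolding xchosen_def den_xlt den_xsum[of 23] input_envD(1)[OF i] den.simps(1)
  proof (intro arg_cong[of _ _ of_bool] arg_cong2[of _ _ _ _ "(<)"] sum.cong refl)
    fix v assume v: "v \<in> {..<n}"
    have "den (xpick e) (\<rho>(23 := v, 21 := t)) M = of_bool (pick \<sigma> (lam \<sigma> t) v (\<rho> e))" if "t < \<rho> 4" for t
      using assms v that round_row[of \<sigma> \<tau> "\<rho>(23 := v, 21 := t)" M]
      by (subst den_xpick[where \<sigma> = \<sigma> and z = "lam \<sigma> t"]) auto
    then show "den (xsum 21 4 (Bin Times (xeq (Var 21) xtau) (xpick e))) (\<rho>(23 := v)) M =
        of_bool (pick \<sigma> (lam \<sigma> (\<tau> v)) v (\<rho> e))"
      using assms i v
      by (subst den_select_round[where f = "\<lambda>t. of_bool (pick \<sigma> (lam \<sigma> t) v (\<rho> e))" and \<sigma> = \<sigma> and \<tau> = \<tau>]) auto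
  qed
  then show ?thesis
    by (auto simp: chosen_def zero_less_iff_neq_zero)
qed

lemma den_xkept:
  assumes "coin_env \<sigma> \<rho> M" "round_env \<sigma> \<tau> \<rho> M" "\<rho> 24 < m"
  shows "den xkept \<rho> M = of_bool (kept \<sigma> \<tau> (\<rho> 24))"
proof -
  note i = coin_envD(1)[OF assms(1)]
  let ?x = "Bin Times (Bin Times (xinc 24 22) (xeq (xsig (Var 22)) (Num 0)))
     (xle (xkap 22) (xsum 32 2 (Bin Times (xlt (Var 32) (Var 24)) (Bin Times (xinc 32 22) (xchosen 32)))))"
  let ?P = "\<lambda>u. inc (\<rho> 24) u \<and> \<sigma> u = 0 \<and>
      \<kappa> u \<le> (\<Sum>e'<m. of_bool (e' < \<rho> 24 \<and> inc e' u \<and> chosen \<sigma> \<tau> e'))"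
  have "den ?x (\<rho>(22 := u)) M = of_bool (?P u)" if u: "u < n" for u
  proof -
    have "den (xsum 32 2 (Bin Times (xlt (Var 32) (Var 24)) (Bin Times (xinc 32 22) (xchosen 32)))) (\<rho>(22 := u)) M =
        (\<Sum>e'<m. of_bool (e' < \<rho> 24 \<and> inc e' u \<and> chosen \<sigma> \<tau> e'))"
      unfolding den_xsum using assms i u
      by (intro sum.cong) (simp_all add: input_envD(2) den_xinc den_xchosen[where \<sigma> = \<sigma> and \<tau> = \<tau>] of_bool_conj)
    then show ?thesis
      using assms i u by (simp add: den_xinc den_xsig[where \<sigma> = \<sigma>] den_xkap of_bool_conj del: den_xsum)
  qed
  then have "den (xsum 22 1 ?x) \<rho> M = (\<Sum>u<n. of_bool (?P u))"
    unfolding den_xsum input_envD(1)[OF i] by (intro sum.cong) auto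
  then have "den (xeq (xsum 22 1 ?x) (Num 0)) \<rho> M = of_bool (\<forall>u<n. \<not> ?P u)"
    unfolding den_xeq by (auto simp del: den_xsum)
  moreover have "den (xchosen 24) \<rho> M = of_bool (chosen \<sigma> \<tau> (\<rho> 24))"
    using assms by (intro den_xchosen) auto
  ultimately have "den xkept \<rho> M = of_bool (chosen \<sigma> \<tau> (\<rho> 24)) * of_bool (\<forall>u<n. \<not> ?P u)"
    unfolding xkept_def by (simp only: den.simps bapp.simps)
  then show ?thesis
    unfolding kept_def of_bool_conj[symmetric] by (auto simp: not_le)
qed

lemma den_xprc:
  assumes "coin_env \<sigma> \<rho> M" "round_env \<sigma> \<tau> \<rho> M" "\<rho> 23 < n"
  shows "den xprc \<rho> M = prc \<sigma> \<tau> (\<rho> 23)"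
proof -
  note i = coin_envD(1)[OF assms(1)]
  have "den xprice (\<rho>(21 := t)) M = price \<sigma> (lam \<sigma> t) (\<rho> 23)" if "t < \<rho> 4" for t
    using assms that round_row[of \<sigma> \<tau> "\<rho>(21 := t)" M]
    by (subst den_xprice[where \<sigma> = \<sigma> and z = "lam \<sigma> t"]) auto
  then have "den (xsum 21 4 (Bin Times (xeq (Var 21) xtau) xprice)) \<rho> M = price \<sigma> (lam \<sigma> (\<tau> (\<rho> 23))) (\<rho> 23)"
    using assms i by (intro den_select_round[where f = "\<lambda>t. price \<sigma> (lam \<sigma> t) (\<rho> 23)"]) auto
  then show ?thesis
    using assms by (simp add: xprc_def prc_def den_xsig[where \<sigma> = \<sigma>] del: den_xsum)
qed

definition outval :: "(nat \<Rightarrow> nat) \<Rightarrow> (nat \<Rightarrow> nat) \<Rightarrow> nat \<Rightarrow> nat" where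
  "outval \<sigma> \<tau> x = (\<Sum>w<n. of_bool (x = 2 * w) * prc \<sigma> \<tau> w + of_bool (x = 2 * w + 1) * (\<Prod>e<m. d e)) +
     (\<Sum>e<m. of_bool (x = 2 * n + e) * of_bool (kept \<sigma> \<tau> e))"

lemma outval:
  "w < n \<Longrightarrow> outval \<sigma> \<tau> (2 * w) = prc \<sigma> \<tau> w"
  "w < n \<Longrightarrow> outval \<sigma> \<tau> (Suc (2 * w)) = (\<Prod>e<m. d e)"
  "e < m \<Longrightarrow> outval \<sigma> \<tau> (2 * n + e) = of_bool (kept \<sigma> \<tau> e)"
proof -
  assume w: "w < n"
  have "(\<Sum>e<m. of_bool (2 * w = 2 * n + e) * of_bool (kept \<sigma> \<tau> e)) = (0::nat)"
    "(\<Sum>e<m. of_bool (Suc (2 * w) = 2 * n + e) * of_bool (kept \<sigma> \<tau> e)) = (0::nat)"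
    using w by (intro sum.neutral; simp)+
  moreover have "2 * w \<noteq> Suc (2 * v)" "Suc (2 * w) \<noteq> 2 * v" for v by presburger+
  ultimately show "outval \<sigma> \<tau> (2 * w) = prc \<sigma> \<tau> w" "outval \<sigma> \<tau> (Suc (2 * w)) = (\<Prod>e<m. d e)"
    using w sum_select[OF w, of "prc \<sigma> \<tau>"] sum_select[OF w, of "\<lambda>_. \<Prod>e<m. d e"]
    by (simp_all add: outval_def eq_commute[of w])
next
  assume e: "e < m"
  have "(\<Sum>w<n. of_bool (2 * n + e = 2 * w) * prc \<sigma> \<tau> w + of_bool (2 * n + e = 2 * w + 1) * (\<Prod>e<m. d e)) = 0"
    by (intro sum.neutral) auto
  then show "outval \<sigma> \<tau> (2 * n + e) = of_bool (kept \<sigma> \<tau> e)"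
    using sum_select[OF e, of "\<lambda>e. of_bool (kept \<sigma> \<tau> e)"] by (simp add: outval_def eq_commute[of e])
qed

lemma den_xout:
  assumes "coin_env \<sigma> \<rho> M" "round_env \<sigma> \<tau> \<rho> M" "\<rho> 41 = (\<Prod>e<m. d e)"
  shows "den xout \<rho> M = outval \<sigma> \<tau> (\<rho> 20)"
proof -
  note i = coin_envD(1)[OF assms(1)]
  show ?thesis
    unfolding xout_def outval_def den.simps(4) bapp.simps den_xsum input_envD(1,2)[OF i]
    by (intro arg_cong2[of _ _ _ _ "(+)"] sum.cong refl)
      (use assms i in \<open>simp_all add: den_xprc[where \<sigma> = \<sigma> and \<tau> = \<tau>] den_xkept[where \<sigma> = \<sigma> and \<tau> = \<tau>] input_envD(3)\<close>)
qed

text \<open>Only entries before \<open>\<rho> 20\<close> are assumed, as the table is still being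
  filled; an entry of row \<open>t + 1\<close> needs row \<open>t\<close>, which lies entirely
  before it. Summands for other pairs may read unfilled cells, but they are multiplied by
  zero.\<close>

lemma den_xlam:
  assumes "coin_env \<sigma> \<rho> M" and x: "\<rho> 20 < \<rho> 4 * n"
    and filled: "\<And>y. y < \<rho> 20 \<Longrightarrow> M (\<rho> 6 + y) = lam \<sigma> (y div n) (y mod n)"
  shows "den (xlam k) \<rho> M = lam \<sigma> (\<rho> 20 div n) (\<rho> 20 mod n)"
proof -
  note i = coin_envD(1)[OF assms(1)]
  have n: "0 < n" using x by (cases n) auto
  let ?y = "\<rho> 20"
  have "den (xlam k) \<rho> M = (\<Sum>t<\<rho> 4. \<Sum>u<n. of_bool (?y = Suc t * n + u) * lam \<sigma> (Suc t) u)"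
    unfolding xlam_def den_xsum
  proof (rule sum.cong[OF refl], rule sum.cong)
    fix t u assume t: "t \<in> {..<\<rho> 4}" and u: "u \<in> {..<n}"
    let ?\<rho> = "\<rho>(21 := t, 22 := u)"
    have "den (xupdate k) ?\<rho> M = lam \<sigma> (Suc t) u" if "?y = Suc t * n + u"
    proof -
      have "M (\<rho> 6 + (t * n + w)) = lam \<sigma> t w" if "w < n" for w
        using filled[of "t * n + w"] that \<open>?y = Suc t * n + u\<close> by simp
      then have "row_env (lam \<sigma> t) ?\<rho> M" by (simp add: row_env_def)
      then show ?thesis
        using assms(1) u by (subst den_xupdate[where \<sigma> = \<sigma> and z = "lam \<sigma> t"]) auto
    qed
    then show "den (Bin Times (xeq (Var 20) (Bin Plus (Bin Times (Bin Plus (Var 21) (Num 1)) (Var 1)) (Var 22))) (xupdate k)) ?\<rho> M =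
        of_bool (?y = Suc t * n + u) * lam \<sigma> (Suc t) u"
      using i by (cases "?y = Suc t * n + u") (simp_all add: input_envD(3))
  qed (use i in \<open>simp add: input_envD(3)\<close>)
  also have "\<dots> = lam \<sigma> (?y div n) (?y mod n)"
  proof (cases "?y div n")
    case 0
    then have "?y < n" using n by (simp add: div_eq_0_iff)
    then have "(\<Sum>t<\<rho> 4. \<Sum>u<n. of_bool (?y = Suc t * n + u) * lam \<sigma> (Suc t) u) = 0"
      by (intro sum.neutral ballI) auto
    then show ?thesis using 0 by simp
  next
    case (Suc t0)
    have "?y div n < \<rho> 4" using x by (simp add: less_mult_imp_div_less)
    then have t0: "t0 < \<rho> 4" using Suc by simp
    have eq: "?y = Suc t * n + u \<longleftrightarrow> t = t0 \<and> u = ?y mod n" if "u < n" for t u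
    proof
      assume "?y = Suc t * n + u"
      then have "?y div n = Suc t" "?y mod n = u"
        using that by (simp_all only: div_mult_self3 mod_mult_self3) (simp_all add: n)
      then show "t = t0 \<and> u = ?y mod n" using Suc by simp
    next
      assume "t = t0 \<and> u = ?y mod n"
      then show "?y = Suc t * n + u" using Suc div_mult_mod_eq[of ?y n] by simp
    qed
    have "(\<Sum>t<\<rho> 4. \<Sum>u<n. of_bool (?y = Suc t * n + u) * lam \<sigma> (Suc t) u) =
        (\<Sum>t<\<rho> 4. of_bool (t = t0) * (\<Sum>u<n. of_bool (u = ?y mod n) * lam \<sigma> (Suc t) u))"
      unfolding sum_distrib_left
      by (intro sum.cong refl) (simp only: eq lessThan_iff of_bool_conj mult.assoc)
    also have "\<dots> = lam \<sigma> (Suc t0) (?y mod n)"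
      using n by (simp only: sum_select[OF t0] sum_select[OF mod_less_divisor[OF n]])
    finally show ?thesis using Suc by simp
  qed
  finally show ?thesis .
qed

end

section \<open>The phases of the program and its memory layout\<close>

fun set_regs :: "(nat \<times> sexp) list \<Rightarrow> com" where
  "set_regs [] = Skip"
| "set_regs ((x, e) # L) = Seq (set_reg x e) (set_regs L)"

fun final_regs :: "(nat \<times> sexp) list \<Rightarrow> (nat \<Rightarrow> nat) \<Rightarrow> (nat \<Rightarrow> nat) \<Rightarrow> nat \<Rightarrow> nat" where
  "final_regs [] \<rho> M = \<rho>"
| "final_regs ((x, e) # L) \<rho> M = final_regs L (\<rho>(x := den e \<rho> M)) M"

fun regs_ok :: "nat \<Rightarrow> (nat \<times> sexp) list \<Rightarrow> (nat \<Rightarrow> nat) \<Rightarrow> (nat \<Rightarrow> nat) \<Rightarrow> bool" where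
  "regs_ok A [] \<rho> M = True"
| "regs_ok A ((x, e) # L) \<rho> M \<longleftrightarrow>
     (den e \<rho> M \<le> A \<or> 40 \<le> x \<and> den e \<rho> M < 2 ^ A) \<and> regs_ok A L (\<rho>(x := den e \<rho> M)) M"

lemma set_regs_realizes:
  assumes "\<forall>(x, e) \<in> set L. wf_sexp e \<and> x < 60"
  shows "\<exists>f. pbd f \<and> (\<forall>A \<rho> M r. small A \<rho> M \<longrightarrow> regs_ok A L \<rho> M \<longrightarrow>
    small A (final_regs L \<rho> M) M \<and> realizes (set_regs L) \<rho> M r (final_regs L \<rho> M) M r (f A))"
  using assms
proof (induction L rule: set_regs.induct)
  case 1
  have "realizes Skip \<rho> M r \<rho> M r 1" for \<rho> M r
    using exec.Skip unfolding realizes_def runs_def by blast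
  then show ?case by (intro exI[of _ "\<lambda>_. 1"]) simp
next
  case (2 x e L)
  obtain f where f: "pbd f" "\<And>A \<rho> M r. small A \<rho> M \<Longrightarrow> regs_ok A L \<rho> M \<Longrightarrow>
    small A (final_regs L \<rho> M) M \<and> realizes (set_regs L) \<rho> M r (final_regs L \<rho> M) M r (f A)"
    using 2 by auto
  obtain g where g: "pbd g" "\<And>A \<rho> M r. small A \<rho> M \<Longrightarrow>
    realizes (set_reg x e) \<rho> M r (\<rho>(x := den e \<rho> M)) M r (g A)"
    using set_reg_realizes[of e x] 2(2) by auto
  have "small A (final_regs ((x, e) # L) \<rho> M) M \<and>
      realizes (set_regs ((x, e) # L)) \<rho> M r (final_regs ((x, e) # L) \<rho> M) M r (g A + f A)"
    if sm: "small A \<rho> M" and ok: "regs_ok A ((x, e) # L) \<rho> M" for A \<rho> M r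
  proof -
    have "small A (\<rho>(x := den e \<rho> M)) M"
      using small_upd[OF sm, of "den e \<rho> M" x] sm ok by (force simp: small_def)
    then show ?thesis
      using f(2)[of A "\<rho>(x := den e \<rho> M)" M r] ok realizes_Seq[OF g(2)[OF sm]] by simp
  qed
  moreover have "pbd (\<lambda>A. g A + f A)"
    by (intro pbd_add f(1) g(1))
  ultimately show ?case by blast
qed

definition params :: "nat \<Rightarrow> nat \<Rightarrow> (nat \<times> sexp) list" where
  "params k J =
    [(1, Ld (Num 0)), (2, Ld (Num 1)),
     (14, Bin Plus (Var 2) (Num J)),
     (13, Bin Times (Bin Times (Num k) (Bin Plus (Var 1) (Num 1)))
        (Bin Times (Bin Times (Bin Plus (Var 14) (Num 1)) (Bin Plus (Var 14) (Num 1))) (Bin Plus (Var 14) (Num 1)))),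
     (8, Bin Plus (Var 13) (Var 2)),
     (3, xsum 20 8 (xlt (xprod 21 20 (Num 2)) (Var 8))),
     (4, xprod 20 3 (Num 2)),
     (5, Bin Plus (Bin Plus (Num 5) (Bin Times (Num 2) (Var 1))) (Bin Times (Num 4) (Var 2))),
     (9, Bin Plus (Var 1) (Bin Times (Var 1) (Var 3))),
     (6, Bin Plus (Var 5) (Var 9)),
     (10, Bin Times (Var 4) (Var 1)),
     (7, Bin Plus (Var 6) (Var 10)),
     (11, Bin Plus (Bin Times (Num 2) (Var 1)) (Var 2)),
     (40, xsum 24 2 (xbeta 24)), (41, xprod 24 2 (xD 24))]"

text \<open>The input must stay readable until the last output entry is computed, so the output is
  built behind all other tables and finally copied to address 0, the content of the untouched
  register 12.\<close>

definition pricing_program :: "nat \<Rightarrow> nat \<Rightarrow> com" where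
  "pricing_program k J = Seq (set_regs (params k J)) (Seq (flip_fill 5 20 9) (Seq (fill 6 20 10 (xlam k))
     (Seq (fill 7 20 11 xout) (Seq (fill 12 20 11 (Ld (Bin Plus (Var 7) (Var 20)))) (set_reg 0 (Var 11))))))"

lemma wf_params: "\<forall>(x, e) \<in> set (params k J). wf_sexp e \<and> x < 60"
  by (simp add: params_def)

lemma binary_less: "(\<Sum>i<K. 2 ^ i * of_bool (P i)) < (2 ^ K :: nat)"
  by (induction K) auto

context program
begin

text \<open>The binary logarithm of \<open>N + m\<close>, rounded up, in the form in which the
  program counts it.\<close>

definition coin_bits :: nat where
  "coin_bits = (\<Sum>i<N + m. of_bool (2 ^ i < N + m))"

definition rounds :: nat where
  "rounds = 2 ^ coin_bits"

definition coins :: nat where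
  "coins = n + n * coin_bits"

definition base1 :: nat where
  "base1 = 5 + 2 * n + 4 * m"

definition base2 :: nat where
  "base2 = base1 + coins"

definition base3 :: nat where
  "base3 = base2 + rounds * n"

definition side :: "bool list \<Rightarrow> nat \<Rightarrow> nat" where
  "side r = (\<lambda>w\<in>{..<n}. of_bool (r ! w))"

definition round_of :: "bool list \<Rightarrow> nat \<Rightarrow> nat" where
  "round_of r = (\<lambda>w\<in>{..<n}. \<Sum>i<coin_bits. 2 ^ i * of_bool (r ! (n + (w * coin_bits + i))))"

text \<open>The counted exponents are closed downwards, hence are exactly those below
  \<open>coin_bits\<close>. The lower bound on \<open>rounds\<close> serves the averaging argument,
  the upper bound keeps the table of multipliers polynomial.\<close>

lemma coin_bits:
  assumes "0 < N"
  shows "N + m \<le> rounds" "rounds \<le> 2 * (N + m)" "coin_bits \<le> N + m"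
proof -
  let ?Q = "N + m"
  let ?S = "{i \<in> {..<?Q}. 2 ^ i < ?Q}"
  have b: "coin_bits = card ?S"
    unfolding coin_bits_def by (simp add: sum_of_bool_eq Int_def)
  have down: "i \<in> ?S" if "j \<in> ?S" "i \<le> j" for i j
    using that power_increasing[of i j "2::nat"] by (auto elim: le_less_trans[rotated])
  show "coin_bits \<le> ?Q" using card_mono[of "{..<?Q}" ?S] b by auto
  have "coin_bits \<notin> ?S"
  proof
    assume "coin_bits \<in> ?S"
    then have "{..coin_bits} \<subseteq> ?S" using down by blast
    then have "card {..coin_bits} \<le> card ?S" by (intro card_mono) auto
    then show False using b by simp
  qed
  then have "?Q \<le> coin_bits \<or> ?Q \<le> rounds"
    by (auto simp: rounds_def not_less)
  moreover have "coin_bits < rounds"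
    unfolding rounds_def by (rule less_exp)
  ultimately show "?Q \<le> rounds" by linarith
  show "rounds \<le> 2 * ?Q"
  proof (cases coin_bits)
    case 0
    then have "rounds = 1" by (simp add: rounds_def)
    then show ?thesis using assms by presburger
  next
    case (Suc c)
    have "c \<in> ?S"
    proof (rule ccontr)
      assume "c \<notin> ?S"
      have "?S \<subseteq> {..<c}"
      proof
        fix x assume "x \<in> ?S"
        then have "\<not> c \<le> x" using down \<open>c \<notin> ?S\<close> by blast
        then show "x \<in> {..<c}" by simp
      qed
      then have "card ?S \<le> card {..<c}" by (intro card_mono) auto
      then show False using b Suc by simp
    qed
    then show ?thesis using Suc by (simp add: rounds_def)
  qed
qed

definition init_mem :: "(nat \<Rightarrow> nat) \<Rightarrow> bool" where
  "init_mem M \<longleftrightarrow> M 0 = n \<and> M 1 = m \<and> (\<forall>w<n. M (2 + w) = code w) \<and>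
     (\<forall>e<m. M (2 + n + 4 * e) = U e \<and> M (3 + n + 4 * e) = V e \<and>
        M (4 + n + 4 * e) = a e \<and> M (5 + n + 4 * e) = d e)"

text \<open>Requirements on the size parameter: addresses and loop bounds count by value, while
  multipliers, prices and denominators count by bit length. The summand 1 makes the bound on the
  multipliers cover \<open>total\<close> itself.\<close>

definition roomy :: "nat \<Rightarrow> bool" where
  "roomy A \<longleftrightarrow> base3 + 2 * n + m \<le> A \<and> N + m \<le> A \<and> m + J \<le> A \<and> coin_bits \<le> A \<and> rounds \<le> A \<and>
     total * (N + m + 1) < 2 ^ A \<and> (\<Prod>e<m. d e) < 2 ^ A"

definition final :: "nat \<Rightarrow> nat \<Rightarrow> nat" where
  "final l = (\<lambda>_. 0)(0 := l, 1 := n, 2 := m, 14 := m + J, 13 := N, 8 := N + m, 3 := coin_bits, 4 := rounds,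
     5 := base1, 9 := coins, 6 := base2, 10 := rounds * n, 7 := base3, 11 := 2 * n + m,
     40 := total, 41 := \<Prod>e<m. d e)"

lemma params_final:
  assumes "init_mem M" "roomy A"
  shows "final_regs (params k J) ((\<lambda>_. 0)(0 := l)) M = final l" "regs_ok A (params k J) ((\<lambda>_. 0)(0 := l)) M"
proof -
  have NN: "k * (n + 1) * ((m + J + 1) * (m + J + 1) * (m + J + 1)) = N"
    by (simp only: N_def power3_eq_cube)
  let ?r2 = "(\<lambda>_. 0)(0 := l, 1 := n, 2 := m)"
  let ?r8 = "?r2(14 := m + J, 13 := N, 8 := N + m)"
  let ?r4 = "?r8(3 := coin_bits, 4 := rounds)"
  let ?r6 = "?r4(5 := base1, 9 := coins, 6 := base2)"
  let ?\<rho> = "?r6(10 := rounds * n, 7 := base3, 11 := 2 * n + m)"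
  have env: "input_env ?\<rho> M" "input_env (?\<rho>(40 := total)) M"
    using assms(1) by (simp_all add: input_env_def init_mem_def)
  have beta: "den (xsum 24 2 (xbeta 24)) ?\<rho> M = total"
    unfolding den_xsum total_def using env by (intro sum.cong) (simp_all add: den_xbeta)
  have D: "den (xprod 24 2 (xD 24)) (?\<rho>(40 := total)) M = (\<Prod>e<m. d e)"
    unfolding den_xprod using env by (intro prod.cong) (simp_all add: den_access)
  have mu: "M 0 = n" "M (Suc 0) = m" using assms(1) by (simp_all add: init_mem_def)
  have steps: "den (Ld (Num 0)) ((\<lambda>_. 0)(0 := l)) M = n"
    "den (Ld (Num 1)) ((\<lambda>_. 0)(0 := l, 1 := n)) M = m"
    "den (Bin Plus (Var 2) (Num J)) ?r2 M = m + J"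
    "den (Bin Times (Bin Times (Num k) (Bin Plus (Var 1) (Num 1)))
        (Bin Times (Bin Times (Bin Plus (Var 14) (Num 1)) (Bin Plus (Var 14) (Num 1))) (Bin Plus (Var 14) (Num 1))))
        (?r2(14 := m + J)) M = N"
    "den (Bin Plus (Var 13) (Var 2)) (?r2(14 := m + J, 13 := N)) M = N + m"
    "den (xsum 20 8 (xlt (xprod 21 20 (Num 2)) (Var 8))) ?r8 M = coin_bits"
    "den (xprod 20 3 (Num 2)) (?r8(3 := coin_bits)) M = rounds"
    "den (Bin Plus (Bin Plus (Num 5) (Bin Times (Num 2) (Var 1))) (Bin Times (Num 4) (Var 2))) ?r4 M = base1"
    "den (Bin Plus (Var 1) (Bin Times (Var 1) (Var 3))) (?r4(5 := base1)) M = coins"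
    "den (Bin Plus (Var 5) (Var 9)) (?r4(5 := base1, 9 := coins)) M = base2"
    "den (Bin Times (Var 4) (Var 1)) ?r6 M = rounds * n"
    "den (Bin Plus (Var 6) (Var 10)) (?r6(10 := rounds * n)) M = base3"
    "den (Bin Plus (Bin Times (Num 2) (Var 1)) (Var 2)) (?r6(10 := rounds * n, 7 := base3)) M = 2 * n + m"
    using mu NN by (simp_all add: base1_def base2_def base3_def coins_def coin_bits_def rounds_def)
  show "final_regs (params k J) ((\<lambda>_. 0)(0 := l)) M = final l"
    unfolding params_def final_regs.simps steps beta D final_def ..
  have "total < 2 ^ A" using assms(2) by (auto simp: roomy_def elim: le_less_trans[rotated])
  then show "regs_ok A (params k J) ((\<lambda>_. 0)(0 := l)) M"
    unfolding params_def regs_ok.simps steps beta D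
    using assms(2) by (simp add: roomy_def base3_def base2_def base1_def)
qed

end

context graph_program
begin

lemma prc_le_total: "prc \<sigma> \<tau> v \<le> total"
  using price_le_total[of \<sigma> "lam \<sigma> (\<tau> v)" v] by (simp add: prc_def)

lemma outval_less:
  assumes A: "roomy A" and x: "x < 2 * n + m"
  shows "outval \<sigma> \<tau> x < 2 ^ A"
proof -
  have *: "total < 2 ^ A" "(\<Prod>e<m. d e) < 2 ^ A"
    using A by (auto simp: roomy_def elim: le_less_trans[rotated])
  have "A \<noteq> 0" using A by (auto simp: roomy_def base3_def base2_def base1_def)
  then have b: "of_bool P < (2::nat) ^ A" for P
    using power_increasing[of 1 A "2::nat"] by (cases P) auto
  consider w where "w < n" "x = 2 * w" | w where "w < n" "x = Suc (2 * w)" | e where "e < m" "x = 2 * n + e"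
  proof (cases "x < 2 * n")
    case True
    then have "x div 2 < n" by auto
    moreover have "x = 2 * (x div 2) \<or> x = Suc (2 * (x div 2))" by presburger
    ultimately show thesis using that by blast
  next
    case False
    then show thesis using that(3)[of "x - 2 * n"] x by simp
  qed
  then show ?thesis
    by cases (use * b le_less_trans[OF prc_le_total *(1)] in \<open>simp_all only: outval\<close>)
qed

lemma lam_less: "roomy A \<Longrightarrow> lam \<sigma> t u < 2 ^ A"
  using lam_le[of \<sigma> t u] by (auto simp: roomy_def elim!: le_less_trans[rotated])

lemma coin_env_final:
  assumes "init_mem M0" "\<And>x. x < base1 \<Longrightarrow> M x = M0 x"
    "\<And>i. i < coins \<Longrightarrow> M (base1 + i) = of_bool (r ! i)"
  shows "coin_env (side r) (final l) M"
proof -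
  have "M (2 + w) = M0 (2 + w)" if "w < n" for w
    using that by (intro assms(2)) (simp add: base1_def)
  moreover have "M (c + n + 4 * e) = M0 (c + n + 4 * e)" if "c \<le> 5" "e < m" for c e
    using that by (intro assms(2)) (simp add: base1_def)
  from this[of 2] this[of 3] this[of 4] this[of 5]
  have "M (2 + n + 4 * e) = M0 (2 + n + 4 * e) \<and> M (3 + n + 4 * e) = M0 (3 + n + 4 * e) \<and>
     M (4 + n + 4 * e) = M0 (4 + n + 4 * e) \<and> M (5 + n + 4 * e) = M0 (5 + n + 4 * e)" if "e < m" for e
    using that by simp
  ultimately have "input_env (final l) M"
    using assms(1) by (simp add: input_env_def init_mem_def final_def)
  moreover have "M (base1 + w) = of_bool (r ! w)" if "w < n" for w
    using that by (intro assms(3)) (simp add: coins_def)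
  ultimately show ?thesis by (simp add: coin_env_def side_def final_def)
qed

lemma round_env_final:
  assumes "\<And>i. i < coins \<Longrightarrow> M (base1 + i) = of_bool (r ! i)"
    "\<And>y. y < rounds * n \<Longrightarrow> M (base2 + y) = lam \<sigma> (y div n) (y mod n)"
  shows "round_env \<sigma> (round_of r) (final l) M"
proof -
  have "M (base1 + (n + (w * coin_bits + i))) = of_bool (r ! (n + (w * coin_bits + i)))"
    if "w < n" "i < coin_bits" for w i
  proof (rule assms(1))
    have "w * coin_bits + i < Suc w * coin_bits" using that by simp
    also have "\<dots> \<le> n * coin_bits" using that by (intro mult_le_mono1) simp
    finally show "n + (w * coin_bits + i) < coins" by (simp add: coins_def)
  qed
  moreover have "M (base2 + (t * n + w)) = lam \<sigma> t w" if "t < rounds" "w < n" for t w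
  proof -
    have "t * n + w < Suc t * n" using that by simp
    also have "\<dots> \<le> rounds * n" using that by (intro mult_le_mono1) simp
    finally show ?thesis using assms(2) that by simp
  qed
  ultimately show ?thesis
    using binary_less[where K = coin_bits]
    by (simp add: round_env_def final_def round_of_def rounds_def)
qed

end

text \<open>The function \<open>f\<close> is fixed before the instance, so that one time bound
  serves all instances with the same \<open>k\<close> and \<open>J\<close>.\<close>

definition run_bound :: "nat \<Rightarrow> nat \<Rightarrow> (nat \<Rightarrow> nat) \<Rightarrow> bool" where
  "run_bound k J f \<longleftrightarrow> (\<forall>n m U V a d code A M l r. graph_program n m U V \<longrightarrow>
     program.init_mem n m U V a d code M \<longrightarrow> program.roomy n m k J a d A \<longrightarrow> l \<le> A \<longrightarrow> (\<forall>i. M i < 2 ^ A) \<longrightarrow>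
     program.coins n m k J \<le> length r \<longrightarrow>
     (\<exists>\<rho>' M' r'. realizes (pricing_program k J) ((\<lambda>_. 0)(0 := l)) M r \<rho>' M' r' (f A) \<and> \<rho>' 0 = 2 * n + m \<and>
        (\<forall>x<2 * n + m. M' x = graph_program.outval n m k J U V a d code (program.side n r) (program.round_of n m k J r) x)))"

lemma pricing_program_realizes: "\<exists>f. pbd f \<and> run_bound k J f"
proof -
  obtain f1 where f1: "pbd f1" "\<And>A \<rho> M r. small A \<rho> M \<Longrightarrow> regs_ok A (params k J) \<rho> M \<Longrightarrow>
    small A (final_regs (params k J) \<rho> M) M \<and>
    realizes (set_regs (params k J)) \<rho> M r (final_regs (params k J) \<rho> M) M r (f1 A)"
    using set_regs_realizes[OF wf_params] by blast
  obtain f2 where f2: "pbd f2" "\<And>A \<rho> M r. small A \<rho> M \<Longrightarrow> \<rho> 9 \<le> length r \<Longrightarrow>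
    realizes (flip_fill 5 20 9) \<rho> M r (\<rho>(20 := \<rho> 9)) (upd M (\<rho> 5) (\<lambda>i. of_bool (r ! i)) (\<rho> 9)) (drop (\<rho> 9) r) (f2 A)"
    using flip_fill_realizes[of 5 20 9] by auto
  let ?c = "Ld (Bin Plus (Var 7) (Var 20))"
  have fill: "\<exists>f. pbd f \<and> fills (fill b 20 y e) b 20 y e f" if "wf_sexp e" "b < 20" "y < 20" for b y e
    using that by (intro fill_realizes) auto
  obtain f3 where f3: "pbd f3" "fills (fill 6 20 10 (xlam k)) 6 20 10 (xlam k) f3"
    using fill[of "xlam k" 6 10] by auto
  obtain f4 where f4: "pbd f4" "fills (fill 7 20 11 xout) 7 20 11 xout f4"
    using fill[of xout 7 11] by auto
  obtain f5 where f5: "pbd f5" "fills (fill 12 20 11 ?c) 12 20 11 ?c f5"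
    using fill[of ?c 12 11] by auto
  obtain f6 where f6: "pbd f6" "\<And>A \<rho> M r. small A \<rho> M \<Longrightarrow>
    realizes (set_reg 0 (Var 11)) \<rho> M r (\<rho>(0 := den (Var 11) \<rho> M)) M r (f6 A)"
    using set_reg_realizes[of "Var 11" 0] by auto
  let ?F = "\<lambda>A. f1 A + (f2 A + (f3 A + (f4 A + (f5 A + f6 A))))"
  have "run_bound k J ?F"
    unfolding run_bound_def
  proof (intro allI impI)
    fix n m U V a d code A M l and r :: "bool list"
    assume g: "graph_program n m U V" and init: "program.init_mem n m U V a d code M"
      and A: "program.roomy n m k J a d A" and l: "l \<le> A" and M: "\<forall>i. M i < 2 ^ A"
      and r: "program.coins n m k J \<le> length r"
    interpret graph_program n m k J U V a d code by (rule g)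
    let ?\<rho> = "final l"
    let ?L = "\<lambda>y. lam (side r) (y div n) (y mod n)"
    let ?o = "outval (side r) (round_of r)"
    \<comment> \<open>Memory after the coins, the multipliers, the output table and its copy. Each
      of the first three lies behind everything written before, so no data still to be read is
      overwritten.\<close>
    define M1 where "M1 = upd M base1 (\<lambda>i. of_bool (r ! i)) coins"
    define M2 where "M2 = upd M1 base2 ?L (rounds * n)"
    define M3 where "M3 = upd M2 base3 ?o (2 * n + m)"
    define M4 where "M4 = upd M3 0 ?o (2 * n + m)"
    have A': "base1 \<le> A" "coins \<le> A" "rounds * n \<le> A" "2 * n + m \<le> A" "A \<noteq> 0"
      using A by (auto simp: roomy_def base3_def base2_def base1_def)
    have regs: "?\<rho> 5 = base1" "?\<rho> 9 = coins" "?\<rho> 6 = base2" "?\<rho> 10 = rounds * n" "?\<rho> 7 = base3"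
      "?\<rho> 11 = 2 * n + m" "?\<rho> 12 = 0" "?\<rho> 4 = rounds" "?\<rho> 41 = (\<Prod>e<m. d e)"
      by (simp_all add: final_def)
    have sm0: "small A ((\<lambda>_. 0)(0 := l)) M"
      using le_less_trans[OF l less_exp] M l by (auto simp: small_def)
    note par = params_final[OF init A, of l]
    have 1: "realizes (set_regs (params k J)) ((\<lambda>_. 0)(0 := l)) M r ?\<rho> M r (f1 A)" and sm: "small A ?\<rho> M"
      using f1(2)[OF sm0 par(2), of r] unfolding par(1) by blast+
    have 2: "realizes (flip_fill 5 20 9) ?\<rho> M r (?\<rho>(20 := coins)) M1 (drop coins r) (f2 A)"
      using f2(2)[OF sm, of r] r by (simp add: regs M1_def)
    have sm1: "small A (?\<rho>(20 := i)) M1" if "i \<le> A" for i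
      unfolding M1_def
      by (intro small_upd small_upd_mem sm that) (use one_less_power[of "2::nat" A] A'(5) in auto)
    have coin: "coin_env (side r) ?\<rho> M'"
      if "\<And>x. x < base2 \<Longrightarrow> M' x = M1 x" for M'
    proof (rule coin_env_final[OF init])
      show "M' x = M x" if "x < base1" for x
        using that \<open>\<And>x. x < base2 \<Longrightarrow> M' x = M1 x\<close>[of x] by (simp add: base2_def M1_def upd_outside)
      show "M' (base1 + i) = of_bool (r ! i)" if "i < coins" for i
        using that \<open>\<And>x. x < base2 \<Longrightarrow> M' x = M1 x\<close>[of "base1 + i"] by (simp add: base2_def M1_def upd_inside)
    qed
    have 3: "realizes (fill 6 20 10 (xlam k)) (?\<rho>(20 := coins)) M1 (drop coins r) (?\<rho>(20 := rounds * n)) M2 (drop coins r) (f3 A)"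
    proof -
      have "den (xlam k) (?\<rho>(20 := i)) (upd M1 base2 ?L i) = ?L i" if "i < rounds * n" for i
        using that coin[of "upd M1 base2 ?L i"]
        by (subst den_xlam[where \<sigma> = "side r"]) (auto simp: regs upd_outside upd_inside)
      then show ?thesis
        using f3(2)[unfolded fills_def, rule_format, OF sm1[OF A'(2)], of ?L "drop coins r"] lam_less[OF A] by (simp add: regs M2_def)
    qed
    have sm2: "small A (?\<rho>(20 := i)) M2" if "i \<le> A" for i
      unfolding M2_def by (intro small_upd_mem sm1 that lam_less A)
    have 4: "realizes (fill 7 20 11 xout) (?\<rho>(20 := rounds * n)) M2 (drop coins r) (?\<rho>(20 := 2 * n + m)) M3 (drop coins r) (f4 A)"
    proof -
      have "den xout (?\<rho>(20 := i)) (upd M2 base3 ?o i) = ?o i" if "i < 2 * n + m" for i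
      proof -
        let ?M = "upd M2 base3 ?o i"
        have m2: "?M x = M2 x" if "x < base3" for x using that by (simp add: upd_outside)
        have m1: "?M x = M1 x" if "x < base2" for x
          using that m2[of x] by (simp add: M2_def upd_outside base3_def)
        have "round_env (side r) (round_of r) ?\<rho> ?M"
        proof (rule round_env_final)
          show "?M (base1 + i) = of_bool (r ! i)" if "i < coins" for i
            using that by (simp add: m1 base2_def M1_def upd_inside)
          show "?M (base2 + y) = ?L y" if "y < rounds * n" for y
            using that m2[of "base2 + y"] by (simp add: base3_def M2_def upd_inside)
        qed
        then show ?thesis
          using coin[OF m1] by (subst den_xout[where \<sigma> = "side r" and \<tau> = "round_of r"]) (simp_all add: regs)
      qed
      then show ?thesis
        using f4(2)[unfolded fills_def, rule_format, OF sm2[OF A'(3)], of ?o "drop coins r"] outval_less[OF A] by (simp add: regs M3_def)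
    qed
    have sm3: "small A (?\<rho>(20 := i)) M3" if "i \<le> A" for i
      unfolding M3_def by (intro small_upd_mem sm2 that outval_less A)
    have 5: "realizes (fill 12 20 11 ?c) (?\<rho>(20 := 2 * n + m)) M3 (drop coins r) (?\<rho>(20 := 2 * n + m)) M4 (drop coins r) (f5 A)"
    proof -
      have "den ?c (?\<rho>(20 := i)) (upd M3 0 ?o i) = ?o i" if "i < 2 * n + m" for i
      proof -
        \<comment> \<open>The destination of the copy ends before its source begins.\<close>
        have "2 * n + m \<le> base3" by (simp add: base3_def base2_def base1_def)
        then show ?thesis using that by (simp add: regs upd_outside M3_def upd_inside)
      qed
      then show ?thesis
        using f5(2)[unfolded fills_def, rule_format, OF sm3[OF A'(4)], of ?o "drop coins r"] outval_less[OF A] by (simp add: regs M4_def)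
    qed
    have sm4: "small A (?\<rho>(20 := i)) M4" if "i \<le> A" for i
      unfolding M4_def by (intro small_upd_mem sm3 that outval_less A)
    have 6: "realizes (set_reg 0 (Var 11)) (?\<rho>(20 := 2 * n + m)) M4 (drop coins r)
        (?\<rho>(20 := 2 * n + m, 0 := 2 * n + m)) M4 (drop coins r) (f6 A)"
      using f6(2)[OF sm4[OF A'(4)], of "drop coins r"] by (simp add: regs)
    have "M4 x = ?o x" if "x < 2 * n + m" for x
      using that by (simp add: M4_def upd_def)
    then show "\<exists>\<rho>' M' r'. realizes (pricing_program k J) ((\<lambda>_. 0)(0 := l)) M r \<rho>' M' r' (?F A) \<and>
        \<rho>' 0 = 2 * n + m \<and> (\<forall>x<2 * n + m. M' x = ?o x)"
      using realizes_Seq[OF 1 realizes_Seq[OF 2 realizes_Seq[OF 3 realizes_Seq[OF 4 realizes_Seq[OF 5 6]]]]]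
      unfolding pricing_program_def
      by (intro exI[of _ "?\<rho>(20 := 2 * n + m, 0 := 2 * n + m)"] exI[of _ M4] exI[of _ "drop coins r"] conjI) simp_all
  qed
  moreover have "pbd ?F"
    by (intro pbd_add f1(1) f2(1) f3(1) f4(1) f5(1) f6(1))
  ultimately show ?thesis by blast
qed

section \<open>Analysis of the program\<close>

lemma binary_inj:
  "(\<Sum>i<K. 2 ^ i * of_bool (P i)) = (\<Sum>i<K. 2 ^ i * of_bool (Q i) :: nat) \<Longrightarrow> i < K \<Longrightarrow> P i = Q i"
proof (induction K)
  case (Suc K)
  have "P K = Q K"
    using Suc.prems(1) binary_less[where K = K and P = P] binary_less[where K = K and P = Q]
    by (cases "P K"; cases "Q K") simp_all
  then show ?case
    using Suc by (cases "i = K") simp_all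
qed simp

section \<open>Coin sequences as independent sides and rounds\<close>

context program
begin

lemma bij_coins:
  assumes len: "coins \<le> l"
  shows "bij_betw (\<lambda>r. (side r, round_of r, drop coins r)) {r :: bool list. length r = l}
    (PiE {..<n} (\<lambda>_. {..<2}) \<times> PiE {..<n} (\<lambda>_. {..<rounds}) \<times> {r. length r = l - coins})"
    (is "bij_betw ?h ?A ?B")
proof -
  have inj: "inj_on ?h ?A"
  proof (rule inj_onI)
    fix r r' assume r: "r \<in> ?A" "r' \<in> ?A" and eq: "?h r = ?h r'"
    have sd: "side r w = side r' w" and rd: "round_of r w = round_of r' w" for w
      using eq by auto
    have "r ! i = r' ! i" if i: "i < l" for i
    proof -
      consider "i < n" | "n \<le> i" "i < coins" | "coins \<le> i" by linarith
      then show ?thesis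
      proof cases
        case 1
        then show ?thesis using sd[of i] by (cases "r ! i"; cases "r' ! i") (simp_all add: side_def)
      next
        case 2
        then have "i - n < n * coin_bits" by (simp add: coins_def)
        then have w: "(i - n) div coin_bits < n" and c: "0 < coin_bits"
          by (simp_all add: less_mult_imp_div_less) (metis gr0I mult_0_right not_less0)
        have "r ! (n + ((i - n) div coin_bits * coin_bits + (i - n) mod coin_bits)) =
            r' ! (n + ((i - n) div coin_bits * coin_bits + (i - n) mod coin_bits))"
          using rd[of "(i - n) div coin_bits"] w c
          by (intro binary_inj[of "\<lambda>j. r ! (n + ((i - n) div coin_bits * coin_bits + j))" coin_bits
              "\<lambda>j. r' ! (n + ((i - n) div coin_bits * coin_bits + j))"]) (simp_all add: round_of_def)
        then show ?thesis using 2 by simp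
      next
        case 3
        have "drop coins r ! (i - coins) = drop coins r' ! (i - coins)" using eq by simp
        then show ?thesis using 3 r len by simp
      qed
    qed
    then show "r = r'" using r by (intro nth_equalityI) simp_all
  qed
  have sub: "?h ` ?A \<subseteq> ?B"
  proof -
    have "side r \<in> PiE {..<n} (\<lambda>_. {..<2})" for r
      by (simp add: side_def)
    moreover have "round_of r \<in> PiE {..<n} (\<lambda>_. {..<rounds})" for r
      by (simp add: round_of_def rounds_def binary_less)
    ultimately show ?thesis by auto
  qed
  have card_lists: "card {r :: bool list. length r = j} = 2 ^ j" for j
    using card_lists_length_eq[of "UNIV :: bool set" j] by simp
  have fin: "finite {r :: bool list. length r = j}" for j
    using finite_lists_length_eq[of "UNIV :: bool set" j] by simp
  have "card ?B = 2 ^ n * (rounds ^ n * 2 ^ (l - coins))"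
    by (simp add: card_cartesian_product card_PiE card_lists)
  also have "\<dots> = 2 ^ (n + coin_bits * n + (l - coins))"
    by (simp add: rounds_def power_mult power_add)
  also have "\<dots> = card ?A"
    using len by (simp add: card_lists coins_def mult.commute)
  finally have "card (?h ` ?A) = card ?B"
    using card_image[OF inj] by simp
  moreover have "finite ?B"
    by (intro finite_cartesian_product finite_PiE fin) auto
  ultimately have "?h ` ?A = ?B"
    using sub by (intro card_subset_eq) auto
  then show ?thesis using inj by (simp add: bij_betw_def)
qed

lemma expectation_coins:
  fixes g :: "(nat \<Rightarrow> nat) \<Rightarrow> (nat \<Rightarrow> nat) \<Rightarrow> real"
  assumes len: "coins \<le> l"
  shows "measure_pmf.expectation (pmf_of_set {r :: bool list. length r = l}) (\<lambda>r. g (side r) (round_of r)) =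
    (\<Sum>\<sigma>\<in>PiE {..<n} (\<lambda>_. {..<2}). \<Sum>\<tau>\<in>PiE {..<n} (\<lambda>_. {..<rounds}). g \<sigma> \<tau>) / (2 ^ n * real rounds ^ n)"
proof -
  let ?A = "{r :: bool list. length r = l}"
  let ?P = "PiE {..<n} (\<lambda>_. {..<2::nat})" and ?Q = "PiE {..<n} (\<lambda>_. {..<rounds})"
  let ?R = "{r :: bool list. length r = l - coins}"
  have card_lists: "card {r :: bool list. length r = j} = 2 ^ j" for j
    using card_lists_length_eq[of "UNIV :: bool set" j] by simp
  have fin: "finite ?A" using finite_lists_length_eq[of "UNIV :: bool set" l] by simp
  have "replicate l True \<in> ?A" by simp
  then have ne: "?A \<noteq> {}" by blast
  have "(\<Sum>r\<in>?A. g (side r) (round_of r)) = (\<Sum>(\<sigma>, \<tau>, r)\<in>?P \<times> ?Q \<times> ?R. g \<sigma> \<tau>)"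
    by (subst sum.reindex_bij_betw[OF bij_coins[OF len], symmetric]) simp
  also have "\<dots> = (\<Sum>\<sigma>\<in>?P. \<Sum>\<tau>\<in>?Q. \<Sum>r\<in>?R. g \<sigma> \<tau>)"
    by (simp only: sum.cartesian_product)
  also have "\<dots> = (\<Sum>\<sigma>\<in>?P. \<Sum>\<tau>\<in>?Q. g \<sigma> \<tau>) * 2 ^ (l - coins)"
    by (simp add: card_lists sum_distrib_left mult.commute)
  finally have sum: "(\<Sum>r\<in>?A. g (side r) (round_of r)) = (\<Sum>\<sigma>\<in>?P. \<Sum>\<tau>\<in>?Q. g \<sigma> \<tau>) * 2 ^ (l - coins)" .
  have "l = n + coin_bits * n + (l - coins)" using len by (simp add: coins_def)
  then have "(2::real) ^ l = 2 ^ n * real rounds ^ n * 2 ^ (l - coins)"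
    by (metis power_add power_mult rounds_def of_nat_numeral of_nat_power)
  then show ?thesis
    using fin ne by (simp add: integral_pmf_of_set sum card_lists)
qed

lemma \<beta>_div: 
  assumes "e < m" "\<And>e. e < m \<Longrightarrow> 0 < d e"
  shows "real (\<beta> e) / real (\<Prod>e<m. d e) = real (a e) / real (d e)"
proof -
  have "(\<Prod>x<m. if x = e then 1 else d x) = (\<Prod>x\<in>{..<m} - {e}. d x)"
    using assms(1) by (subst prod.remove[of _ e]) (auto intro!: prod.cong)
  moreover have "(\<Prod>e<m. d e) = d e * (\<Prod>x\<in>{..<m} - {e}. d x)"
    using assms(1) by (subst prod.remove[of _ e]) auto
  moreover have "0 < (\<Prod>x\<in>{..<m} - {e}. d x)" using assms(2) by (intro prod_pos) auto
  ultimately show ?thesis by (simp add: \<beta>_def)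
qed

lemma \<kappa>_ge: "(code w \<noteq> 0 \<longrightarrow> J < code w) \<Longrightarrow> J \<le> \<kappa> w"
  by (auto simp: \<kappa>_def)

lemma \<kappa>_le: "\<kappa> w \<le> m + J"
  by (auto simp: \<kappa>_def)

end

text \<open>With \<open>\<delta> = 1 / (2 * k)\<close>, lowering the capacity by
  \<open>\<kappa> / k\<close> gains \<open>\<kappa> / (2 * k^2)\<close> in the exponent, while
  \<open>ln (1 + \<delta>) \<ge> \<delta> - \<delta>^2\<close> costs
  \<open>\<kappa> / (4 * k^2)\<close>. The remaining \<open>\<kappa> / (4 * k^2)\<close> is at least
  \<open>k + 1\<close>, which is the origin of the hypothesis on \<open>\<kappa>\<close>: one unit
  pays for the integer division and the average excess, the other \<open>k\<close> for
  \<open>exp (- k) \<le> 1 / k\<close>.\<close>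

lemma exp_moment_small:
  assumes k: "0 < k" and J: "4 * k\<^sup>2 * (k + 1) \<le> \<kappa>"
  shows "exp (1 / (2 * real k) * (real (\<kappa> - \<kappa> div k) + 1)) \<le> 1 / real k * (1 + 1 / (2 * real k)) ^ \<kappa>"
proof -
  define \<delta> where "\<delta> = 1 / (2 * real k)"
  have \<delta>: "0 < \<delta>" "\<delta> \<le> 1" using k by (auto simp: \<delta>_def)
  have "real \<kappa> / real k - 1 \<le> real (\<kappa> div k)"
  proof -
    have "\<kappa> < k + \<kappa> div k * k" by (rule dividend_less_div_times[OF k])
    then have "real \<kappa> < real k + real (\<kappa> div k) * real k"
      by (simp flip: of_nat_add of_nat_mult)
    then show ?thesis using k by (simp add: field_simps)
  qed
  moreover have "real (\<kappa> - \<kappa> div k) = real \<kappa> - real (\<kappa> div k)"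
    by (simp add: of_nat_diff)
  ultimately have "\<delta> * (real (\<kappa> - \<kappa> div k) + 1) \<le> \<delta> * (real \<kappa> - real \<kappa> / real k + 2)"
    using \<delta> by (intro mult_left_mono) auto
  also have "\<dots> = real \<kappa> * (\<delta> - \<delta>\<^sup>2) + (1 / real k - real \<kappa> / (4 * (real k)\<^sup>2))"
    using k by (simp add: \<delta>_def field_simps power2_eq_square)
  also have "\<dots> \<le> real \<kappa> * ln (1 + \<delta>) - real k"
  proof -
    have "real \<kappa> * (\<delta> - \<delta>\<^sup>2) \<le> real \<kappa> * ln (1 + \<delta>)"
      using \<delta> ln_one_plus_pos_lower_bound[of \<delta>] by (intro mult_left_mono) auto
    moreover have "1 / real k \<le> 1" using k by simp
    moreover have "real k + 1 \<le> real \<kappa> / (4 * (real k)\<^sup>2)"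
    proof -
      have "real (4 * k\<^sup>2 * (k + 1)) \<le> real \<kappa>" using J by (rule of_nat_mono)
      then show ?thesis using k by (simp add: le_divide_eq mult.commute algebra_simps)
    qed
    ultimately show ?thesis by linarith
  qed
  finally have "exp (\<delta> * (real (\<kappa> - \<kappa> div k) + 1)) \<le> exp (real \<kappa> * ln (1 + \<delta>) - real k)"
    by simp
  also have "\<dots> = (1 + \<delta>) ^ \<kappa> * exp (- real k)"
    using \<delta> by (simp add: exp_diff exp_minus exp_of_nat_mult divide_inverse)
  also have "\<dots> \<le> (1 + \<delta>) ^ \<kappa> * (1 / real k)"
  proof (rule mult_left_mono)
    have "real k \<le> exp (real k)" using exp_ge_add_one_self[of "real k"] by linarith
    then show "exp (- real k) \<le> 1 / real k"
      using k by (simp add: exp_minus field_simps)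
  qed (use \<delta> in auto)
  finally show ?thesis by (simp add: \<delta>_def mult.commute)
qed

context graph_program
begin

abbreviation revenue_sum :: real where
  "revenue_sum \<equiv> \<Sum>\<sigma>\<in>PiE {..<n} (\<lambda>_. {..<2}). \<Sum>\<tau>\<in>PiE {..<n} (\<lambda>_. {..<rounds}). sol_revenue \<sigma> \<tau>"

text \<open>Averages over the sides, for any bound \<open>b\<close> on the scaled budgets. The outer
  factor \<open>1 - 1 / k\<close> comes from dropped edges, the inner one from the reduced
  capacities.\<close>

lemma sum_sol_revenue_sides_ge:
  assumes sol: "solution F p" and k: "0 < k"
    and J: "\<And>w. w < n \<Longrightarrow> 4 * k\<^sup>2 * (k + 1) \<le> \<kappa> w" and top: "\<And>e. e < m \<Longrightarrow> real (\<beta> e) \<le> b" "0 \<le> b"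
  shows "2 ^ n * real rounds ^ n * ((1 - 1 / real k) *
      ((1 - 1 / real k) / 4 * (\<Sum>e\<in>F. p (U e) + p (V e)) - b / (2 * real k))) \<le>
    revenue_sum"
proof -
  let ?P = "PiE {..<n} (\<lambda>_. {..<2::nat})"
  let ?W = "m + J"
  let ?err = "real total * real n * (real ?W)\<^sup>2 / (2 * real N)"
  have N: "0 < N" using k by (simp add: N_def)
  have "real total \<le> real m * b"
    unfolding total_def of_nat_sum using sum_bounded_above[of "{..<m}" "\<lambda>e. real (\<beta> e)" b] top by simp
  then have "real total * real n * (real ?W)\<^sup>2 \<le> (real m * b) * real n * (real ?W)\<^sup>2"
    by (intro mult_right_mono) auto
  also have "\<dots> = b * (real m * real n * (real ?W)\<^sup>2)" by simp
  also have "\<dots> \<le> b * (real (?W + 1) * real (n + 1) * (real (?W + 1))\<^sup>2)"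
    using top(2) by (intro mult_left_mono mult_mono power_mono) auto
  also have "\<dots> = b * real N / real k"
  proof -
    have "real N = real k * (real (?W + 1) * real (n + 1) * (real (?W + 1))\<^sup>2)"
      unfolding N_def of_nat_mult of_nat_power by (simp only: power2_eq_square power3_eq_cube mult_ac)
    then show ?thesis using k by simp
  qed
  finally have err: "?err \<le> b / (2 * real k)"
    using N k by (simp add: field_simps)
  have side: "(1 - 1 / real k) * real rounds ^ n * ((1 - 1 / real k) * crossing_value \<sigma> F p - b / (2 * real k)) \<le>
      (\<Sum>\<tau>\<in>PiE {..<n} (\<lambda>_. {..<rounds}). sol_revenue \<sigma> \<tau>)" for \<sigma>
  proof -
    have "(1 - 1 / real k) * real rounds ^ n * ((1 - 1 / real k) * crossing_value \<sigma> F p - b / (2 * real k)) \<le>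
        (1 - 1 / real k) * real rounds ^ n * ((1 - 1 / real k) * crossing_value \<sigma> F p - ?err)"
      using err k by (intro mult_left_mono) auto
    also have "\<dots> \<le> (\<Sum>\<tau>\<in>PiE {..<n} (\<lambda>_. {..<rounds}). sol_revenue \<sigma> \<tau>)"
    proof (rule sum_sol_revenue_ge[OF sol k _ _ N, where \<delta> = "1 / (2 * real k)"])
      show "exp (1 / (2 * real k) * (real (target u) + 1)) \<le> 1 / real k * (1 + 1 / (2 * real k)) ^ \<kappa> u" if "u < n" for u
        unfolding target_def by (rule exp_moment_small[OF k J[OF that]])
    qed (use k coin_bits(1)[OF N] \<kappa>_le in auto)
    finally show ?thesis .
  qed
  have "card ?P = 2 ^ n" by (simp add: card_PiE)
  then have "(\<Sum>\<sigma>\<in>?P. (1 - 1 / real k) * real rounds ^ n * ((1 - 1 / real k) * crossing_value \<sigma> F p - b / (2 * real k))) =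
      (1 - 1 / real k) * real rounds ^ n * ((1 - 1 / real k) * (\<Sum>\<sigma>\<in>?P. crossing_value \<sigma> F p) - 2 ^ n * (b / (2 * real k)))"
    by (simp add: sum_distrib_left[symmetric] sum_subtractf)
  also have "(\<Sum>\<sigma>\<in>?P. crossing_value \<sigma> F p) = 2 ^ n / 4 * (\<Sum>e\<in>F. p (U e) + p (V e))"
    using sol ends_less no_loop by (intro sum_crossing_value[of m]) (auto simp: solution_def)
  also have "(1 - 1 / real k) * real rounds ^ n * ((1 - 1 / real k) * (2 ^ n / 4 * (\<Sum>e\<in>F. p (U e) + p (V e))) - 2 ^ n * (b / (2 * real k))) =
      2 ^ n * real rounds ^ n * ((1 - 1 / real k) *
      ((1 - 1 / real k) / 4 * (\<Sum>e\<in>F. p (U e) + p (V e)) - b / (2 * real k)))"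
    by (simp add: right_diff_distrib mult_ac)
  finally have "2 ^ n * real rounds ^ n * ((1 - 1 / real k) *
      ((1 - 1 / real k) / 4 * (\<Sum>e\<in>F. p (U e) + p (V e)) - b / (2 * real k))) =
      (\<Sum>\<sigma>\<in>?P. (1 - 1 / real k) * real rounds ^ n * ((1 - 1 / real k) * crossing_value \<sigma> F p - b / (2 * real k)))" ..
  also have "\<dots> \<le> (\<Sum>\<sigma>\<in>?P. \<Sum>\<tau>\<in>PiE {..<n} (\<lambda>_. {..<rounds}). sol_revenue \<sigma> \<tau>)"
    by (intro sum_mono side)
  finally show ?thesis .
qed

end

section \<open>Decoding the input and bounding all sizes by its length\<close>

lemma nth_concat_map:
  assumes "\<And>x. length (f x) = c" "e < m" "j < c"
  shows "concat (map f [0..<m]) ! (c * e + j) = f e ! j"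
  using assms(2)
proof (induction m)
  case (Suc m)
  have len: "length (concat (map f [0..<m])) = c * m" for m
    by (induction m) (simp_all add: assms(1))
  show ?case
  proof (cases "e < m")
    case True
    have "c * e + j < c * Suc e" using assms(3) by simp
    also have "\<dots> \<le> c * m" using True by (intro mult_le_mono2) simp
    finally show ?thesis using Suc True by (simp add: nth_append len)
  next
    case False
    then have "e = m" using Suc by simp
    then show ?thesis by (simp add: nth_append len)
  qed
qed simp

lemma length_concat_map: "(\<And>x. length (f x) = c) \<Longrightarrow> length (concat (map f [0..<m])) = c * m"
  by (induction m) simp_all

lemma sum_list_concat_map:
  "(\<Sum>x\<leftarrow>concat (map f [0..<m]). g x) = (\<Sum>e<m. \<Sum>x\<leftarrow>f e. g x :: nat)"
  by (induction m) simp_all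

definition slots :: "nat \<Rightarrow> nat \<Rightarrow> nat \<Rightarrow> nat" where
  "slots k J s = k * (s + 1) * (s + J + 1) ^ 3 + s"

text \<open>The size parameter as a polynomial in the input size \<open>s\<close>. With
  \<open>Q = slots k J s\<close> bounding \<open>N + m\<close>, the coins need about
  \<open>s * Q\<close> cells and the multipliers \<open>2 * s * Q\<close>; the term
  \<open>3 * Q\<close> covers the number of rounds and the bit length that the multipliers have
  beyond \<open>2 * s\<close>.\<close>

definition room :: "nat \<Rightarrow> nat \<Rightarrow> nat \<Rightarrow> nat" where
  "room k J s = 10 + 20 * s + J + 3 * s * slots k J s + 3 * slots k J s"

lemma pbd_room: "pbd (room k J)"
  unfolding room_def slots_def by (intro pbd_add pbd_mult pbd_pow pbd_const pbd_id)

lemma bits_pos: "1 \<le> bits x"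
  by (simp add: bits_def)

lemma length_le_input_size: "length xs \<le> input_size xs"
proof (induction xs)
  case (Cons x xs)
  then show ?case using bits_pos[of x] by (simp add: input_size_def)
qed simp

lemma bits_le_input_size: "x \<in> set xs \<Longrightarrow> bits x \<le> input_size xs"
  unfolding input_size_def by (intro member_le_sum_list) auto

locale encoded_instance =
  fixes I :: "(nat, nat) cgp" and xs :: "nat list" and n m k J :: nat and U V a d :: "nat \<Rightarrow> nat"
  assumes verts: "verts I = {..<n}" and edges: "edges I = {..<m}"
    and edge: "e < m \<Longrightarrow> ends I e = {U e, V e} \<and> d e > 0 \<and> budget I e = real (a e) / real (d e)"
    and xs: "xs = [n, m] @ map (\<lambda>w. cap_code (cap I w)) [0..<n] @ concat (map (\<lambda>e. [U e, V e, a e, d e]) [0..<m])"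
    and instance_I: "cgp_instance I" and simple_I: "simple_graph I"
    and k: "0 < k" and J: "4 * k\<^sup>2 * (k + 1) \<le> J" and cap: "w < n \<Longrightarrow> enat J \<le> cap I w"
begin

lemma graph_program_I: "graph_program n m U V"
proof
  fix e assume e: "e < m"
  have "ends I e \<subseteq> {..<n}" "card (ends I e) = 2"
    using instance_I e verts edges by (auto simp: cgp_instance_def)
  then show "U e < n" "V e < n" "U e \<noteq> V e"
    using edge[OF e] by auto
next
  fix e e' assume "e < m" "e' < m" "{U e, V e} = {U e', V e'}"
  then show "e = e'"
    using simple_I edge edges by (auto simp: simple_graph_def inj_on_def)
qed

sublocale graph_program n m k J U V a d "\<lambda>w. cap_code (cap I w)"
  by (rule graph_program_I)

lemma length_xs: "length xs = 2 + n + 4 * m"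
  by (simp add: xs length_concat_map[where c = 4])

lemma init_mem_xs: "init_mem (mem (init_state xs))"
proof -
  have edge_nth: "xs ! (2 + n + (4 * e + j)) = [U e, V e, a e, d e] ! j" if "e < m" "j < 4" for e j
  proof -
    have "xs ! (2 + n + (4 * e + j)) = concat (map (\<lambda>e. [U e, V e, a e, d e]) [0..<m]) ! (4 * e + j)"
      by (simp add: xs nth_append)
    also have "\<dots> = [U e, V e, a e, d e] ! j"
      using that by (intro nth_concat_map) auto
    finally show ?thesis .
  qed
  have "xs ! (2 + w) = cap_code (cap I w)" if "w < n" for w
    using that by (simp add: xs nth_append)
  moreover have "xs ! 0 = n" "xs ! 1 = m" by (simp_all add: xs)
  moreover have "xs ! (2 + n + 4 * e) = U e" "xs ! (3 + n + 4 * e) = V e"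
    "xs ! (4 + n + 4 * e) = a e" "xs ! (5 + n + 4 * e) = d e" if "e < m" for e
    using edge_nth[OF that, of 0] edge_nth[OF that, of 1] edge_nth[OF that, of 2] edge_nth[OF that, of 3]
    by (simp_all add: numeral_eq_Suc)
  ultimately show ?thesis
    unfolding init_mem_def init_state_def length_xs by (simp add: length_xs)
qed

abbreviation "s \<equiv> input_size xs"

lemma sizes: "n \<le> s" "m \<le> s"
  using length_le_input_size[of xs] length_xs by auto

lemma sum_bits: "(\<Sum>e<m. bits (a e) + bits (d e)) \<le> s"
proof -
  have "(\<Sum>e<m. bits (a e) + bits (d e)) \<le> (\<Sum>e<m. \<Sum>x\<leftarrow>[U e, V e, a e, d e]. bits x)"
    by (intro sum_mono) simp
  also have "\<dots> \<le> s"
    by (simp add: input_size_def xs sum_list_concat_map)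
  finally show ?thesis .
qed

lemma prod_le: "(\<Prod>e<m. d e) \<le> 2 ^ (\<Sum>e<m. bits (d e))"
  unfolding power_sum by (intro prod_mono) (auto intro: less_imp_le[OF bits_gt])

text \<open>Clearing denominators is affordable: the bits of \<open>a e\<close> and of all
  denominators are separate parts of the input, so together they number at most
  \<open>s\<close>.\<close>

lemma beta_le: "e < m \<Longrightarrow> \<beta> e \<le> 2 ^ s"
proof -
  assume e: "e < m"
  have "(\<Prod>x<m. if x = e then 1 else d x) \<le> (\<Prod>x<m. d x)"
    using edge by (intro prod_mono) (auto simp: Suc_le_eq)
  then have "\<beta> e \<le> 2 ^ bits (a e) * 2 ^ (\<Sum>e<m. bits (d e))"
    unfolding \<beta>_def using prod_le less_imp_le[OF bits_gt] by (intro mult_le_mono) auto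
  also have "\<dots> = 2 ^ (bits (a e) + (\<Sum>e<m. bits (d e)))"
    by (simp add: power_add)
  also have "\<dots> \<le> 2 ^ s"
  proof (rule power_increasing)
    have "bits (a e) \<le> (\<Sum>e<m. bits (a e))"
      using e by (intro member_le_sum) auto
    then show "bits (a e) + (\<Sum>e<m. bits (d e)) \<le> s"
      using sum_bits by (simp add: sum.distrib)
  qed simp
  finally show ?thesis .
qed

lemma N_pos: "0 < N"
  using k by (simp add: N_def)

lemma slots: "N + m \<le> slots k J s"
  unfolding N_def slots_def using sizes by (intro add_mono mult_le_mono power_mono) auto

lemma roomy_room: "roomy (room k J s)"
proof -
  let ?Q = "slots k J s"
  note c = coin_bits[OF N_pos]
  have Q: "coin_bits \<le> ?Q" "rounds \<le> 2 * ?Q"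
    using order.trans[OF c(3) slots] order.trans[OF c(2) mult_le_mono2[OF slots, of 2]] by auto
  have "n * coin_bits \<le> s * ?Q" "rounds * n \<le> 2 * ?Q * s"
    using Q sizes by (auto intro: mult_le_mono)
  then have "base3 + 2 * n + m \<le> room k J s"
    using sizes by (simp add: base3_def base2_def base1_def coins_def room_def algebra_simps)
  moreover have "(\<Prod>e<m. d e) < 2 ^ room k J s"
  proof -
    have "(\<Sum>e<m. bits (d e)) \<le> s" using sum_bits by (simp add: sum.distrib)
    also have "\<dots> < room k J s" by (simp add: room_def)
    finally show ?thesis
      using le_less_trans[OF prod_le power_strict_increasing[of _ "room k J s" "2::nat"]] by simp
  qed
  moreover have "total * (N + m + 1) < 2 ^ room k J s"
  proof -
    have "total \<le> m * 2 ^ s"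
      unfolding total_def using sum_bounded_above[of "{..<m}" \<beta> "2 ^ s"] beta_le by simp
    also have "\<dots> \<le> 2 ^ s * 2 ^ s"
      by (intro mult_le_mono order.trans[OF sizes(2) less_imp_le[OF less_exp]]) simp
    finally have t: "total \<le> 2 ^ s * 2 ^ s" .
    have "N + m + 1 \<le> ?Q + 1" using slots by simp
    also have "\<dots> \<le> 2 ^ ?Q" by (simp add: Suc_le_eq)
    finally have "total * (N + m + 1) \<le> 2 ^ s * 2 ^ s * 2 ^ ?Q" using t by (intro mult_le_mono)
    also have "\<dots> = 2 ^ (s + s + ?Q)" by (simp add: power_add)
    also have "\<dots> < 2 ^ room k J s" by (rule power_strict_increasing) (simp_all add: room_def)
    finally show ?thesis .
  qed
  ultimately show ?thesis
    using slots Q sizes by (auto simp: roomy_def room_def)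
qed

lemma coins_le_room: "coins \<le> room k J s"
  using roomy_room by (simp add: roomy_def base3_def base2_def)

lemma mem_less: "mem (init_state xs) i < 2 ^ room k J s"
proof (cases "i < length xs")
  case True
  have "xs ! i < 2 ^ bits (xs ! i)" by (rule bits_gt)
  also have "\<dots> \<le> 2 ^ room k J s"
    using bits_le_input_size[of "xs ! i" xs] True by (intro power_increasing) (auto simp: room_def)
  finally show ?thesis using True by (simp add: init_state_def)
qed (simp add: init_state_def)

section \<open>The output as a solution of the instance, and its expected revenue\<close>

definition sol_price :: "bool list \<Rightarrow> nat \<Rightarrow> real" where
  "sol_price r v = real (prc (side r) (round_of r) v) / real (\<Prod>e<m. d e)"

definition sol :: "bool list \<Rightarrow> nat set" where
  "sol r = sol_edges (side r) (round_of r)"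

lemma denominator_pos: "0 < (\<Prod>e<m. d e)"
  using edge by (intro prod_pos) auto

lemma bundle_eq: "e < m \<Longrightarrow> bundle_price I q e = q (U e) + q (V e)"
  using edge[of e] no_loop[of e] by (simp add: bundle_price_def)

lemma budget_eq: "e < m \<Longrightarrow> budget I e = real (\<beta> e) / real (\<Prod>e<m. d e)"
  using edge[of e] \<beta>_div[of e] edge by simp

lemma kappa_le_cap: "enat (\<kappa> w) \<le> cap I w \<or> cap I w = \<infinity>"
  by (cases "cap I w") (auto simp: \<kappa>_def)

lemma inc_iff: "e < m \<Longrightarrow> w \<in> ends I e \<longleftrightarrow> inc e w"
  using edge[of e] by (auto simp: inc_def)

lemma feasible_sol: "feasible I (sol_price r) (sol r)"
  unfolding feasible_def
proof (intro conjI ballI)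
  show "0 \<le> sol_price r v" for v by (simp add: sol_price_def prod_nonneg)
  show "sol r \<subseteq> edges I" by (auto simp: sol_def sol_edges_def edges)
next
  fix e assume e: "e \<in> sol r"
  then have "e < m" by (simp add: sol_def sol_edges_def)
  moreover have "real (prc (side r) (round_of r) (U e) + prc (side r) (round_of r) (V e)) \<le> real (\<beta> e)"
    using sol_within_budget e by (intro of_nat_mono) (auto simp: sol_def)
  moreover have "bundle_price I (sol_price r) e =
      real (prc (side r) (round_of r) (U e) + prc (side r) (round_of r) (V e)) / real (\<Prod>e<m. d e)"
    by (simp add: bundle_eq[OF \<open>e < m\<close>] sol_price_def add_divide_distrib del: of_nat_prod)
  ultimately show "bundle_price I (sol_price r) e \<le> budget I e"
    by (simp only: budget_eq[OF \<open>e < m\<close>]) (intro divide_right_mono of_nat_0_le_iff)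
next
  fix w assume "w \<in> verts I"
  then have w: "w < n" by (simp add: verts)
  have "{e \<in> sol r. w \<in> ends I e} = {e \<in> sol_edges (side r) (round_of r). inc e w}"
    using inc_iff by (auto simp: sol_def sol_edges_def)
  then show "enat (card {e \<in> sol r. w \<in> ends I e}) \<le> cap I w"
    using sol_within_cap[OF w, of "side r" "round_of r"] kappa_le_cap[of w]
    by (auto intro: order.trans[rotated])
qed

lemma revenue_sol: "revenue I (sol_price r) (sol r) = sol_revenue (side r) (round_of r) / real (\<Prod>e<m. d e)"
  unfolding revenue_def sol_revenue_def sum_divide_distrib sol_def
  by (intro sum.cong refl) (auto simp: sol_edges_def bundle_eq sol_price_def add_divide_distrib)

lemma J_le_kappa: "w < n \<Longrightarrow> J \<le> \<kappa> w"
proof (rule \<kappa>_ge)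
  assume "w < n"
  then show "cap_code (cap I w) \<noteq> 0 \<longrightarrow> J < cap_code (cap I w)"
    using cap[of w] by (cases "cap I w") auto
qed

text \<open>The truncated capacities still admit every feasible solution, as \<open>F\<close> has at
  most \<open>m\<close> edges.\<close>

lemma card_le_kappa:
  assumes "feasible I p F" "w < n"
  shows "card {e \<in> F. inc e w} \<le> \<kappa> w"
proof -
  have F: "F \<subseteq> {..<m}" using assms by (simp add: feasible_def edges)
  have "{e \<in> F. w \<in> ends I e} = {e \<in> F. inc e w}"
    using inc_iff F by auto
  moreover have "enat (card {e \<in> F. w \<in> ends I e}) \<le> cap I w"
    using assms by (auto simp: feasible_def verts)
  ultimately have "enat (card {e \<in> F. inc e w}) \<le> cap I w"
    by (simp only:)
  moreover have "card {e \<in> F. inc e w} \<le> card {..<m}"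
    using F by (intro card_mono) auto
  ultimately show ?thesis
    by (cases "cap I w") (auto simp: \<kappa>_def)
qed

lemma revenue_le_opt: "feasible I p F \<Longrightarrow> revenue I p F \<le> opt I"
  unfolding opt_def
  by (rule cSup_upper) (auto intro!: bdd_aboveI dest: revenue_bounded[OF instance_I])

lemma J_pos: "0 < J"
  using J k by (metis add_gr_0 less_le_trans mult_pos_pos zero_less_numeral zero_less_one zero_less_power)

text \<open>Selling the single edge \<open>e\<close> at its full budget, charged at one endpoint, is
  feasible because all capacities are positive. This turns the additive loss into a fraction of the
  optimum.\<close>

lemma budget_le_opt:
  assumes "e < m"
  shows "budget I e \<le> opt I"
proof -
  let ?p = "(\<lambda>_. 0)(U e := budget I e)"
  have b: "0 \<le> budget I e" using edge[OF assms] by simp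
  have "enat (card {e' \<in> {e}. w \<in> ends I e'}) \<le> cap I w" if "w < n" for w
  proof -
    have "card {e' \<in> {e}. w \<in> ends I e'} \<le> card {e}"
      by (rule card_mono) auto
    then have "enat (card {e' \<in> {e}. w \<in> ends I e'}) \<le> enat J"
      using J_pos by simp
    then show ?thesis using cap[OF that] by (rule order.trans)
  qed
  moreover have "bundle_price I ?p e = budget I e"
    using no_loop[OF assms] by (simp add: bundle_eq[OF assms])
  ultimately have "feasible I ?p {e}"
    using assms b by (auto simp: feasible_def verts edges)
  then show ?thesis
    using revenue_le_opt[of ?p "{e}"] \<open>bundle_price I ?p e = budget I e\<close> by (simp add: revenue_def)
qed

lemma opt_nonneg: "0 \<le> opt I"
  using revenue_le_opt[OF feasible_empty] by (simp add: revenue_def)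

abbreviation mean_revenue :: "nat \<Rightarrow> real" where
  "mean_revenue l \<equiv> measure_pmf.expectation (pmf_of_set {r. length r = l}) (\<lambda>r. revenue I (sol_price r) (sol r))"

text \<open>Multiplying all prices by the common denominator turns a feasible solution into a
  competitor for the scaled problem. The competitor is arbitrary because the optimum is defined as a
  supremum.\<close>

lemma expected_revenue_ge:
  assumes len: "coins \<le> l" and p: "feasible I p F"
  shows "(1 - 1 / real k) * ((1 - 1 / real k) / 4 * revenue I p F - opt I / (2 * real k)) \<le>
    mean_revenue l"
proof -
  let ?D = "real (\<Prod>e<m. d e)"
  have D: "0 < ?D" using denominator_pos by (simp only: of_nat_0_less_iff)
  let ?p = "\<lambda>v. ?D * p v"
  have F: "F \<subseteq> {..<m}" using p by (simp add: feasible_def edges)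
  have rev: "(\<Sum>e\<in>F. ?p (U e) + ?p (V e)) = ?D * revenue I p F"
    unfolding revenue_def sum_distrib_left using F by (intro sum.cong) (auto simp: bundle_eq distrib_left)
  have beta: "real (\<beta> e) = ?D * budget I e" if "e < m" for e
    using D by (simp add: budget_eq[OF that] del: of_nat_prod)
  have "2 ^ n * real rounds ^ n * ((1 - 1 / real k) *
      ((1 - 1 / real k) / 4 * (\<Sum>e\<in>F. ?p (U e) + ?p (V e)) - ?D * opt I / (2 * real k))) \<le>
    revenue_sum"
  proof (rule sum_sol_revenue_sides_ge[OF _ k])
    have "?p (U e) + ?p (V e) \<le> real (\<beta> e)" if "e \<in> F" for e
    proof -
      have "e < m" using that F by auto
      have "p (U e) + p (V e) \<le> budget I e"
        using that p bundle_eq[OF \<open>e < m\<close>, of p] by (auto simp: feasible_def)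
      then show ?thesis
        using D by (simp only: beta[OF \<open>e < m\<close>] distrib_left[symmetric] mult_le_cancel_left_pos)
    qed
    moreover have "0 \<le> ?p v" if "v < n" for v using that p D by (auto simp: feasible_def verts)
    ultimately show "solution F ?p"
      using F card_le_kappa[OF p] by (auto simp: solution_def)
    show "4 * k\<^sup>2 * (k + 1) \<le> \<kappa> w" if "w < n" for w using J J_le_kappa[OF that] by linarith
    show "real (\<beta> e) \<le> ?D * opt I" if "e < m" for e
      using D budget_le_opt[OF that] by (simp only: beta[OF that] mult_le_cancel_left_pos)
    show "0 \<le> ?D * opt I" using D opt_nonneg by simp
  qed
  also have "\<dots> = 2 ^ n * real rounds ^ n *
      (?D * mean_revenue l)"
  proof -
    have "mean_revenue l =
      (\<Sum>\<sigma>\<in>PiE {..<n} (\<lambda>_. {..<2}). \<Sum>\<tau>\<in>PiE {..<n} (\<lambda>_. {..<rounds}). sol_revenue \<sigma> \<tau> / ?D) /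
        (2 ^ n * real rounds ^ n)"
      unfolding revenue_sol by (rule expectation_coins[OF len])
    moreover have "S = 2 ^ n * real rounds ^ n * (c * (S / c / (2 ^ n * real rounds ^ n)))"
      if "0 < c" for S c :: real
      using that by (simp add: rounds_def)
    ultimately show ?thesis
      using D by (simp only: sum_divide_distrib[symmetric])
  qed
  finally have "2 ^ n * real rounds ^ n * (?D * ((1 - 1 / real k) *
      ((1 - 1 / real k) / 4 * revenue I p F - opt I / (2 * real k)))) \<le> \<dots>"
    unfolding rev by (simp add: right_diff_distrib mult_ac del: of_nat_prod)
  moreover have "0 < rounds" by (simp add: rounds_def)
  ultimately show ?thesis
    using D by (simp add: mult_le_cancel_left_pos del: of_nat_prod)
qed

lemma expected_revenue:
  assumes len: "coins \<le> l"
  shows "(1 - 1 / real k) * ((1 - 1 / real k) / 4 - 1 / (2 * real k)) * opt I \<le>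
    mean_revenue l"
    (is "_ \<le> ?E")
\<comment> \<open>For \<open>k = 1\<close> the left-hand side vanishes and nonnegative revenue
  suffices; otherwise \<open>1 - 1 / k\<close> can be divided by.\<close>
proof (cases "k = 1")
  case True
  have "0 \<le> ?E"
    by (intro Bochner_Integration.integral_nonneg)
      (simp add: revenue_sol sol_revenue_def sum_nonneg prod_nonneg)
  then show ?thesis using True by simp
next
  case False
  then have q: "0 < 1 - 1 / real k" using k by simp
  define q where "q = 1 - 1 / real k"
  note q = q[folded q_def]
  \<comment> \<open>The bound of \<open>expected_revenue_ge\<close> solved for the revenue of the
    competitor; as it does not mention the competitor, it passes to the supremum.\<close>
  let ?X = "(?E / q + opt I / (2 * real k)) * (4 / q)"
  have "revenue I p F \<le> ?X" if "feasible I p F" for p F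
    using expected_revenue_ge[OF len that, folded q_def] q by (simp add: field_simps)
  moreover have "{revenue I p F |p F. feasible I p F} \<noteq> {}"
    using feasible_empty by blast
  ultimately have "Sup {revenue I p F |p F. feasible I p F} \<le> ?X"
    by (intro cSup_least) blast+
  then have "opt I \<le> ?X"
    by (simp only: opt_def)
  then show ?thesis
    unfolding q_def[symmetric] using q by (simp add: field_simps)
qed

lemma encodes_output:
  assumes "reg t 0 = 2 * n + m" "\<And>x. x < 2 * n + m \<Longrightarrow> mem t x = outval (side r) (round_of r) x"
  shows "encodes_solution (output_of t) I (sol_price r) (sol r)"
proof -
  let ?a = "prc (side r) (round_of r)" and ?D = "\<Prod>e<m. d e"
  let ?ys = "concat (map (\<lambda>v. [?a v, ?D]) [0..<n]) @ map (\<lambda>e. of_bool (e \<in> sol r)) [0..<m]"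
  have len: "length (concat (map (\<lambda>v. [?a v, ?D]) [0..<n])) = 2 * n"
    by (rule length_concat_map) simp
  have "output_of t = ?ys"
  proof (rule nth_equalityI)
    show "length (output_of t) = length ?ys" using assms(1) len by (simp add: output_of_def)
    fix x assume "x < length (output_of t)"
    then have x: "x < 2 * n + m" using assms(1) by (simp add: output_of_def)
    then have "output_of t ! x = outval (side r) (round_of r) x"
      using assms by (simp add: output_of_def)
    also have "\<dots> = ?ys ! x"
    proof (cases "x < 2 * n")
      case True
      then have v: "x div 2 < n" by auto
      have "?ys ! x = concat (map (\<lambda>v. [?a v, ?D]) [0..<n]) ! (2 * (x div 2) + x mod 2)"
        using True len by (simp add: nth_append)
      also have "\<dots> = [?a (x div 2), ?D] ! (x mod 2)"
        using v by (intro nth_concat_map) auto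
      also have "\<dots> = outval (side r) (round_of r) x"
      proof (cases "even x")
        case True
        then obtain v where "x = 2 * v" by blast
        then show ?thesis using v by (simp add: outval)
      next
        case False
        then obtain v where "x = Suc (2 * v)" by (metis oddE Suc_eq_plus1)
        then show ?thesis using v by (simp add: outval)
      qed
      finally show ?thesis by simp
    next
      case False
      then obtain e where e: "x = 2 * n + e" "e < m" using x by (metis le_Suc_ex linorder_not_less nat_add_left_cancel_less)
      then show ?thesis using len by (simp add: outval nth_append sol_def sol_edges_def)
    qed
    finally show "output_of t ! x = ?ys ! x" .
  qed
  then show ?thesis
    unfolding encodes_solution_def
    by (intro exI[of _ ?a] exI[of _ "\<lambda>_. ?D"]) (use denominator_pos in \<open>simp add: verts edges sol_price_def\<close>)
qed

end

text \<open>With \<open>x = 1 / k\<close> the right-hand side is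
  \<open>(1 - 4 * x) / 4 + 3 / 4 * x^2\<close>, and the left-hand side is
  \<open>(1 - 4 * y) / 4\<close> for \<open>y = \<epsilon> / (4 * (4 + \<epsilon>))\<close>. The
  hypothesis on \<open>k\<close> says \<open>x \<le> y\<close>.\<close>

lemma ratio_ge:
  fixes \<epsilon> :: real
  assumes "0 < \<epsilon>" "4 * (4 + \<epsilon>) / \<epsilon> \<le> real k"
  shows "1 / (4 + \<epsilon>) \<le> (1 - 1 / real k) * ((1 - 1 / real k) / 4 - 1 / (2 * real k))"
proof -
  define x where "x = 1 / real k"
  have "0 < 4 * (4 + \<epsilon>) / \<epsilon>" using assms(1) by (intro divide_pos_pos) auto
  then have "0 < real k" using assms(2) by linarith
  then have x: "0 < x" "x \<le> \<epsilon> / (4 * (4 + \<epsilon>))"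
    using assms by (simp_all add: x_def field_simps)
  have "1 / (4 + \<epsilon>) = (1 - 4 * (\<epsilon> / (4 * (4 + \<epsilon>)))) / 4"
    using assms(1) by (simp add: field_simps)
  also have "\<dots> \<le> (1 - 4 * x) / 4" using x by simp
  also have "\<dots> \<le> (1 - x) * ((1 - x) / 4 - x / 2)"
  proof -
    have "(1 - x) * ((1 - x) / 4 - x / 2) = (1 - 4 * x) / 4 + 3 / 4 * (x * x)"
      by (simp add: field_simps)
    then show ?thesis by simp
  qed
  finally show ?thesis by (simp add: x_def mult.commute)
qed

theorem theorem8:
  fixes \<epsilon> :: real
  assumes "\<epsilon> > 0"
  shows "\<exists>C::real. C \<ge> 0 \<and>
    admits_randomized_polytime_approx (4 + \<epsilon>)
      {I. cgp_instance I \<and> simple_graph I \<and> (\<forall>v\<in>verts I. ereal C \<le> ereal_of_enat (cap I v))}"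
proof -
  obtain k :: nat where k_large: "4 * (4 + \<epsilon>) / \<epsilon> \<le> real k" using real_arch_simple by blast
  have "0 < 4 * (4 + \<epsilon>) / \<epsilon>" using assms by (intro divide_pos_pos) auto
  then have k0: "0 < k" using k_large by (cases k) auto
  \<comment> \<open>The capacity threshold that \<open>exp_moment_small\<close> asks for; it becomes
    the constant \<open>C\<close>.\<close>
  define J where "J = 4 * k\<^sup>2 * (k + 1)"
  obtain f where f: "pbd f" "run_bound k J f"
    using pricing_program_realizes by blast
  \<comment> \<open>The second summand makes the time bound large enough for a coin sequence of that
    length to supply all tosses of the program.\<close>
  have "pbd (\<lambda>s. f (room k J s) + room k J s)"
    by (intro pbd_add pbd_comp[OF f(1)] pbd_room)
  then obtain E where E: "f (room k J s) + room k J s \<le> (s + 2) ^ E" for s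
    unfolding pbd_def by blast
  have "admits_randomized_polytime_approx (4 + \<epsilon>)
      {I. cgp_instance I \<and> simple_graph I \<and> (\<forall>v\<in>verts I. ereal (real J) \<le> ereal_of_enat (cap I v))}"
    unfolding admits_randomized_polytime_approx_def Let_def
  proof (intro exI[of _ "pricing_program k J"] exI[of _ "[:2, 1:] ^ E"] ballI allI impI)
    fix I xs
    assume I: "I \<in> {I. cgp_instance I \<and> simple_graph I \<and> (\<forall>v\<in>verts I. ereal (real J) \<le> ereal_of_enat (cap I v))}"
      and enc: "encodes_instance xs I"
    obtain n m U V a d where e: "verts I = {..<n}" "edges I = {..<m}"
      "\<forall>e<m. ends I e = {U e, V e} \<and> d e > 0 \<and> budget I e = real (a e) / real (d e)"
      "xs = [n, m] @ map (\<lambda>w. cap_code (cap I w)) [0..<n] @ concat (map (\<lambda>e. [U e, V e, a e, d e]) [0..<m])"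
      using enc unfolding encodes_instance_def by blast
    have "enat J \<le> cap I w" if "w < n" for w
    proof -
      have "ereal (real J) \<le> ereal_of_enat (cap I w)" using I e(1) that by auto
      then show ?thesis by (cases "cap I w") auto
    qed
    then interpret encoded_instance I xs n m k J U V a d
      using I e k0 by unfold_locales (auto simp: J_def)
    let ?T = "poly ([:2, 1:] ^ E) s"
    have T: "?T = (s + 2) ^ E"
      by (simp add: poly_power add.commute)
    have coins_T: "coins \<le> ?T" and f_T: "f (room k J s) \<le> ?T"
      using E[of s] coins_le_room unfolding T by linarith+
    show "\<exists>p F. (\<forall>r. length r = ?T \<longrightarrow> feasible I (p r) (F r) \<and>
        (\<exists>ys. computes_within (pricing_program k J) xs r ys ?T \<and> encodes_solution ys I (p r) (F r))) \<and>
      1 / (4 + \<epsilon>) * opt I \<le> measure_pmf.expectation (pmf_of_set {r. length r = ?T}) (\<lambda>r. revenue I (p r) (F r))"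
    proof (intro exI[of _ sol_price] exI[of _ sol] conjI allI impI)
      fix r :: "bool list" assume r: "length r = ?T"
      show "feasible I (sol_price r) (sol r)" by (rule feasible_sol)
      have "length xs \<le> room k J s"
        using length_le_input_size[of xs] by (simp add: room_def)
      then obtain \<rho>' M' r' where run: "realizes (pricing_program k J) ((\<lambda>_. 0)(0 := length xs)) (mem (init_state xs)) r \<rho>' M' r' (f (room k J s))"
        "\<rho>' 0 = 2 * n + m" "\<forall>x<2 * n + m. M' x = outval (side r) (round_of r) x"
        using f(2)[unfolded run_bound_def, rule_format, OF graph_program_I init_mem_xs roomy_room, of "length xs" r]
          mem_less coins_T r by auto
      have "represents ((\<lambda>_. 0)(0 := length xs)) (mem (init_state xs)) (init_state xs)"
        by (simp add: represents_def init_state_def)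
      then obtain t where t: "runs (pricing_program k J) (init_state xs) r t r' (f (room k J s))" "represents \<rho>' M' t"
        using run(1) unfolding realizes_def by blast
      have "computes_within (pricing_program k J) xs r (output_of t) ?T"
        using runs_mono[OF t(1) f_T] unfolding runs_def computes_within_def by blast
      moreover have "encodes_solution (output_of t) I (sol_price r) (sol r)"
        by (rule encodes_output) (use t(2) run in \<open>auto simp: represents_def\<close>)
      ultimately show "\<exists>ys. computes_within (pricing_program k J) xs r ys ?T \<and> encodes_solution ys I (sol_price r) (sol r)"
        by blast
    next
      have "1 / (4 + \<epsilon>) * opt I \<le> (1 - 1 / real k) * ((1 - 1 / real k) / 4 - 1 / (2 * real k)) * opt I"
        using ratio_ge[OF assms k_large] opt_nonneg by (rule mult_right_mono)
      also note expected_revenue[OF coins_T]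
      finally show "1 / (4 + \<epsilon>) * opt I \<le>
          measure_pmf.expectation (pmf_of_set {r. length r = ?T}) (\<lambda>r. revenue I (sol_price r) (sol r))" .
    qed
  qed
  then show ?thesis
    by (intro exI[of _ "real J"]) simp
qed

end
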